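(* Let $(G,\rho)$ be a non-crossing framework in the plane, with $G$ $2$-connected, with a self-stress $\omega$ that is non-zero on every edge and such that the corresponding reciprocal $(G^*,\rho^* )$ is non-crossing, and let $(G,\mu)$ be its standard lifting. (i) $(G,\mu)$ has a unique local (and global) maximum point; it is a vertex whose reciprocal face is bounded by the boundary cycle of $(G^*,\rho^* )$ (i.e. it is reciprocal to the outer face), and all edges incident to it have self-stress of sign opposite to those on the boundary of $(G,\rho)$. (ii) The maximum is the unique point where the lifted surface is "pointed", meaning that there is a plane in $\mathbb{R}^3$ passing through the point and leaving a neighborhood of it in the surface (except for the point itself) in one of its two open half-spaces. (iii) The boundary (outer) face is the unique local minimum of $(G,\mu)$.
   Context: Framework: a finite simple graph $G=(V,E)$ with a map $\rho:V\to\mathbb{R}^2$, $\rho(i)=p_i$, edges drawn as straight segments; non-crossing if vertices are distinct points and two edge segments meet at most in a common endpoint (a vertex never lies in the interior of an edge). Vertices with two angles equal to $\pi$ are not allowed. Self-stress: $\omega:E\to\mathbb{R}$ with $\sum_{j:ij\in E}\omega_{ij}(p_i-p_j)=0$ for every $i\in V$. Reciprocal: $G^*$ is the dual plane graph of the non-crossing drawing $(G,\rho)$ (one vertex per face, including the outer one; one edge per edge). The reciprocal $(G^*,\rho^* )$ determined by $\omega$ is the framework, unique up to translation, such that for every directed edge $i\to j$ with face $L$ on its left and $R$ on its right, $\rho^*(L)-\rho^*(R)=\omega_{ij}(p_j-p_i)$. It is non-crossing if $(G^*,\rho^* )$ is a non-crossing framework and its embedding is dual to that of $(G,\rho)$: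 face cycles of $(G,\rho)$ become vertex cycles (cyclic orders of edges around vertices) of $(G^*,\rho^* )$ and vertex cycles become face cycles, either all with the same orientation or all with reversed orientation (orientation of the outer face being considered from outside). In that case every vertex of $G$ is reciprocal to a face of $(G^*,\rho^* )$. When the reciprocal is non-crossing, all edges of the boundary cycle of $(G,\rho)$ have the same sign in $\omega$. The standard lifting $(G,\mu)$ is the graph (a surface over the whole plane) of the continuous function $h:\mathbb{R}^2\to\mathbb{R}$ that is affine on each face (including the outer face), identically $0$ on the outer face, and satisfies, for every directed edge $i\to j$ with left face $L$ and right face $R$, $\nabla h|_L-\nabla h|_R=c\,\omega_{ij}\,J(p_j-p_i)$, where $J$ is the counterclockwise rotation by $90^\circ$ and $c\in\{1,-1\}$ is chosen so that the boundary edges are valleys ($c\,\omega_{ij}>0$ on boundary edges). Edges with $c\,\omega_{ij}>0$ are valleys, those with $c\,\omega_{ij}<0$ are ridges. *)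

theory Defs
  imports "HOL-Analysis.Analysis"
begin

text \<open>
  The plane is the type \<open>complex\<close> with its Euclidean inner product; the counterclockwise rotation
  by a right angle is multiplication by \<open>\<i>\<close>, and three-space is \<open>complex \<times> real\<close>. A simple graph
  is a finite vertex set \<open>V\<close> together with a set \<open>E\<close> of two-element subsets of \<open>V\<close>; a directed
  edge is a pair \<open>(i, j)\<close> with \<open>{i, j} \<in> E\<close>.
\<close>

definition simple_graph :: "'v set \<Rightarrow> 'v set set \<Rightarrow> bool" where
  "simple_graph V E \<longleftrightarrow> finite V \<and> (\<forall>e\<in>E. e \<subseteq> V \<and> card e = 2)"

text \<open>Connectedness of the subgraph induced on \<open>W\<close>.\<close>

definition connected_on :: "'v set set \<Rightarrow> 'v set \<Rightarrow> bool" where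
  "connected_on E W \<longleftrightarrow>
     (\<forall>u\<in>W. \<forall>v\<in>W. (u, v) \<in> {(x, y). x \<in> W \<and> y \<in> W \<and> {x, y} \<in> E}\<^sup>*)"

definition two_connected :: "'v set \<Rightarrow> 'v set set \<Rightarrow> bool" where
  "two_connected V E \<longleftrightarrow>
     3 \<le> card V \<and> connected_on E V \<and> (\<forall>x\<in>V. connected_on E (V - {x}))"

text \<open>
  The counterclockwise angle from the direction \<open>u\<close> to the direction \<open>w\<close>, taken in the interval
  \<open>(0, 2 \<pi>]\<close>. It is \<open>2 \<pi>\<close> when the directions coincide, so a direction is its own cyclic
  neighbour only if it is the only one.
\<close>

definition ccw_angle :: "complex \<Rightarrow> complex \<Rightarrow> real" where
  "ccw_angle u w = 2 * pi - Arg2pi (u / w)"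

definition ccw_next :: "'v set set \<Rightarrow> ('v \<Rightarrow> complex) \<Rightarrow> 'v \<Rightarrow> 'v \<Rightarrow> 'v" where
  "ccw_next E p i j = arg_min (\<lambda>k. ccw_angle (p j - p i) (p k - p i)) (\<lambda>k. {i, k} \<in> E)"

definition cw_next :: "'v set set \<Rightarrow> ('v \<Rightarrow> complex) \<Rightarrow> 'v \<Rightarrow> 'v \<Rightarrow> 'v" where
  "cw_next E p i j = arg_min (\<lambda>k. ccw_angle (p k - p i) (p j - p i)) (\<lambda>k. {i, k} \<in> E)"

text \<open>
  Straight-line non-crossing frameworks; the last clause says that at most one of the angles
  between consecutive edges at a vertex equals \<open>\<pi>\<close>.
\<close>

definition noncrossing_framework :: "'v set \<Rightarrow> 'v set set \<Rightarrow> ('v \<Rightarrow> complex) \<Rightarrow> bool" where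
  "noncrossing_framework V E p \<longleftrightarrow>
     simple_graph V E \<and> inj_on p V \<and>
     (\<forall>e\<in>E. \<forall>f\<in>E. e \<noteq> f \<longrightarrow> convex hull (p ` e) \<inter> convex hull (p ` f) \<subseteq> p ` (e \<inter> f)) \<and>
     (\<forall>v\<in>V. \<forall>e\<in>E. p v \<in> convex hull (p ` e) \<longrightarrow> v \<in> e) \<and>
     (\<forall>i\<in>V. card {j. {i, j} \<in> E \<and>
        ccw_angle (p j - p i) (p (ccw_next E p i j) - p i) = pi} \<le> 1)"

definition drawing :: "'v set \<Rightarrow> 'v set set \<Rightarrow> ('v \<Rightarrow> complex) \<Rightarrow> complex set" where
  "drawing V E p = p ` V \<union> (\<Union>e\<in>E. convex hull (p ` e))"

definition faces :: "'v set \<Rightarrow> 'v set set \<Rightarrow> ('v \<Rightarrow> complex) \<Rightarrow> complex set set" where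
  "faces V E p = components (- drawing V E p)"

definition outer_face :: "'v set \<Rightarrow> 'v set set \<Rightarrow> ('v \<Rightarrow> complex) \<Rightarrow> complex set" where
  "outer_face V E p = outside (drawing V E p)"

text \<open>
  The face to the left of the directed edge from \<open>i\<close> to \<open>j\<close>: the component of the complement
  containing all points close to the midpoint of the edge on its left-hand side. The face to the
  right is \<open>left_face V E p j i\<close>.
\<close>

definition left_face :: "'v set \<Rightarrow> 'v set set \<Rightarrow> ('v \<Rightarrow> complex) \<Rightarrow> 'v \<Rightarrow> 'v \<Rightarrow> complex set" where
  "left_face V E p i j =
     {z. \<forall>\<^sub>F t in at_right (0::real).
           connected_component (- drawing V E p)
             (midpoint (p i) (p j) + t *\<^sub>R (\<i> * (p j - p i))) z}"

definition edges_of_face ::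
    "'v set set \<Rightarrow> ('v \<Rightarrow> complex) \<Rightarrow> complex set \<Rightarrow> 'v set set" where
  "edges_of_face E p F = {e \<in> E. convex hull (p ` e) \<subseteq> frontier F}"

definition boundary_edges :: "'v set \<Rightarrow> 'v set set \<Rightarrow> ('v \<Rightarrow> complex) \<Rightarrow> 'v set set" where
  "boundary_edges V E p = edges_of_face E p (outer_face V E p)"

text \<open>
  Successor of a directed edge in the vertex cycle of its source (counterclockwise), and in the
  cycle of the face to its left, traversed with that face on the left. The latter is
  counterclockwise for bounded faces, and for the outer face it is counterclockwise as seen from
  outside.
\<close>

definition vertex_succ :: "'v set set \<Rightarrow> ('v \<Rightarrow> complex) \<Rightarrow> 'v \<times> 'v \<Rightarrow> 'v \<times> 'v" where
  "vertex_succ E p = (\<lambda>(i, j). (i, ccw_next E p i j))"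

definition face_succ :: "'v set set \<Rightarrow> ('v \<Rightarrow> complex) \<Rightarrow> 'v \<times> 'v \<Rightarrow> 'v \<times> 'v" where
  "face_succ E p = (\<lambda>(i, j). (j, cw_next E p j i))"

definition self_stress ::
    "'v set \<Rightarrow> 'v set set \<Rightarrow> ('v \<Rightarrow> complex) \<Rightarrow> ('v set \<Rightarrow> real) \<Rightarrow> bool" where
  "self_stress V E p \<omega> \<longleftrightarrow> (\<forall>i\<in>V. (\<Sum>j | {i, j} \<in> E. \<omega> {i, j} *\<^sub>R (p i - p j)) = 0)"

text \<open>
  The vertices of the dual graph are the faces; the dual of an edge is the set of the faces on its
  two sides.
\<close>

definition dual_edge ::
    "'v set \<Rightarrow> 'v set set \<Rightarrow> ('v \<Rightarrow> complex) \<Rightarrow> 'v set \<Rightarrow> complex set set" where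
  "dual_edge V E p e = {left_face V E p i j | i j. e = {i, j}}"

definition dual_edges ::
    "'v set \<Rightarrow> 'v set set \<Rightarrow> ('v \<Rightarrow> complex) \<Rightarrow> complex set set set" where
  "dual_edges V E p = dual_edge V E p ` E"

definition dual_dart ::
    "'v set \<Rightarrow> 'v set set \<Rightarrow> ('v \<Rightarrow> complex) \<Rightarrow> 'v \<times> 'v \<Rightarrow> complex set \<times> complex set" where
  "dual_dart V E p = (\<lambda>(i, j). (left_face V E p i j, left_face V E p j i))"

definition is_reciprocal ::
    "'v set \<Rightarrow> 'v set set \<Rightarrow> ('v \<Rightarrow> complex) \<Rightarrow> ('v set \<Rightarrow> real) \<Rightarrow> (complex set \<Rightarrow> complex) \<Rightarrow> bool"
  where
  "is_reciprocal V E p \<omega> q \<longleftrightarrow>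
     (\<forall>i j. {i, j} \<in> E \<longrightarrow>
        q (left_face V E p i j) - q (left_face V E p j i) = \<omega> {i, j} *\<^sub>R (p j - p i))"

text \<open>
  In the first relation face cycles become vertex cycles and vertex cycles become face cycles with
  the same orientation, in the second one with the reversed orientation. The dual of a directed
  edge points from its left to its right face. Hence, for edges leaving a vertex, the duals in
  counterclockwise order traverse the reciprocal cycle head to tail only after being reversed;
  this is the \<open>prod.swap\<close> in the first relation. In the second one the cycle is traversed
  backwards, so no swap is needed.
\<close>

definition dual_embedding_same ::
    "'v set \<Rightarrow> 'v set set \<Rightarrow> ('v \<Rightarrow> complex) \<Rightarrow> (complex set \<Rightarrow> complex) \<Rightarrow> bool" where
  "dual_embedding_same V E p q \<longleftrightarrow>
     (\<forall>i j. {i, j} \<in> E \<longrightarrow>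
        vertex_succ (dual_edges V E p) q (dual_dart V E p (i, j)) =
          dual_dart V E p (face_succ E p (i, j)) \<and>
        face_succ (dual_edges V E p) q (dual_dart V E p (prod.swap (i, j))) =
          dual_dart V E p (prod.swap (vertex_succ E p (i, j))))"

definition dual_embedding_reversed ::
    "'v set \<Rightarrow> 'v set set \<Rightarrow> ('v \<Rightarrow> complex) \<Rightarrow> (complex set \<Rightarrow> complex) \<Rightarrow> bool" where
  "dual_embedding_reversed V E p q \<longleftrightarrow>
     (\<forall>i j. {i, j} \<in> E \<longrightarrow>
        vertex_succ (dual_edges V E p) q (dual_dart V E p (face_succ E p (i, j))) =
          dual_dart V E p (i, j) \<and>
        face_succ (dual_edges V E p) q (dual_dart V E p (vertex_succ E p (i, j))) =
          dual_dart V E p (i, j))"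

text \<open>
  The injectivity clause excludes parallel edges of the dual graph, which would be drawn as
  identical segments and are invisible in the set \<open>dual_edges V E p\<close>; loops are excluded by
  \<open>simple_graph\<close>.
\<close>

definition noncrossing_reciprocal ::
    "'v set \<Rightarrow> 'v set set \<Rightarrow> ('v \<Rightarrow> complex) \<Rightarrow> (complex set \<Rightarrow> complex) \<Rightarrow> bool" where
  "noncrossing_reciprocal V E p q \<longleftrightarrow>
     inj_on (dual_edge V E p) E \<and>
     noncrossing_framework (faces V E p) (dual_edges V E p) q \<and>
     (dual_embedding_same V E p q \<or> dual_embedding_reversed V E p q)"

text \<open>\<open>F\<close> is the face of the reciprocal whose bounding cycle is dual to the vertex cycle of \<open>v\<close>.\<close>

definition is_reciprocal_face ::
    "'v set \<Rightarrow> 'v set set \<Rightarrow> ('v \<Rightarrow> complex) \<Rightarrow> (complex set \<Rightarrow> complex) \<Rightarrow> 'v \<Rightarrow> complex set \<Rightarrow> bool"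
  where
  "is_reciprocal_face V E p q v F \<longleftrightarrow>
     F \<in> faces (faces V E p) (dual_edges V E p) q \<and>
     edges_of_face (dual_edges V E p) q F = dual_edge V E p ` {e \<in> E. v \<in> e}"

text \<open>Here \<open>g F\<close> is the gradient of the height function \<open>h\<close> on the face \<open>F\<close>.\<close>

definition standard_lifting ::
    "'v set \<Rightarrow> 'v set set \<Rightarrow> ('v \<Rightarrow> complex) \<Rightarrow> ('v set \<Rightarrow> real) \<Rightarrow> (complex \<Rightarrow> real) \<Rightarrow> bool" where
  "standard_lifting V E p \<omega> h \<longleftrightarrow>
     continuous_on UNIV h \<and>
     (\<forall>x\<in>outer_face V E p. h x = 0) \<and>
     (\<exists>c\<in>{1, - 1}. \<exists>g.
        (\<forall>F\<in>faces V E p. \<exists>b. \<forall>x\<in>F. h x = g F \<bullet> x + b) \<and>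
        (\<forall>e\<in>boundary_edges V E p. c * \<omega> e > 0) \<and>
        (\<forall>i j. {i, j} \<in> E \<longrightarrow>
           g (left_face V E p i j) - g (left_face V E p j i) =
             (c * \<omega> {i, j}) *\<^sub>R (\<i> * (p j - p i))))"

definition local_max_at :: "(complex \<Rightarrow> real) \<Rightarrow> complex \<Rightarrow> bool" where
  "local_max_at h x \<longleftrightarrow> (\<forall>\<^sub>F y in nhds x. h y \<le> h x)"

definition local_min_at :: "(complex \<Rightarrow> real) \<Rightarrow> complex \<Rightarrow> bool" where
  "local_min_at h x \<longleftrightarrow> (\<forall>\<^sub>F y in nhds x. h x \<le> h y)"

definition lifted_surface :: "(complex \<Rightarrow> real) \<Rightarrow> (complex \<times> real) set" where
  "lifted_surface h = {(x, h x) | x. True}"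

text \<open>
  The plane is \<open>{Q. a \<bullet> Q = a \<bullet> P}\<close>; since \<open>a\<close> may be replaced by \<open>- a\<close>, either of its two sides
  is allowed.
\<close>

definition pointed_at :: "(complex \<times> real) set \<Rightarrow> complex \<times> real \<Rightarrow> bool" where
  "pointed_at S P \<longleftrightarrow> (\<exists>a. a \<noteq> 0 \<and> (\<forall>\<^sub>F Q in at P within S. a \<bullet> Q < a \<bullet> P))"

end

theory Submission
  imports Defs
begin

text \<open>
  Let \<open>g F\<close> be the gradient of the lifting on the face \<open>F\<close>, and \<open>O\<close> the outer face. The jump of \<open>g\<close>
  across an edge is a quarter turn of the jump of \<open>q\<close>, and \<open>g O = 0\<close>, so \<open>g F = \<plusminus>\<i> (q F - q O)\<close>
  (\<open>gradient_eq\<close>): the reciprocal is, up to a quarter turn, the diagram of the gradients, with the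
  outer face at the origin. That this diagram is drawn without crossings means that different faces
  have different gradients and that \<open>0\<close> does not lie on the segment between the gradients of two
  neighbouring faces unless \<open>O\<close> is one of them. An extremum in the interior of a face or of an edge
  would contradict this, so away from the closed outer face every local extremum is a vertex and is
  strict (\<open>local_extremum_at_vertex_strict\<close>). A point where the surface is pointed is a vertex for
  the same, simpler, reason (\<open>pointed_is_vertex\<close>).

  The heart of the proof is that at most one vertex can be pointed. The gradients of the faces around
  a vertex \<open>v\<close>, in counterclockwise order, form a closed polygon whose edges are the duals of the
  edges at \<open>v\<close>. Let \<open>winding v y\<close> be the total angle that it sweeps about a point \<open>y\<close>.

  On the one hand, the polygon of \<open>v\<close> is crossed only by passing between the reciprocal face of \<open>v\<close>
  and that of a neighbour of \<open>v\<close>, and this changes the angle by one full turn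
  (\<open>winding_across_edge\<close>). As \<open>G - v\<close> is connected, the angle is the same on the reciprocal faces of
  all vertices other than \<open>v\<close>. It vanishes on the outer face of the reciprocal. Hence it is never
  positive, unless \<open>v\<close> is the vertex \<open>w\<close> whose reciprocal face is the outer one
  (\<open>winding_nonpos\<close>). Connectedness of \<open>G - v\<close> thus replaces any appeal to the Jordan curve theorem.

  On the other hand, if a plane supports the surface at \<open>v\<close> strictly, then all angles at \<open>v\<close> are
  smaller than \<open>\<pi>\<close> and the polygon sweeps, about the slope of that plane, the sum of these angles,
  which is positive (\<open>angle_sum_around_vertex_pos\<close>, \<open>pointed_vertex\<close>). So \<open>v = w\<close>. The lifting is positive
  somewhere, so its maximum is such a vertex; being the only one, it leaves no room for another
  extremum, in particular for negative heights or for a minimum outside the closed outer face.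

  Two further points need an argument. The sign in the first computation depends on the
  orientation of the reciprocal, and the orientation-preserving case has to be excluded
  (\<open>same_embedding_impossible\<close>): each extreme vertex of \<open>G\<close> would produce, in the fan of edges at
  \<open>q O\<close>, a gap larger than \<open>\<pi>\<close>, but a fan has room for only one such gap while \<open>G\<close> has two
  extreme vertices. And all edges at \<open>w\<close> must be ridges (\<open>ridges_at_strict_maximum\<close>): an extreme
  point of the reciprocal drawing belongs to a sector of \<open>w\<close> whose two bounding edges have the same
  sign, this sign is that of a ridge because the surface descends in all directions from \<open>w\<close>, and
  every sector of \<open>w\<close> arises in this way.
\<close>

section \<open>Angles and directions in the plane\<close>

lemma ccw_angle_bounds: "0 < ccw_angle u w" "ccw_angle u w \<le> 2 * pi"
  using Arg2pi[of "u / w"] by (auto simp: ccw_angle_def)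

text \<open>
  Polar coordinates relative to \<open>u\<close>. Together with \<open>ccw_angle_unique\<close> this is the only way in which
  the definition of \<open>ccw_angle\<close> by an argument is used.
\<close>

lemma ccw_angle_polar:
  assumes "u \<noteq> 0"
  shows "w = of_real (norm w / norm u) * cis (ccw_angle u w) * u"
proof (cases "w = 0")
  case False
  have 1: "u / w = of_real (norm (u / w)) * exp (\<i> * of_real (Arg2pi (u / w)))"
    using Arg2pi(1)[of "u / w"] by (simp add: Arg2pi_eq)
  have 2: "exp (\<i> * of_real (Arg2pi (u / w))) = cis (Arg2pi (u / w))"
    by (simp add: cis_conv_exp)
  have 3: "cis (ccw_angle u w) = inverse (cis (Arg2pi (u / w)))"
    by (simp add: ccw_angle_def cis.ctr complex_eq_iff)
  define c where "c = cis (Arg2pi (u / w))"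
  have c0: "c \<noteq> 0" by (simp add: c_def)
  have "u = of_real (norm u / norm w) * c * w"
    using 1 2 False by (simp add: c_def norm_divide field_simps)
  then have "of_real (norm w / norm u) * inverse c * u
     = of_real (norm w / norm u) * inverse c * (of_real (norm u / norm w) * c * w)"
    by simp
  also have "\<dots> = w"
    using c0 assms False by (simp add: field_simps)
  finally show ?thesis using 3 by (simp add: c_def)
qed simp

lemma ccw_angle_unique:
  assumes "u \<noteq> 0" "0 < r" "0 < \<phi>" "\<phi> \<le> 2 * pi" "w = of_real r * cis \<phi> * u"
  shows "ccw_angle u w = \<phi>"
proof -
  have "u / w = of_real (inverse r) * exp (\<i> * of_real (2 * pi - \<phi>))"
  proof -
    have "exp (\<i> * of_real (2 * pi - \<phi>)) = cis (2 * pi - \<phi>)"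
      by (simp only: cis_conv_exp)
    also have "\<dots> = inverse (cis \<phi>)"
      by (simp add: complex_eq_iff)
    finally have "exp (\<i> * of_real (2 * pi - \<phi>)) = inverse (cis \<phi>)" .
    then show ?thesis using assms by (simp add: field_simps)
  qed
  then have "Arg2pi (u / w) = 2 * pi - \<phi>"
    by (intro Arg2pi_unique[of "inverse r"]) (use assms in auto)
  then show ?thesis by (simp add: ccw_angle_def)
qed

lemma ccw_angle_scale:
  assumes "r > 0" "s > 0"
  shows "ccw_angle (of_real r * u) (of_real s * w) = ccw_angle u w"
proof -
  have "of_real r * u / (of_real s * w) = of_real (r / s) * (u / w)" by simp
  then show ?thesis using assms
    by (simp only: ccw_angle_def Arg2pi_times_of_real divide_pos_pos)
qed

lemma ccw_angle_scale_right: "s > 0 \<Longrightarrow> ccw_angle u (of_real s * w) = ccw_angle u w"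
  using ccw_angle_scale[of 1 s u w] by simp

lemma ccw_angle_uminus: "ccw_angle (- u) (- w) = ccw_angle u w"
  by (simp add: ccw_angle_def)

lemma ccw_angle_add:
  assumes "u \<noteq> 0" "v \<noteq> 0" "w \<noteq> 0"
  shows "ccw_angle u v + ccw_angle v w = ccw_angle u w \<or>
         ccw_angle u v + ccw_angle v w = ccw_angle u w + 2 * pi"
proof -
  define a where "a = ccw_angle u v"
  define b where "b = ccw_angle v w"
  have ab: "0 < a" "a \<le> 2 * pi" "0 < b" "b \<le> 2 * pi"
    by (auto simp: a_def b_def ccw_angle_bounds)
  have "w = of_real (norm w / norm v) * cis b * (of_real (norm v / norm u) * cis a * u)"
    using ccw_angle_polar[of u v] ccw_angle_polar[of v w] assms by (simp add: a_def b_def)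
  then have w: "w = of_real (norm w / norm u) * cis (a + b) * u"
    using assms by (simp add: cis_mult[symmetric] field_simps)
  show ?thesis
  proof (cases "a + b \<le> 2 * pi")
    case True
    then have "ccw_angle u w = a + b"
      by (intro ccw_angle_unique[of u "norm w / norm u"]) (use assms w ab in auto)
    then show ?thesis by (simp add: a_def b_def)
  next
    case False
    have "cis (a + b - 2 * pi) = cis (a + b)"
      using cos_periodic[of "a + b - 2 * pi"] sin_periodic[of "a + b - 2 * pi"]
      by (simp add: complex_eq_iff)
    then have "ccw_angle u w = a + b - 2 * pi"
      by (intro ccw_angle_unique[of u "norm w / norm u"]) (use assms w ab False in auto)
    then show ?thesis by (simp add: a_def b_def)
  qed
qed

lemma ccw_angle_self: "u \<noteq> 0 \<Longrightarrow> ccw_angle u u = 2 * pi"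
  by (rule ccw_angle_unique[of u 1]) auto

lemma ccw_angle_opposite: "u \<noteq> 0 \<Longrightarrow> ccw_angle u (- u) = pi"
  by (rule ccw_angle_unique[of u 1]) (auto simp: complex_eq_iff)

lemma ccw_angle_eq_full_iff:
  assumes "u \<noteq> 0" "w \<noteq> 0"
  shows "ccw_angle u w = 2 * pi \<longleftrightarrow> w = of_real (norm w / norm u) * u"
proof
  assume "ccw_angle u w = 2 * pi"
  then show "w = of_real (norm w / norm u) * u"
    using ccw_angle_polar[of u w] assms by simp
next
  assume "w = of_real (norm w / norm u) * u"
  then show "ccw_angle u w = 2 * pi"
    by (intro ccw_angle_unique[of u "norm w / norm u"]) (use assms in auto)
qed

lemma ccw_angle_swap:
  assumes "u \<noteq> 0" "w \<noteq> 0" "ccw_angle u w < 2 * pi"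
  shows "ccw_angle w u = 2 * pi - ccw_angle u w"
  using ccw_angle_add[of u w u] ccw_angle_self[of u] assms ccw_angle_bounds[of w u] by auto

lemma inner_eq_cos_ccw_angle:
  assumes "u \<noteq> 0"
  shows "u \<bullet> w = norm u * norm w * cos (ccw_angle u w)"
proof -
  define \<phi> where "\<phi> = ccw_angle u w"
  have w: "w = of_real (norm w / norm u) * cis \<phi> * u"
    using ccw_angle_polar[OF assms] by (simp add: \<phi>_def)
  have "u \<bullet> w = Re (cnj u * w)" by (simp add: inner_complex_def)
  also have "cnj u * w = (cnj u * u) * (of_real (norm w / norm u) * cis \<phi>)"
    by (subst w) (simp add: algebra_simps)
  also have "cnj u * u = of_real ((norm u)\<^sup>2)"
    by (metis complex_norm_square mult.commute)
  finally show ?thesis using assms by (simp add: power2_eq_square \<phi>_def)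
qed

lemma cross_eq_sin_ccw_angle:
  assumes "u \<noteq> 0"
  shows "(\<i> * u) \<bullet> w = norm u * norm w * sin (ccw_angle u w)"
proof -
  define \<phi> where "\<phi> = ccw_angle u w"
  have w: "w = of_real (norm w / norm u) * cis \<phi> * u"
    using ccw_angle_polar[OF assms] by (simp add: \<phi>_def)
  have "(\<i> * u) \<bullet> w = Im (cnj u * w)" by (simp add: inner_complex_def)
  also have "cnj u * w = (cnj u * u) * (of_real (norm w / norm u) * cis \<phi>)"
    by (subst w) (simp add: algebra_simps)
  also have "cnj u * u = of_real ((norm u)\<^sup>2)"
    by (metis complex_norm_square mult.commute)
  finally show ?thesis using assms by (simp add: power2_eq_square \<phi>_def)
qed

text \<open>
  The inner product of \<open>w\<close> with the left normal \<open>\<i> * u\<close> is the cross product of \<open>u\<close> and \<open>w\<close>.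
\<close>

lemma ccw_angle_less_pi_iff:
  assumes "u \<noteq> 0" "w \<noteq> 0"
  shows "ccw_angle u w < pi \<longleftrightarrow> 0 < (\<i> * u) \<bullet> w"
proof -
  have "0 < (\<i> * u) \<bullet> w \<longleftrightarrow> 0 < sin (ccw_angle u w)"
    using assms by (auto simp: cross_eq_sin_ccw_angle zero_less_mult_iff mult_less_0_iff)
  moreover have "0 < sin (ccw_angle u w)" if "ccw_angle u w < pi"
    using that ccw_angle_bounds[of u w] by (simp add: sin_gt_zero)
  moreover have "sin (ccw_angle u w) \<le> 0" if "\<not> ccw_angle u w < pi"
    using that ccw_angle_bounds[of u w]
    by (cases "ccw_angle u w = 2 * pi") (auto intro: sin_le_zero)
  ultimately show ?thesis by (meson not_less)
qed

lemma cross_swap: "(\<i> * u) \<bullet> w = - ((\<i> * w) \<bullet> u)"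
  by (simp add: inner_complex_def)

text \<open>
  Cramer's rule in the plane; the coefficients are cross products.
\<close>

lemma cone_decomposition:
  fixes u w z :: complex
  shows "((\<i> * u) \<bullet> w) *\<^sub>R z = ((\<i> * z) \<bullet> w) *\<^sub>R u + ((\<i> * u) \<bullet> z) *\<^sub>R w"
  by (simp add: complex_eq_iff inner_complex_def algebra_simps)

lemma inner_neg_on_cone:
  assumes uw: "0 < (\<i> * u) \<bullet> w" and z: "0 < (\<i> * u) \<bullet> z" "0 < (\<i> * z) \<bullet> w"
    and neg: "x \<bullet> u < 0" "x \<bullet> w < 0"
  shows "x \<bullet> z < 0"
proof -
  have "((\<i> * u) \<bullet> w) * (x \<bullet> z) = ((\<i> * z) \<bullet> w) * (x \<bullet> u) + ((\<i> * u) \<bullet> z) * (x \<bullet> w)"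
    using arg_cong[OF cone_decomposition[of u w z], of "\<lambda>y. x \<bullet> y"] by (simp add: inner_add_right)
  also have "\<dots> < 0" using z neg by (intro add_neg_neg mult_pos_neg)
  finally show ?thesis using uw by (simp add: mult_less_0_iff)
qed

lemma ccw_angle_less_on_cone:
  assumes "0 < (\<i> * u) \<bullet> w" "0 < (\<i> * u) \<bullet> z" "0 < (\<i> * z) \<bullet> w"
  shows "ccw_angle u z < ccw_angle u w"
proof -
  have nz: "u \<noteq> 0" "w \<noteq> 0" "z \<noteq> 0" using assms by auto
  have "ccw_angle u z < pi" "ccw_angle z w < pi"
    using ccw_angle_less_pi_iff[OF nz(1,3)] ccw_angle_less_pi_iff[OF nz(3,2)] assms by auto
  then show ?thesis
    using ccw_angle_add[OF nz(1,3,2)] ccw_angle_bounds(1)[of z w] ccw_angle_bounds(1)[of u w] by linarith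
qed

lemma inner_rotate_self: "(\<i> * d) \<bullet> d = 0" "d \<bullet> (\<i> * d) = 0"
  by (simp_all add: inner_complex_def)

lemma perpendicular_eq_multiple:
  fixes u d :: complex
  assumes "d \<noteq> 0" "u \<bullet> d = 0"
  obtains \<alpha> where "u = \<alpha> *\<^sub>R (\<i> * d)"
proof -
  have "Im (u / (\<i> * d)) = 0"
  proof -
    have "Im (u * cnj (\<i> * d)) = - (u \<bullet> d)" by (simp add: inner_complex_def algebra_simps)
    then have "Im (u * cnj (\<i> * d)) = 0" using assms by simp
    then show ?thesis by (subst complex_div_cnj) simp
  qed
  then have "u / (\<i> * d) = of_real (Re (u / (\<i> * d)))" by (simp add: complex_eq_iff)
  then have "u = of_real (Re (u / (\<i> * d))) * (\<i> * d)" using assms by (metis nonzero_eq_divide_eq mult_eq_0_iff complex_i_not_zero)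
  then show thesis using that[of "Re (u / (\<i> * d))"] by (simp add: scaleR_conv_of_real)
qed

text \<open>
  The points of a disc other than a boundary point \<open>y\<close> lie strictly on one side of the tangent at \<open>y\<close>.
  So a farthest point from some centre is a strictly extreme point, and no ties between equally high
  points have to be broken.
\<close>

lemma farthest_point_extreme:
  fixes x y c :: complex
  assumes "x \<noteq> y" "norm (x - c) \<le> norm (y - c)"
  shows "(x - y) \<bullet> (y - c) < 0"
proof -
  have "norm (x - c)^2 \<le> norm (y - c)^2" using assms by (simp add: power_mono)
  also have "norm (x - c)^2 = norm ((x - y) + (y - c))^2" by simp
  also have "\<dots> = norm (x - y)^2 + 2 * ((x - y) \<bullet> (y - c)) + norm (y - c)^2"
    unfolding power2_norm_eq_inner inner_add_left inner_add_right
    using inner_commute[of "y - c" "x - y"] by linarith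
  finally have "norm (x - y)^2 + 2 * ((x - y) \<bullet> (y - c)) \<le> 0" by simp
  moreover have "0 < norm (x - y)^2" using assms(1) by simp
  ultimately show ?thesis by linarith
qed

lemma eventually_along_ray:
  fixes x d :: complex
  assumes "\<forall>\<^sub>F y in nhds x. P y"
  shows "\<forall>\<^sub>F t in at_right 0. P (x + t *\<^sub>R d)"
proof -
  have "((\<lambda>t. x + t *\<^sub>R d) \<longlongrightarrow> x + 0 *\<^sub>R d) (at_right 0)" by (intro tendsto_intros)
  then show ?thesis using assms by (simp add: filterlim_iff)
qed

lemma eventually_small_pos: "\<delta> > 0 \<Longrightarrow> \<forall>\<^sub>F t in at_right (0::real). 0 < t \<and> t < \<delta>"
  using eventually_at_right_field by blast

lemma ex_small_pos:
  assumes "\<forall>\<^sub>F t in at_right (0::real). P t"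
  shows "\<exists>t>0. P t"
proof -
  have "\<forall>\<^sub>F t in at_right (0::real). 0 < t \<and> P t"
    using assms eventually_at_right_less[of 0] by eventually_elim simp
  then show ?thesis using eventually_happens'[OF trivial_limit_at_right_real] by blast
qed

lemma mem_closureI: "x \<in> F \<Longrightarrow> x \<in> closure F"
  using closure_subset by blast

section \<open>Edges and faces of a straight-line plane graph\<close>

text \<open>
  The locale is interpreted for the given framework and also for its reciprocal.
\<close>

locale framework =
  fixes V :: "'v set" and E :: "'v set set" and p :: "'v \<Rightarrow> complex"
  assumes noncrossing: "noncrossing_framework V E p"
begin

abbreviation D :: "complex set" where "D \<equiv> drawing V E p"

abbreviation lface :: "'v \<Rightarrow> 'v \<Rightarrow> complex set" where "lface \<equiv> left_face V E p"

abbreviation next_ccw :: "'v \<Rightarrow> 'v \<Rightarrow> 'v" where "next_ccw \<equiv> ccw_next E p"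

abbreviation next_cw :: "'v \<Rightarrow> 'v \<Rightarrow> 'v" where "next_cw \<equiv> cw_next E p"

text \<open>
  Coordinates adapted to the directed edge from \<open>i\<close> to \<open>j\<close>: \<open>s\<close> is the position along the edge, from
  \<open>0\<close> to \<open>1\<close>, and \<open>t > 0\<close> means left of it.
\<close>

definition edge_pt :: "'v \<Rightarrow> 'v \<Rightarrow> real \<Rightarrow> real \<Rightarrow> complex" where
  "edge_pt i j s t = p i + Complex s t * (p j - p i)"

lemma graph: "simple_graph V E" and inj_p: "inj_on p V"
  using noncrossing by (auto simp: noncrossing_framework_def)

lemma finite_V: "finite V" using graph by (simp add: simple_graph_def)

lemma finite_E: "finite E"
proof (rule finite_subset)
  show "E \<subseteq> Pow V" using graph by (auto simp: simple_graph_def)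
qed (simp add: finite_V)

lemma edge_commute: "{i, j} \<in> E \<longleftrightarrow> {j, i} \<in> E"
  by (simp add: insert_commute)

lemma edgeD:
  assumes "{i, j} \<in> E"
  shows "i \<noteq> j" "i \<in> V" "j \<in> V" "p i \<noteq> p j"
proof -
  have c: "{i, j} \<subseteq> V" "card {i, j} = 2"
    using graph assms by (auto simp: simple_graph_def)
  then show "i \<noteq> j" "i \<in> V" "j \<in> V" by (auto simp: card_insert_if split: if_splits)
  then show "p i \<noteq> p j" using inj_p by (auto dest: inj_onD)
qed

lemma edgeE:
  assumes "e \<in> E"
  obtains i j where "e = {i, j}" "{i, j} \<in> E"
  using assms graph by (auto simp: simple_graph_def card_2_iff)

lemma finite_nbrs: "finite {j. {v, j} \<in> E}"
  by (rule finite_subset[OF _ finite_V]) (auto dest: edgeD)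

lemma hull_edge: "convex hull (p ` {i, j}) = closed_segment (p i) (p j)"
  by (simp add: segment_convex_hull)

lemma edges_meet:
  assumes "{i, j} \<in> E" "f \<in> E" "{i, j} \<noteq> f"
    "x \<in> closed_segment (p i) (p j)" "x \<in> convex hull (p ` f)"
  shows "x \<in> {p i, p j}"
proof -
  have "convex hull (p ` {i, j}) \<inter> convex hull (p ` f) \<subseteq> p ` ({i, j} \<inter> f)"
    using noncrossing[unfolded noncrossing_framework_def, THEN conjunct2, THEN conjunct2,
        THEN conjunct1, rule_format, OF assms(1-3)] .
  moreover have "x \<in> convex hull (p ` {i, j})" using assms(4) by (simp only: hull_edge)
  ultimately have "x \<in> p ` ({i, j} \<inter> f)" using assms(5) by blast
  then show ?thesis by blast
qed

lemma vertex_on_edge: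
  assumes "v \<in> V" "e \<in> E" "p v \<in> convex hull (p ` e)"
  shows "v \<in> e"
  using noncrossing assms by (simp add: noncrossing_framework_def)

lemma vertex_on_segment:
  assumes "v \<in> V" "{i, j} \<in> E" "p v \<in> closed_segment (p i) (p j)"
  shows "v = i \<or> v = j"
  using vertex_on_edge[of v "{i, j}"] assms unfolding hull_edge by auto

lemma compact_edge:
  assumes "e \<in> E"
  shows "compact (convex hull (p ` e))"
  using assms graph finite_V
  by (intro compact_convex_hull finite_imp_compact finite_imageI)
    (auto simp: simple_graph_def intro: finite_subset)

lemma compact_D: "compact D"
proof -
  have "compact (\<Union>e\<in>E. convex hull (p ` e))"
    using compact_edge by (intro compact_UN finite_E) auto
  then show ?thesis
    unfolding drawing_def using finite_V
    by (intro compact_Un) (auto intro: finite_imp_compact)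
qed

lemma negligible_D: "negligible D"
proof -
  have "negligible (convex hull (p ` e))" if e: "e \<in> E" for e
  proof -
    obtain i j where "e = {i, j}" using edgeE[OF e] .
    then have "convex hull (p ` e) = closed_segment (p i) (p j)" using hull_edge by simp
    moreover have "interior (closed_segment (p i) (p j)) = {}"
      by (rule interior_closed_segment_ge2) simp
    ultimately show ?thesis by (simp add: negligible_convex_interior)
  qed
  then have "negligible (\<Union>e\<in>E. convex hull (p ` e))"
    using finite_E by (intro negligible_Union) auto
  then show ?thesis
    unfolding drawing_def using finite_V by (intro negligible_Un) (auto intro: negligible_finite)
qed

lemma ex_point_off_D: "open S \<Longrightarrow> S \<noteq> {} \<Longrightarrow> \<exists>y\<in>S. y \<notin> D"
  using negligible_D negligible_subset open_not_negligible by blast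

lemma open_complement: "open (- D)"
  using compact_D compact_imp_closed by blast

lemma faces_eqI:
  assumes "F \<in> faces V E p" "G \<in> faces V E p" "x \<in> F" "x \<in> G"
  shows "F = G"
  using components_nonoverlap[of F "- D" G] assms by (auto simp: faces_def)

lemma open_face: "F \<in> faces V E p \<Longrightarrow> open F"
  unfolding faces_def using open_components open_complement by blast

lemma face_disjoint_D: "F \<in> faces V E p \<Longrightarrow> F \<inter> D = {}"
  unfolding faces_def using in_components_subset by blast

lemma off_D_in_face: "x \<notin> D \<Longrightarrow> \<exists>F\<in>faces V E p. x \<in> F"
  unfolding faces_def using Union_components[of "- D"] by blast

lemma segment_subset_D: "{i, j} \<in> E \<Longrightarrow> closed_segment (p i) (p j) \<subseteq> D"
  unfolding drawing_def using hull_edge by blast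

lemma edge_pt_swap: "edge_pt j i s t = edge_pt i j (1 - s) (- t)"
  by (simp add: edge_pt_def complex_eq_iff algebra_simps)

lemma edge_pt_real: "edge_pt v j t 0 = p v + t *\<^sub>R (p j - p v)"
  by (simp add: edge_pt_def complex_eq_iff)

lemma edge_pt_on_segment:
  assumes "p i \<noteq> p j"
  shows "edge_pt i j s t \<in> closed_segment (p i) (p j) \<longleftrightarrow> t = 0 \<and> 0 \<le> s \<and> s \<le> 1"
proof
  assume "edge_pt i j s t \<in> closed_segment (p i) (p j)"
  then obtain u where u: "0 \<le> u" "u \<le> 1" "edge_pt i j s t = (1 - u) *\<^sub>R p i + u *\<^sub>R p j"
    by (auto simp: in_segment)
  have "Complex s t * (p j - p i) = of_real u * (p j - p i)"
    using u(3) by (simp add: edge_pt_def scaleR_conv_of_real algebra_simps)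
  then have "Complex s t = of_real u" using assms by simp
  then show "t = 0 \<and> 0 \<le> s \<and> s \<le> 1" using u by (simp add: complex_eq_iff)
next
  assume a: "t = 0 \<and> 0 \<le> s \<and> s \<le> 1"
  have "Complex s 0 = of_real s" by (simp add: complex_eq_iff)
  then have "edge_pt i j s t = (1 - s) *\<^sub>R p i + s *\<^sub>R p j"
    using a by (simp add: edge_pt_def scaleR_conv_of_real algebra_simps)
  then show "edge_pt i j s t \<in> closed_segment (p i) (p j)"
    using a by (auto simp: in_segment)
qed

lemma dist_edge_pt: "dist (edge_pt i j s t) (edge_pt i j s' t') = norm (Complex (s - s') (t - t')) * norm (p j - p i)"
proof -
  have "edge_pt i j s t - edge_pt i j s' t' = Complex (s - s') (t - t') * (p j - p i)"
    by (simp add: edge_pt_def complex_eq_iff algebra_simps)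
  then show ?thesis by (simp add: dist_norm norm_mult)
qed

lemma edge_pt_endpoints: "edge_pt i j 0 0 = p i" "edge_pt i j 1 0 = p j"
  by (simp_all add: edge_pt_def complex_eq_iff)

lemma inner_edge_pt_not_endpoint:
  assumes "p i \<noteq> p j" "0 < s" "s < 1"
  shows "edge_pt i j s 0 \<notin> {p i, p j}"
proof
  assume "edge_pt i j s 0 \<in> {p i, p j}"
  then have "dist (edge_pt i j s 0) (edge_pt i j 0 0) = 0 \<or> dist (edge_pt i j s 0) (edge_pt i j 1 0) = 0"
    by (auto simp: edge_pt_endpoints)
  then show False unfolding dist_edge_pt using assms by (auto simp: complex_eq_iff)
qed

lemma continuous_edge_pt: "continuous_on S (\<lambda>x. edge_pt i j (fst x) (snd x))"
  unfolding edge_pt_def Complex_eq by (intro continuous_intros)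

lemma on_D_cases:
  assumes "x \<in> D"
  obtains v where "v \<in> V" "x = p v"
  | i j s where "{i, j} \<in> E" "0 < s" "s < 1" "x = edge_pt i j s 0"
proof (cases "x \<in> p ` V")
  case True
  then show thesis using that(1) by blast
next
  case False
  then obtain e where e: "e \<in> E" "x \<in> convex hull (p ` e)" using assms by (auto simp: drawing_def)
  obtain i j where ij: "e = {i, j}" "{i, j} \<in> E" using e(1) edgeE by blast
  obtain u where u: "0 \<le> u" "u \<le> 1" "x = (1 - u) *\<^sub>R p i + u *\<^sub>R p j"
    using e(2) unfolding ij(1) hull_edge by (auto simp: in_segment)
  have "x = edge_pt i j u 0" using u by (simp add: edge_pt_def complex_eq_iff algebra_simps)
  moreover have "u \<noteq> 0" "u \<noteq> 1" using False u(3) edgeD(2,3)[OF ij(2)] by auto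
  ultimately show thesis using that(2)[OF ij(2), of u] u by simp
qed

text \<open>
  A closed subsegment of the interior of an edge has positive distance from the compact rest of the
  drawing, because the framework is non-crossing.
\<close>

lemma strip_avoids_drawing:
  assumes ij: "{i, j} \<in> E" and "0 < a" "b < 1"
  shows "\<exists>\<delta>>0. \<forall>s t. a \<le> s \<longrightarrow> s \<le> b \<longrightarrow> t \<noteq> 0 \<longrightarrow> \<bar>t\<bar> < \<delta> \<longrightarrow> edge_pt i j s t \<notin> D"
proof -
  note e = edgeD[OF ij]
  define K where "K = (\<lambda>s. edge_pt i j s 0) ` {a..b}"
  define C where "C = p ` V \<union> (\<Union>f\<in>E - {{i, j}}. convex hull (p ` f))"
  have "compact K"
    unfolding K_def
    unfolding edge_pt_def Complex_eq
    by (intro compact_continuous_image continuous_intros) auto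
  moreover have "closed C"
  proof -
    have "compact (\<Union>f\<in>E - {{i, j}}. convex hull (p ` f))"
      using finite_E compact_edge by (intro compact_UN) auto
    then have "compact C" unfolding C_def using finite_V
      by (intro compact_Un) (auto intro: finite_imp_compact)
    then show ?thesis by (rule compact_imp_closed)
  qed
  moreover have "K \<inter> C = {}"
  proof (rule ccontr)
    assume "K \<inter> C \<noteq> {}"
    then obtain s where s: "a \<le> s" "s \<le> b" and C: "edge_pt i j s 0 \<in> C" by (auto simp: K_def)
    have seg: "edge_pt i j s 0 \<in> closed_segment (p i) (p j)"
      using edge_pt_on_segment[OF e(4)] s assms by simp
    have "edge_pt i j s 0 \<in> {p i, p j}"
    proof (cases "edge_pt i j s 0 \<in> p ` V")
      case True
      then obtain v where "v \<in> V" "edge_pt i j s 0 = p v" by blast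
      then show ?thesis using vertex_on_segment[OF _ ij, of v] seg by auto
    next
      case False
      then show ?thesis using C edges_meet[OF ij _ _ seg] by (auto simp: C_def)
    qed
    then show False using inner_edge_pt_not_endpoint[OF e(4), of s] s assms by auto
  qed
  ultimately obtain d where d: "d > 0" "\<And>x y. x \<in> K \<Longrightarrow> y \<in> C \<Longrightarrow> d \<le> dist x y"
    using separate_compact_closed[of K C] by blast
  define \<delta> where "\<delta> = d / norm (p j - p i)"
  show ?thesis
  proof (intro exI[of _ \<delta>] conjI allI impI)
    show "\<delta> > 0" using d e by (simp add: \<delta>_def)
    fix s t :: real
    assume st: "a \<le> s" "s \<le> b" "t \<noteq> 0" "\<bar>t\<bar> < \<delta>"
    have "dist (edge_pt i j s 0) (edge_pt i j s t) = \<bar>t\<bar> * norm (p j - p i)"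
      unfolding dist_edge_pt by (simp add: cmod_def)
    also have "\<dots> < d" using st e by (simp add: \<delta>_def field_simps)
    finally have "edge_pt i j s t \<notin> C" using d(2)[of "edge_pt i j s 0"] st by (force simp: K_def)
    moreover have "edge_pt i j s t \<notin> convex hull (p ` {i, j})"
      unfolding hull_edge edge_pt_on_segment[OF e(4)] using st by simp
    ultimately show "edge_pt i j s t \<notin> D" by (auto simp: C_def drawing_def)
  qed
qed

text \<open>
  The strip on the left of an edge is convex and avoids the drawing. Extended so as to reach the
  midpoint of the edge, it meets the points by which \<open>left_face\<close> is defined and lies in one face.
\<close>

lemma left_face_contains_strip:
  assumes ij: "{i, j} \<in> E" and "0 < a" "b < 1"
  shows "lface i j \<in> faces V E p \<and>
    (\<exists>\<delta>>0. \<forall>s t. a \<le> s \<longrightarrow> s \<le> b \<longrightarrow> 0 < t \<longrightarrow> t < \<delta> \<longrightarrow> edge_pt i j s t \<in> lface i j)"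
proof -
  \<comment> \<open>The range of \<open>s\<close> is enlarged to contain the midpoint \<open>s = 1/2\<close>.\<close>
  define a' where "a' = min a (1/2)"
  define b' where "b' = max b (1/2)"
  obtain \<delta> where \<delta>: "\<delta> > 0"
    "\<And>s t. a' \<le> s \<Longrightarrow> s \<le> b' \<Longrightarrow> t \<noteq> 0 \<Longrightarrow> \<bar>t\<bar> < \<delta> \<Longrightarrow> edge_pt i j s t \<notin> D"
    using strip_avoids_drawing[OF ij, of a' b'] assms by (auto simp: a'_def b'_def)
  define T where "T = (\<lambda>x. edge_pt i j (fst x) (snd x)) ` ({a'..b'} \<times> {0<..<\<delta>})"
  have "connected T"
    unfolding T_def
    by (intro connected_continuous_image continuous_edge_pt convex_connected convex_Times) auto
  moreover have "T \<subseteq> - D" using \<delta> by (auto simp: T_def)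
  ultimately have TT: "connected_component (- D) x y" if "x \<in> T" "y \<in> T" for x y
    using that by (auto intro: connected_componentI)
  have inT: "edge_pt i j s t \<in> T" if "a' \<le> s" "s \<le> b'" "0 < t" "t < \<delta>" for s t
    using that by (force simp: T_def)
  have mid: "midpoint (p i) (p j) + t *\<^sub>R (\<i> * (p j - p i)) = edge_pt i j (1/2) t" for t
    by (simp add: midpoint_def edge_pt_def complex_eq_iff algebra_simps)
  have half: "a' \<le> 1/2" "1/2 \<le> b'" by (auto simp: a'_def b'_def)
  define z0 where "z0 = edge_pt i j (1/2) (\<delta>/2)"
  have z0: "z0 \<in> T" using inT half \<delta> by (simp add: z0_def)
  have eq: "lface i j = connected_component_set (- D) z0"
  proof (intro set_eqI iffI)
    fix z assume "z \<in> lface i j"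
    then have "\<forall>\<^sub>F t in at_right (0::real). connected_component (- D) (edge_pt i j (1/2) t) z"
      by (simp add: left_face_def mid)
    moreover have "\<forall>\<^sub>F t in at_right (0::real). 0 < t \<and> t < \<delta>"
      using \<delta>(1) by (rule eventually_small_pos)
    ultimately have "\<forall>\<^sub>F t in at_right (0::real). connected_component (- D) z0 z"
    proof eventually_elim
      case (elim t)
      then show ?case using TT[OF z0 inT[of "1/2" t]] half by (meson connected_component_trans)
    qed
    then show "z \<in> connected_component_set (- D) z0" by simp
  next
    fix z assume "z \<in> connected_component_set (- D) z0"
    moreover have "\<forall>\<^sub>F t in at_right (0::real). 0 < t \<and> t < \<delta>"
      using \<delta>(1) by (rule eventually_small_pos)
    then have "\<forall>\<^sub>F t in at_right (0::real). connected_component (- D) (edge_pt i j (1/2) t) z0"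
      by eventually_elim (use TT z0 inT half in auto)
    ultimately show "z \<in> lface i j"
      unfolding left_face_def mid mem_Collect_eq
      by (elim eventually_mono) (auto intro: connected_component_trans)
  qed
  have "lface i j \<in> faces V E p"
    unfolding eq faces_def using z0 \<open>T \<subseteq> - D\<close> by (auto intro: componentsI)
  moreover have "edge_pt i j s t \<in> lface i j" if "a \<le> s" "s \<le> b" "0 < t" "t < \<delta>" for s t
    unfolding eq using TT[OF z0 inT[of s t]] that by (simp add: a'_def b'_def)
  ultimately show ?thesis using \<delta>(1) by blast
qed

lemma left_face_in_faces: "{i, j} \<in> E \<Longrightarrow> lface i j \<in> faces V E p"
  using left_face_contains_strip[of i j "1/2" "1/2"] by simp

lemma right_face_in_faces: "{i, j} \<in> E \<Longrightarrow> lface j i \<in> faces V E p"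
  using left_face_in_faces[of j i] by (simp add: insert_commute)

lemma strip_in_left_face:
  assumes "{i, j} \<in> E" "0 < a" "b < 1"
  shows "\<exists>\<delta>>0. \<forall>s t. a \<le> s \<longrightarrow> s \<le> b \<longrightarrow> 0 < t \<longrightarrow> t < \<delta> \<longrightarrow> edge_pt i j s t \<in> lface i j"
  using left_face_contains_strip[OF assms] by blast

lemma edge_neighbourhood:
  assumes ij: "{i, j} \<in> E" and s: "0 < s" "s < 1"
  shows "\<exists>\<epsilon>>0. \<forall>y. dist y (edge_pt i j s 0) < \<epsilon> \<longrightarrow>
    (\<exists>s'. 0 < s' \<and> s' < 1 \<and> y = edge_pt i j s' 0) \<or> y \<in> lface i j \<or> y \<in> lface j i"
proof -
  note e = edgeD[OF ij]
  have ji: "{j, i} \<in> E" using ij by (simp add: insert_commute)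
  define a where "a = s / 2"
  define b where "b = (1 + s) / 2"
  obtain \<delta>1 where \<delta>1: "\<delta>1 > 0"
    "\<And>s t. a \<le> s \<Longrightarrow> s \<le> b \<Longrightarrow> 0 < t \<Longrightarrow> t < \<delta>1 \<Longrightarrow> edge_pt i j s t \<in> lface i j"
    using strip_in_left_face[OF ij, of a b] s by (auto simp: a_def b_def)
  obtain \<delta>2 where \<delta>2: "\<delta>2 > 0"
    "\<And>s t. 1 - b \<le> s \<Longrightarrow> s \<le> 1 - a \<Longrightarrow> 0 < t \<Longrightarrow> t < \<delta>2 \<Longrightarrow> edge_pt j i s t \<in> lface j i"
    using strip_in_left_face[OF ji, of "1 - b" "1 - a"] s by (auto simp: a_def b_def)
  define \<eta> where "\<eta> = Min {s / 2, (1 - s) / 2, \<delta>1, \<delta>2}"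
  have \<eta>: "0 < \<eta>" "\<eta> \<le> s / 2" "\<eta> \<le> (1 - s) / 2" "\<eta> \<le> \<delta>1" "\<eta> \<le> \<delta>2"
    using s \<delta>1(1) \<delta>2(1) by (auto simp: \<eta>_def min_def)
  show ?thesis
  proof (intro exI[of _ "\<eta> * norm (p j - p i)"] conjI allI impI)
    show "0 < \<eta> * norm (p j - p i)" using \<eta> e by simp
    fix y assume y: "dist y (edge_pt i j s 0) < \<eta> * norm (p j - p i)"
    define c where "c = (y - p i) / (p j - p i)"
    define s' where "s' = Re c"
    define t where "t = Im c"
    have yst: "y = edge_pt i j s' t"
      using e by (simp add: edge_pt_def s'_def t_def c_def)
    have "norm (Complex (s' - s) (t - 0)) < \<eta>"
      using y e unfolding yst dist_edge_pt by simp
    then have st: "\<bar>s' - s\<bar> < \<eta>" "\<bar>t\<bar> < \<eta>"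
      using abs_Re_le_cmod[of "Complex (s' - s) t"] abs_Im_le_cmod[of "Complex (s' - s) t"] by auto
    have ab: "a \<le> s'" "s' \<le> b" "0 < s'" "s' < 1" using st \<eta> s by (auto simp: a_def b_def field_simps)
    consider "t = 0" | "t > 0" | "t < 0" by linarith
    then show "(\<exists>s'. 0 < s' \<and> s' < 1 \<and> y = edge_pt i j s' 0) \<or> y \<in> lface i j \<or> y \<in> lface j i"
    proof cases
      case 1 then show ?thesis using yst ab by auto
    next
      case 2 then show ?thesis using yst ab st \<eta> \<delta>1(2)[of s' t] by auto
    next
      case 3
      then have "edge_pt j i (1 - s') (- t) \<in> lface j i"
        using ab st \<eta> by (intro \<delta>2(2)) auto
      then show ?thesis using yst edge_pt_swap[of j i "1 - s'" "- t"] by simp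
    qed
  qed
qed

lemma edge_pt_in_closure:
  assumes ij: "{i, j} \<in> E" and s: "0 < s" "s < 1"
  shows "edge_pt i j s 0 \<in> closure (lface i j)"
  unfolding closure_approachable
proof (intro allI impI)
  fix \<epsilon> :: real assume "\<epsilon> > 0"
  note e = edgeD[OF ij]
  obtain \<delta> where \<delta>: "\<delta> > 0" "\<And>t. 0 < t \<Longrightarrow> t < \<delta> \<Longrightarrow> edge_pt i j s t \<in> lface i j"
    using strip_in_left_face[OF ij, of s s] s by blast
  have "0 < \<epsilon> / norm (p j - p i)" using \<open>\<epsilon> > 0\<close> e by simp
  then obtain t where t: "0 < t" "t < \<delta>" "t < \<epsilon> / norm (p j - p i)"
    using field_lbound_gt_zero[OF \<delta>(1)] by blast
  have "dist (edge_pt i j s t) (edge_pt i j s 0) = t * norm (p j - p i)"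
    unfolding dist_edge_pt using t by (simp add: cmod_def)
  also have "\<dots> < \<epsilon>" using t e by (simp add: field_simps)
  finally show "\<exists>y\<in>lface i j. dist y (edge_pt i j s 0) < \<epsilon>" using \<delta>(2) t by blast
qed

lemma segment_in_closure_left:
  assumes ij: "{i, j} \<in> E"
  shows "closed_segment (p i) (p j) \<subseteq> closure (lface i j)"
proof -
  have "open_segment (p i) (p j) \<subseteq> closure (lface i j)"
  proof
    fix x assume "x \<in> open_segment (p i) (p j)"
    then obtain u where u: "0 < u" "u < 1" "x = (1 - u) *\<^sub>R p i + u *\<^sub>R p j"
      by (auto simp: in_segment)
    have "x = edge_pt i j u 0"
      using u by (simp add: edge_pt_def complex_eq_iff algebra_simps)
    then show "x \<in> closure (lface i j)" using edge_pt_in_closure[OF ij] u by simp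
  qed
  then have "closure (open_segment (p i) (p j)) \<subseteq> closure (lface i j)"
    by (metis closure_closure closure_mono)
  then show ?thesis using edgeD(4)[OF ij] by (simp add: closure_open_segment)
qed

lemma segment_in_closure_right:
  assumes ij: "{i, j} \<in> E"
  shows "closed_segment (p i) (p j) \<subseteq> closure (lface j i)"
  using segment_in_closure_left[of j i] assms by (simp add: insert_commute closed_segment_commute)

lemma edge_pt_in_closures:
  assumes "{i, j} \<in> E" "0 \<le> s" "s \<le> 1"
  shows "edge_pt i j s 0 \<in> closure (lface i j)" "edge_pt i j s 0 \<in> closure (lface j i)"
  using segment_in_closure_left[OF assms(1)] segment_in_closure_right[OF assms(1)]
    edge_pt_on_segment[OF edgeD(4)[OF assms(1)], of s 0] assms(2,3) by auto

lemma face_touching_edge: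
  assumes ij: "{i, j} \<in> E" and s: "0 < s" "s < 1" and F: "F \<in> faces V E p"
    and cl: "edge_pt i j s 0 \<in> closure F"
  shows "F = lface i j \<or> F = lface j i"
proof -
  note e = edgeD[OF ij]
  obtain \<epsilon> where \<epsilon>: "\<epsilon> > 0" "\<And>y. dist y (edge_pt i j s 0) < \<epsilon> \<Longrightarrow>
    (\<exists>s'. 0 < s' \<and> s' < 1 \<and> y = edge_pt i j s' 0) \<or> y \<in> lface i j \<or> y \<in> lface j i"
    using edge_neighbourhood[OF ij s] by blast
  obtain y where y: "y \<in> F" "dist y (edge_pt i j s 0) < \<epsilon>"
    using cl \<epsilon>(1) by (auto simp: closure_approachable)
  have "edge_pt i j s' 0 \<in> D" if "0 < s'" "s' < 1" for s'
    using segment_subset_D[OF ij] edge_pt_on_segment[OF e(4), of s' 0] that by auto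
  then have "y \<in> lface i j \<or> y \<in> lface j i" using \<epsilon>(2)[OF y(2)] y(1) face_disjoint_D[OF F] by auto
  then show ?thesis
    using faces_eqI[OF F] y(1) left_face_in_faces[OF ij] right_face_in_faces[OF ij] by blast
qed

lemma edges_of_face_iff:
  assumes ij: "{i, j} \<in> E" and F: "F \<in> faces V E p"
  shows "{i, j} \<in> edges_of_face E p F \<longleftrightarrow> F = lface i j \<or> F = lface j i"
proof
  assume "{i, j} \<in> edges_of_face E p F"
  then have "closed_segment (p i) (p j) \<subseteq> frontier F"
    unfolding edges_of_face_def hull_edge[symmetric] by simp
  then have "edge_pt i j (1/2) 0 \<in> closure F"
    using edge_pt_on_segment[OF edgeD(4)[OF ij], of "1/2" 0] by (auto simp: frontier_def)
  then show "F = lface i j \<or> F = lface j i"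
    using face_touching_edge[OF ij _ _ F, of "1/2"] by simp
next
  assume "F = lface i j \<or> F = lface j i"
  then have "closed_segment (p i) (p j) \<subseteq> closure F"
    using segment_in_closure_left[OF ij] segment_in_closure_right[OF ij] by blast
  moreover have "closed_segment (p i) (p j) \<inter> F = {}"
    using segment_subset_D[OF ij] face_disjoint_D[OF F] by blast
  ultimately have "closed_segment (p i) (p j) \<subseteq> frontier F"
    using interior_subset by (auto simp: frontier_def)
  then show "{i, j} \<in> edges_of_face E p F"
    unfolding edges_of_face_def using hull_edge ij by auto
qed

text \<open>
  The plane without the finitely many vertices is connected, so a face has a boundary point that is
  not a vertex.
\<close>

lemma face_has_edge:
  assumes F: "F \<in> faces V E p" and "E \<noteq> {}"
  shows "\<exists>i j. {i, j} \<in> E \<and> F = lface i j"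
proof -
  obtain k l where kl: "{k, l} \<in> E" using assms edgeE by (metis all_not_in_conv)
  have conn: "connected (UNIV - p ` V)"
    by (rule connected_open_delete_finite) (auto simp: finite_V)
  have Fne: "F \<noteq> {}" using F by (auto simp: faces_def dest: in_components_nonempty)
  have Fsub: "F \<subseteq> UNIV - p ` V"
    using face_disjoint_D[OF F] by (auto simp: drawing_def)
  have notall: "\<not> UNIV - p ` V \<subseteq> F"
  proof
    assume "UNIV - p ` V \<subseteq> F"
    moreover have "edge_pt k l (1/2) 0 \<in> D"
      using segment_subset_D[OF kl] edge_pt_on_segment[OF edgeD(4)[OF kl], of "1/2" 0] by auto
    ultimately have "edge_pt k l (1/2) 0 \<in> p ` V" using face_disjoint_D[OF F] by blast
    moreover have "edge_pt k l (1/2) 0 \<in> closed_segment (p k) (p l)"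
      using edge_pt_on_segment[OF edgeD(4)[OF kl], of "1/2" 0] by auto
    moreover obtain v where "v \<in> V" "edge_pt k l (1/2) 0 = p v" using calculation(1) by blast
    ultimately have "edge_pt k l (1/2) 0 \<in> {p k, p l}" using vertex_on_segment[OF _ kl, of v] by auto
    then show False using inner_edge_pt_not_endpoint[OF edgeD(4)[OF kl], of "1/2"] by auto
  qed
  have "\<exists>x. x \<in> closure F \<and> x \<notin> F \<and> x \<notin> p ` V"
  proof (rule ccontr)
    assume "\<not> ?thesis"
    then have "UNIV - p ` V \<subseteq> F \<union> - closure F" by auto
    moreover have "F \<inter> (UNIV - p ` V) \<noteq> {}" using Fne Fsub by auto
    moreover have "- closure F \<inter> (UNIV - p ` V) \<noteq> {}" using notall calculation(1) by auto
    moreover have "F \<inter> - closure F \<inter> (UNIV - p ` V) = {}" using closure_subset by auto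
    ultimately show False
      using conn open_face[OF F] unfolding connected_def by (metis closed_closure open_Compl)
  qed
  then obtain x where x: "x \<in> closure F" "x \<notin> F" "x \<notin> p ` V" by blast
  have "x \<in> D"
  proof (rule ccontr)
    assume "x \<notin> D"
    define G where "G = connected_component_set (- D) x"
    have G: "G \<in> faces V E p" "x \<in> G"
      using \<open>x \<notin> D\<close> by (auto simp: G_def faces_def connected_component_refl_eq intro: componentsI)
    then have "G \<inter> F \<noteq> {}" using x(1) open_face[OF G(1)] open_Int_closure_eq_empty by blast
    then show False using faces_eqI[OF G(1) F] G x by auto
  qed
  then show ?thesis
  proof (cases rule: on_D_cases)
    case (1 v)
    then show ?thesis using x(3) by blast
  next
    case (2 i j s)
    then have "F = lface i j \<or> F = lface j i" using face_touching_edge[OF 2(1-3) F] x(1) by simp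
    then show ?thesis using 2(1) edge_commute by blast
  qed
qed

lemma outer_face_in_faces: "outer_face V E p \<in> faces V E p"
proof -
  have "\<not> bounded (outside D)"
    using compact_D compact_imp_bounded by (intro unbounded_outside) blast
  then have "outside D \<noteq> {}" by auto
  moreover have "connected (outside D)"
    using compact_D compact_imp_bounded by (intro connected_outside) auto
  ultimately show ?thesis
    unfolding outer_face_def faces_def outside_in_components by simp
qed

section \<open>The cyclic order of edges and the sectors at a vertex\<close>

lemma nbr_dir_nonzero: "{v, j} \<in> E \<Longrightarrow> p j - p v \<noteq> 0"
  using edgeD by fastforce

lemma same_direction_eq:
  assumes vj: "{v, j} \<in> E" and vk: "{v, k} \<in> E" and r: "0 < r" "p k - p v = of_real r * (p j - p v)"
  shows "j = k"
proof (rule ccontr)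
  assume "j \<noteq> k"
  show False
  proof (cases "r \<le> 1")
    case True
    have "p k = edge_pt v j r 0"
      using r by (simp add: edge_pt_def complex_eq_iff algebra_simps)
    then have "p k \<in> closed_segment (p v) (p j)"
      using edge_pt_on_segment[OF edgeD(4)[OF vj], of r 0] True r(1) by simp
    then show False
      using vertex_on_segment[OF edgeD(3)[OF vk] vj] \<open>j \<noteq> k\<close> edgeD(1)[OF vk] by auto
  next
    case False
    have "p j - p v = of_real (1 / r) * (p k - p v)" using r by simp
    then have "p j = edge_pt v k (1 / r) 0"
      by (simp add: edge_pt_def complex_eq_iff algebra_simps)
    then have "p j \<in> closed_segment (p v) (p k)"
      using edge_pt_on_segment[OF edgeD(4)[OF vk], of "1 / r" 0] False r(1) by simp
    then show False
      using vertex_on_segment[OF edgeD(3)[OF vj] vk] \<open>j \<noteq> k\<close> edgeD(1)[OF vj] by auto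
  qed
qed

lemma ccw_angle_full_eq:
  assumes "{v, j} \<in> E" "{v, k} \<in> E" "ccw_angle (p j - p v) (p k - p v) = 2 * pi"
  shows "j = k"
  using assms(3) ccw_angle_eq_full_iff[OF nbr_dir_nonzero[OF assms(1)] nbr_dir_nonzero[OF assms(2)]]
    nbr_dir_nonzero[OF assms(1)] nbr_dir_nonzero[OF assms(2)]
  by (intro same_direction_eq[OF assms(1,2), of "norm (p k - p v) / norm (p j - p v)"]) auto

lemma ccw_angle_less_full:
  assumes "{v, j} \<in> E" "{v, k} \<in> E" "j \<noteq> k"
  shows "ccw_angle (p j - p v) (p k - p v) < 2 * pi"
  using ccw_angle_full_eq[OF assms(1,2)] assms(3) ccw_angle_bounds(2)[of "p j - p v" "p k - p v"]
  by fastforce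

lemma ccw_angle_inj_right:
  assumes "{v, j} \<in> E" "{v, k} \<in> E" "z \<noteq> 0" "ccw_angle z (p j - p v) = ccw_angle z (p k - p v)"
  shows "j = k"
  using ccw_angle_add[of z "p j - p v" "p k - p v"] assms nbr_dir_nonzero[OF assms(1)]
    nbr_dir_nonzero[OF assms(2)] ccw_angle_bounds(1)[of "p j - p v" "p k - p v"]
  by (intro ccw_angle_full_eq[OF assms(1,2)]) auto

lemma ccw_angle_inj_left:
  assumes "{v, j} \<in> E" "{v, k} \<in> E" "z \<noteq> 0" "ccw_angle (p j - p v) z = ccw_angle (p k - p v) z"
  shows "j = k"
  using ccw_angle_add[of "p j - p v" "p k - p v" z] assms nbr_dir_nonzero[OF assms(1)]
    nbr_dir_nonzero[OF assms(2)] ccw_angle_bounds(1)[of "p j - p v" "p k - p v"]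
  by (intro ccw_angle_full_eq[OF assms(1,2)]) auto

lemma next_ccw_edge: "{v, j} \<in> E \<Longrightarrow> {v, next_ccw v j} \<in> E"
  and next_ccw_min: "{v, j} \<in> E \<Longrightarrow> {v, k} \<in> E \<Longrightarrow>
    ccw_angle (p j - p v) (p (next_ccw v j) - p v) \<le> ccw_angle (p j - p v) (p k - p v)"
  using arg_min_if_finite[OF finite_nbrs[of v], of "\<lambda>k. ccw_angle (p j - p v) (p k - p v)"]
  by (auto simp: ccw_next_def arg_min_on_def not_less)

lemma next_cw_edge: "{v, j} \<in> E \<Longrightarrow> {v, next_cw v j} \<in> E"
  and next_cw_min: "{v, j} \<in> E \<Longrightarrow> {v, k} \<in> E \<Longrightarrow>
    ccw_angle (p (next_cw v j) - p v) (p j - p v) \<le> ccw_angle (p k - p v) (p j - p v)"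
  using arg_min_if_finite[OF finite_nbrs[of v], of "\<lambda>k. ccw_angle (p k - p v) (p j - p v)"]
  by (auto simp: cw_next_def arg_min_on_def not_less)

text \<open>
  An edge met strictly between \<open>j\<close> and its counterclockwise successor would contradict the choice of
  the successor.
\<close>

lemma next_cw_next_ccw:
  assumes vj: "{v, j} \<in> E"
  shows "next_cw v (next_ccw v j) = j"
proof (rule ccontr)
  define k where "k = next_ccw v j"
  define l where "l = next_cw v k"
  assume "next_cw v (next_ccw v j) \<noteq> j"
  then have lj: "l \<noteq> j" by (simp add: l_def k_def)
  have vk: "{v, k} \<in> E" using next_ccw_edge[OF vj] by (simp add: k_def)
  have vl: "{v, l} \<in> E" using next_cw_edge[OF vk] by (simp add: l_def)
  note nz = nbr_dir_nonzero[OF vj] nbr_dir_nonzero[OF vk] nbr_dir_nonzero[OF vl]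
  have "ccw_angle (p l - p v) (p k - p v) \<le> ccw_angle (p j - p v) (p k - p v)"
    using next_cw_min[OF vk vj] by (simp add: l_def)
  moreover have "ccw_angle (p l - p v) (p k - p v) \<noteq> ccw_angle (p j - p v) (p k - p v)"
    using ccw_angle_inj_left[OF vl vj nz(2)] lj by blast
  moreover have "ccw_angle (p j - p v) (p k - p v) \<le> ccw_angle (p j - p v) (p l - p v)"
    using next_ccw_min[OF vj vl] by (simp add: k_def)
  ultimately show False
    using ccw_angle_add[OF nz(1) nz(3) nz(2)] ccw_angle_bounds(1)[of "p l - p v" "p k - p v"]
      ccw_angle_bounds(2)[of "p j - p v" "p l - p v"] by linarith
qed

lemma bij_next_ccw: "bij_betw (next_ccw v) {j. {v, j} \<in> E} {j. {v, j} \<in> E}"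
proof -
  have "inj_on (next_ccw v) {j. {v, j} \<in> E}"
    using next_cw_next_ccw by (intro inj_on_inverseI[where g = "next_cw v"]) auto
  moreover have "next_ccw v ` {j. {v, j} \<in> E} \<subseteq> {j. {v, j} \<in> E}"
    using next_ccw_edge by auto
  ultimately show ?thesis
    using endo_inj_surj[OF finite_nbrs] by (simp add: bij_betw_def)
qed

lemma next_ccw_next_cw:
  assumes vk: "{v, k} \<in> E"
  shows "next_ccw v (next_cw v k) = k"
proof -
  have "k \<in> next_ccw v ` {j. {v, j} \<in> E}"
    using bij_next_ccw[of v] vk by (simp add: bij_betw_def)
  then obtain j where "{v, j} \<in> E" "k = next_ccw v j" by blast
  then show ?thesis using next_cw_next_ccw by simp
qed

text \<open>
  As long as \<open>k\<close> is not reached, each step decreases the angle that remains to be turned up to \<open>k\<close>. So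
  the edges at a vertex form a single cycle.
\<close>

lemma next_ccw_induct:
  assumes vj: "{v, j} \<in> E" and vk: "{v, k} \<in> E" and base: "P j"
    and step: "\<And>i. {v, i} \<in> E \<Longrightarrow> P i \<Longrightarrow> P (next_ccw v i)"
  shows "P k"
proof (rule ccontr)
  assume nP: "\<not> P k"
  define S where "S = {i. {v, i} \<in> E \<and> P i}"
  \<comment> \<open>the element of \<open>S\<close> closest to \<open>k\<close> in clockwise direction\<close>
  define i where "i = arg_min_on (\<lambda>i. ccw_angle (p i - p v) (p k - p v)) S"
  have "finite S" by (rule finite_subset[OF _ finite_nbrs[of v]]) (auto simp: S_def)
  moreover have "S \<noteq> {}" using vj base by (auto simp: S_def)
  ultimately have i: "i \<in> S" and
    min: "\<And>l. l \<in> S \<Longrightarrow> ccw_angle (p i - p v) (p k - p v) \<le> ccw_angle (p l - p v) (p k - p v)"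
    using arg_min_if_finite[of S "\<lambda>i. ccw_angle (p i - p v) (p k - p v)"]
    by (auto simp: i_def not_less)
  define n where "n = next_ccw v i"
  have vi: "{v, i} \<in> E" using i by (simp add: S_def)
  have vn: "{v, n} \<in> E" using next_ccw_edge[OF vi] by (simp add: n_def)
  have nS: "n \<in> S" using i step vn by (simp add: S_def n_def)
  then have "n \<noteq> k" using nP by (auto simp: S_def)
  note nz = nbr_dir_nonzero[OF vi] nbr_dir_nonzero[OF vk] nbr_dir_nonzero[OF vn]
  have "ccw_angle (p i - p v) (p n - p v) \<le> ccw_angle (p i - p v) (p k - p v)"
    using next_ccw_min[OF vi vk] by (simp add: n_def)
  moreover have "ccw_angle (p i - p v) (p n - p v) \<noteq> ccw_angle (p i - p v) (p k - p v)"
    using ccw_angle_inj_right[OF vn vk nz(1)] \<open>n \<noteq> k\<close> by blast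
  moreover note min[OF nS]
  ultimately show False
    using ccw_angle_add[OF nz(1) nz(3) nz(2)] ccw_angle_bounds(1)[of "p i - p v" "p n - p v"]
      ccw_angle_bounds(2)[of "p n - p v" "p k - p v"] by linarith
qed

text \<open>
  The sector containing \<open>z\<close> begins at the edge from which \<open>z\<close> is reached by the smallest turn.
\<close>

lemma direction_in_sector:
  assumes vi: "{v, i} \<in> E" and z: "z \<noteq> 0"
  shows "(\<exists>j t. {v, j} \<in> E \<and> 0 < t \<and> z = of_real t * (p j - p v)) \<or>
    (\<exists>j. {v, j} \<in> E \<and> ccw_angle (p j - p v) z < ccw_angle (p j - p v) (p (next_ccw v j) - p v))"
proof (rule ccontr)
  assume neg: "\<not> ?thesis"
  define j where "j = arg_min_on (\<lambda>j. ccw_angle (p j - p v) z) {j. {v, j} \<in> E}"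
  have vj: "{v, j} \<in> E" and
    min: "\<And>l. {v, l} \<in> E \<Longrightarrow> ccw_angle (p j - p v) z \<le> ccw_angle (p l - p v) z"
    using arg_min_if_finite[OF finite_nbrs[of v], of "\<lambda>j. ccw_angle (p j - p v) z"] vi
    by (auto simp: j_def not_less)
  have nfull: "ccw_angle (p l - p v) z < 2 * pi" if "{v, l} \<in> E" for l
  proof -
    have nz: "p l - p v \<noteq> 0" using nbr_dir_nonzero[OF that] .
    have "z \<noteq> of_real (norm z / norm (p l - p v)) * (p l - p v)"
      using neg that z nz by (metis divide_pos_pos zero_less_norm_iff)
    then show ?thesis
      using ccw_angle_eq_full_iff[OF nz z] ccw_angle_bounds(2)[of "p l - p v" z] by linarith
  qed
  define n where "n = next_ccw v j"
  have vn: "{v, n} \<in> E" using next_ccw_edge[OF vj] by (simp add: n_def)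
  have "ccw_angle (p j - p v) (p n - p v) \<le> ccw_angle (p j - p v) z"
    using neg vj by (auto simp: n_def not_less)
  then show False
    using ccw_angle_add[OF nbr_dir_nonzero[OF vj] nbr_dir_nonzero[OF vn] z] min[OF vn]
      nfull[OF vn] ccw_angle_bounds(1)[of "p j - p v" "p n - p v"] by linarith
qed

lemma sectors_disjoint:
  assumes vj: "{v, j} \<in> E" and vk: "{v, k} \<in> E" and z: "z \<noteq> 0"
    and j: "ccw_angle (p j - p v) z < ccw_angle (p j - p v) (p (next_ccw v j) - p v)"
    and k: "ccw_angle (p k - p v) z < ccw_angle (p k - p v) (p (next_ccw v k) - p v)"
  shows "j = k"
proof (rule ccontr)
  have *: False if vj: "{v, j} \<in> E" and vk: "{v, k} \<in> E"
    and j: "ccw_angle (p j - p v) z < ccw_angle (p j - p v) (p (next_ccw v j) - p v)"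
    and less: "ccw_angle (p k - p v) z < ccw_angle (p j - p v) z" for j k
    using ccw_angle_add[OF nbr_dir_nonzero[OF vj] nbr_dir_nonzero[OF vk] z]
      next_ccw_min[OF vj vk] ccw_angle_bounds(1)[of "p k - p v" z] j less
      ccw_angle_bounds(2)[of "p j - p v" "p k - p v"] by linarith
  assume "j \<noteq> k"
  then have "ccw_angle (p j - p v) z \<noteq> ccw_angle (p k - p v) z"
    using ccw_angle_inj_left[OF vj vk z] by blast
  then show False using *[OF vj vk j] *[OF vk vj k] by linarith
qed

lemma vertex_neighbourhood:
  assumes v: "v \<in> V"
  shows "\<exists>r>0. \<forall>z. norm z < r \<longrightarrow> p v + z \<in> D \<longrightarrow>
    z = 0 \<or> (\<exists>j t. {v, j} \<in> E \<and> 0 < t \<and> t < 1 \<and> z = of_real t * (p j - p v))"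
proof -
  define C where "C = p ` (V - {v}) \<union> (\<Union>f\<in>{f\<in>E. v \<notin> f}. convex hull (p ` f))"
  have "compact (\<Union>f\<in>{f\<in>E. v \<notin> f}. convex hull (p ` f))"
    using finite_E compact_edge by (intro compact_UN) auto
  then have "compact C" unfolding C_def using finite_V
    by (intro compact_Un) (auto intro: finite_imp_compact)
  then have "open (- C)" using compact_imp_closed by blast
  moreover have "p v \<in> - C"
    using vertex_on_edge[OF v] inj_p v by (auto simp: C_def dest: inj_onD)
  ultimately obtain r where r: "r > 0" "ball (p v) r \<subseteq> - C" using openE by blast
  have "z = 0 \<or> (\<exists>j t. {v, j} \<in> E \<and> 0 < t \<and> t < 1 \<and> z = of_real t * (p j - p v))"
    if z: "norm z < r" "p v + z \<in> D" for z
  proof -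
    have "p v + z \<in> ball (p v) r" using z(1) by (simp add: dist_norm)
    then have nC: "p v + z \<notin> C" using r(2) by blast
    show ?thesis
    proof (cases "p v + z \<in> p ` V")
      case True
      then have "p v + z = p v" using nC by (auto simp: C_def)
      then show ?thesis by simp
    next
      case False
      then obtain e where e: "e \<in> E" "p v + z \<in> convex hull (p ` e)"
        using z(2) by (auto simp: drawing_def)
      have "v \<in> e" using e nC by (auto simp: C_def)
      obtain j where j: "e = {v, j}" using edgeE[OF e(1)] \<open>v \<in> e\<close> by auto
      obtain u where u: "0 \<le> u" "u \<le> 1" "p v + z = (1 - u) *\<^sub>R p v + u *\<^sub>R p j"
        using e(2) unfolding j hull_edge by (auto simp: in_segment)
      have zu: "z = of_real u * (p j - p v)"
        using u(3) by (simp add: complex_eq_iff algebra_simps)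
      have "u \<noteq> 0" using False v zu by auto
      moreover have "u \<noteq> 1" using False edgeD(3)[of v j] e(1) j zu by auto
      ultimately show ?thesis using zu u e(1) j by (intro disjI2 exI[of _ j] exI[of _ u]) auto
    qed
  qed
  then show ?thesis using r(1) by blast
qed

definition sector :: "'v \<Rightarrow> 'v \<Rightarrow> real \<Rightarrow> complex set" where
  "sector v j r = {p v + z | z. z \<noteq> 0 \<and> norm z < r \<and>
     ccw_angle (p j - p v) z < ccw_angle (p j - p v) (p (next_ccw v j) - p v)}"

lemma connected_sector:
  assumes vj: "{v, j} \<in> E"
  shows "connected (sector v j r)"
proof -
  define d where "d = p j - p v"
  define \<alpha> where "\<alpha> = ccw_angle d (p (next_ccw v j) - p v)"
  have d: "d \<noteq> 0" using nbr_dir_nonzero[OF vj] by (simp add: d_def)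
  have \<alpha>: "\<alpha> \<le> 2 * pi" by (simp add: \<alpha>_def ccw_angle_bounds)
  define f where "f = (\<lambda>x. p v + of_real (fst x / norm d) * cis (snd x) * d)"
  have "sector v j r = f ` ({0<..<r} \<times> {0<..<\<alpha>})"
  proof (intro set_eqI iffI)
    fix x assume "x \<in> sector v j r"
    then obtain z where z: "x = p v + z" "z \<noteq> 0" "norm z < r" "ccw_angle d z < \<alpha>"
      by (auto simp: sector_def d_def \<alpha>_def)
    have "x = f (norm z, ccw_angle d z)"
      using ccw_angle_polar[OF d, of z] z(1) by (simp add: f_def)
    then show "x \<in> f ` ({0<..<r} \<times> {0<..<\<alpha>})"
      using z ccw_angle_bounds(1)[of d z] by (intro image_eqI[of _ f "(norm z, ccw_angle d z)"]) auto
  next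
    fix x assume "x \<in> f ` ({0<..<r} \<times> {0<..<\<alpha>})"
    then obtain \<rho> \<phi> where x: "x = f (\<rho>, \<phi>)" "0 < \<rho>" "\<rho> < r" "0 < \<phi>" "\<phi> < \<alpha>" by auto
    define z where "z = of_real (\<rho> / norm d) * cis \<phi> * d"
    have "ccw_angle d z = \<phi>"
      by (rule ccw_angle_unique[of d "\<rho> / norm d"]) (use d x \<alpha> in \<open>auto simp: z_def\<close>)
    moreover have "norm z = \<rho>" using d x by (simp add: z_def norm_mult norm_divide)
    ultimately show "x \<in> sector v j r"
      unfolding sector_def d_def[symmetric] \<alpha>_def[symmetric] mem_Collect_eq
      by (intro exI[of _ z]) (use x in \<open>auto simp: f_def z_def\<close>)
  qed
  moreover have "connected (f ` ({0<..<r} \<times> {0<..<\<alpha>}))"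
    unfolding f_def cis_conv_exp
    by (intro connected_continuous_image continuous_intros convex_connected convex_Times) (use d in auto)
  ultimately show ?thesis by simp
qed

text \<open>
  Near \<open>v\<close> a sector is free of the drawing, by minimality of the next edge. It is connected and
  reaches the strips along both of its bounding edges, so the face on the left of the first edge is
  also the one on the right of the second.
\<close>

lemma sector_in_face:
  assumes v: "v \<in> V"
  shows "\<exists>r>0. \<forall>j. {v, j} \<in> E \<longrightarrow> sector v j r \<subseteq> lface v j \<and> lface v j = lface (next_ccw v j) v"
proof -
  obtain r where r: "r > 0" "\<And>z. norm z < r \<Longrightarrow> p v + z \<in> D \<Longrightarrow>
    z = 0 \<or> (\<exists>j t. {v, j} \<in> E \<and> 0 < t \<and> t < 1 \<and> z = of_real t * (p j - p v))"
    using vertex_neighbourhood[OF v] by blast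
  have "sector v j r \<subseteq> lface v j \<and> lface v j = lface (next_ccw v j) v" if vj: "{v, j} \<in> E" for j
  proof -
    define k where "k = next_ccw v j"
    have vk: "{v, k} \<in> E" using next_ccw_edge[OF vj] by (simp add: k_def)
    have kv: "{k, v} \<in> E" using vk by (simp add: insert_commute)
    define d where "d = p j - p v"
    define d' where "d' = p k - p v"
    define \<alpha> where "\<alpha> = ccw_angle d d'"
    have d: "d \<noteq> 0" "d' \<noteq> 0"
      using nbr_dir_nonzero[OF vj] nbr_dir_nonzero[OF vk] by (auto simp: d_def d'_def)
    have \<alpha>: "0 < \<alpha>" "\<alpha> \<le> 2 * pi" by (auto simp: \<alpha>_def ccw_angle_bounds)
    have sub: "sector v j r \<subseteq> - D"
    proof
      fix x assume "x \<in> sector v j r"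
      then obtain z where z: "x = p v + z" "z \<noteq> 0" "norm z < r" "ccw_angle d z < \<alpha>"
        by (auto simp: sector_def d_def \<alpha>_def d'_def k_def)
      show "x \<in> - D"
      proof
        assume "x \<in> D"
        then obtain l t where l: "{v, l} \<in> E" "0 < t" "z = of_real t * (p l - p v)"
          using r(2)[OF z(3)] z by auto
        have "ccw_angle d z = ccw_angle d (p l - p v)"
          using ccw_angle_scale_right[OF l(2)] l(3) by simp
        then show False
          using next_ccw_min[OF vj l(1)] z(4) by (simp add: d_def d'_def \<alpha>_def k_def)
      qed
    qed
    have polar: "p v + of_real (\<rho> / norm d) * cis \<phi> * d \<in> sector v j r"
      if "0 < \<rho>" "\<rho> < r" "0 < \<phi>" "\<phi> < \<alpha>" for \<rho> \<phi>
    proof -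
      define z where "z = of_real (\<rho> / norm d) * cis \<phi> * d"
      have "ccw_angle d z = \<phi>"
        by (rule ccw_angle_unique[of d "\<rho> / norm d"]) (use d \<alpha> that in \<open>auto simp: z_def\<close>)
      moreover have "norm z = \<rho>" using d that by (simp add: z_def norm_mult norm_divide)
      ultimately show ?thesis
        unfolding sector_def d_def[symmetric] d'_def[symmetric] \<alpha>_def[symmetric] k_def[symmetric]
          mem_Collect_eq
        by (intro exI[of _ z]) (use that in \<open>auto simp: z_def\<close>)
    qed
    have ev: "\<exists>\<phi>. 0 < \<phi> \<and> \<phi> < \<alpha> \<and> cos \<phi> > 1/2 \<and> sin \<phi> > 0 \<and> s * sin \<phi> < \<delta>"
      if "0 < s" "0 < \<delta>" for s \<delta> :: real
    proof -
      have "((\<lambda>\<phi>. cos \<phi>) \<longlongrightarrow> cos 0) (at_right (0::real))" by (intro tendsto_intros)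
      then have "\<forall>\<^sub>F \<phi> in at_right (0::real). cos \<phi> > 1/2" by (rule order_tendstoD) simp
      moreover have "((\<lambda>\<phi>. s * sin \<phi>) \<longlongrightarrow> s * sin 0) (at_right (0::real))" by (intro tendsto_intros)
      then have "\<forall>\<^sub>F \<phi> in at_right (0::real). s * sin \<phi> < \<delta>" by (rule order_tendstoD) (use that in simp)
      moreover have "\<forall>\<^sub>F \<phi> in at_right (0::real). 0 < \<phi> \<and> \<phi> < \<alpha>"
        using \<alpha>(1) eventually_at_right_field by blast
      moreover have "\<forall>\<^sub>F \<phi> in at_right (0::real). 0 < \<phi> \<and> \<phi> < pi"
        using pi_gt_zero eventually_at_right_field by blast
      ultimately have "\<forall>\<^sub>F \<phi> in at_right (0::real).
          0 < \<phi> \<and> \<phi> < \<alpha> \<and> cos \<phi> > 1/2 \<and> sin \<phi> > 0 \<and> s * sin \<phi> < \<delta>"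
        by eventually_elim (auto simp: sin_gt_zero)
      then show ?thesis by (metis (mono_tags, lifting) eventually_happens' trivial_limit_at_right_real)
    qed
    have left: "\<exists>x. x \<in> sector v j r \<and> x \<in> lface v j"
    proof -
      have "0 < r / norm d" using r(1) d by simp
      then obtain s where s: "0 < s" "s < r / norm d" "s < 1"
        using field_lbound_gt_zero[of "r / norm d" 1] by auto
      obtain \<delta> where \<delta>: "\<delta> > 0" "\<And>s' t. s/2 \<le> s' \<Longrightarrow> s' \<le> s \<Longrightarrow> 0 < t \<Longrightarrow> t < \<delta> \<Longrightarrow>
          edge_pt v j s' t \<in> lface v j"
        using strip_in_left_face[OF vj half_gt_zero[OF s(1)] s(3)] by blast
      obtain \<phi> where \<phi>: "0 < \<phi>" "\<phi> < \<alpha>" "cos \<phi> > 1/2" "sin \<phi> > 0" "s * sin \<phi> < \<delta>"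
        using ev[OF s(1) \<delta>(1)] by blast
      have "edge_pt v j (s * cos \<phi>) (s * sin \<phi>) \<in> lface v j"
        using s \<phi> \<delta> by (intro \<delta>(2)) auto
      moreover have "edge_pt v j (s * cos \<phi>) (s * sin \<phi>) =
          p v + of_real ((s * norm d) / norm d) * cis \<phi> * d"
        using d by (simp add: edge_pt_def d_def complex_eq_iff algebra_simps)
      moreover have "p v + of_real ((s * norm d) / norm d) * cis \<phi> * d \<in> sector v j r"
        using s \<phi> d by (intro polar) (auto simp: field_simps)
      ultimately show ?thesis by metis
    qed
    have right: "\<exists>x. x \<in> sector v j r \<and> x \<in> lface k v"
    proof -
      have "0 < r / norm d'" using r(1) d by simp
      then obtain s where s: "0 < s" "s < r / norm d'" "s < 1"
        using field_lbound_gt_zero[of "r / norm d'" 1] by auto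
      have "0 < 1 - s" "1 - s/2 < 1" using s by auto
      then obtain \<delta> where \<delta>: "\<delta> > 0" "\<And>s' t. 1 - s \<le> s' \<Longrightarrow> s' \<le> 1 - s/2 \<Longrightarrow> 0 < t \<Longrightarrow> t < \<delta> \<Longrightarrow>
          edge_pt k v s' t \<in> lface k v"
        using strip_in_left_face[OF kv, of "1 - s" "1 - s/2"] by blast
      obtain \<phi> where \<phi>: "0 < \<phi>" "\<phi> < \<alpha>" "cos \<phi> > 1/2" "sin \<phi> > 0" "s * sin \<phi> < \<delta>"
        using ev[OF s(1) \<delta>(1)] by blast
      have "edge_pt k v (1 - s * cos \<phi>) (s * sin \<phi>) \<in> lface k v"
        using s \<phi> \<delta> by (intro \<delta>(2)) auto
      moreover have "edge_pt k v (1 - s * cos \<phi>) (s * sin \<phi>) =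
          p v + of_real ((s * norm d') / norm d) * cis (\<alpha> - \<phi>) * d"
      proof -
        have "edge_pt k v (1 - s * cos \<phi>) (s * sin \<phi>) = p v + of_real s * cis (- \<phi>) * d'"
          by (simp add: edge_pt_def d'_def complex_eq_iff algebra_simps)
        also have "of_real s * cis (- \<phi>) * d' =
            of_real s * cis (- \<phi>) * (of_real (norm d' / norm d) * cis \<alpha> * d)"
          using ccw_angle_polar[OF d(1), of d'] by (simp add: \<alpha>_def)
        also have "\<dots> = of_real ((s * norm d') / norm d) * (cis (- \<phi>) * cis \<alpha>) * d"
          by (simp add: algebra_simps)
        finally show ?thesis by (simp add: cis_mult)
      qed
      moreover have "p v + of_real ((s * norm d') / norm d) * cis (\<alpha> - \<phi>) * d \<in> sector v j r"
        using s \<phi> d by (intro polar) (auto simp: field_simps)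
      ultimately show ?thesis by metis
    qed
    obtain F where F: "F \<in> faces V E p" "sector v j r \<subseteq> F"
    proof -
      obtain x where x: "x \<in> sector v j r" using left by blast
      show thesis
      proof (rule that)
        show "connected_component_set (- D) x \<in> faces V E p"
          using x sub by (auto simp: faces_def intro: componentsI)
        show "sector v j r \<subseteq> connected_component_set (- D) x"
          using connected_sector[OF vj] x sub by (intro connected_component_maximal)
      qed
    qed
    have "F = lface v j" using left F faces_eqI[OF F(1) left_face_in_faces[OF vj]] by blast
    moreover have "F = lface k v" using right F faces_eqI[OF F(1) left_face_in_faces[OF kv]] by blast
    ultimately show ?thesis using F by (simp add: k_def)
  qed
  then show ?thesis using r(1) by blast
qed

lemma vertex_star:
  assumes vi: "{v, i} \<in> E"
  shows "\<exists>r>0. \<forall>z. z \<noteq> 0 \<longrightarrow> norm z < r \<longrightarrow>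
    (\<exists>j t. {v, j} \<in> E \<and> 0 < t \<and> t < 1 \<and> z = of_real t * (p j - p v)) \<or>
    (\<exists>j. {v, j} \<in> E \<and> p v + z \<in> lface v j)"
proof -
  obtain r1 where r1: "r1 > 0" "\<And>j. {v, j} \<in> E \<Longrightarrow> sector v j r1 \<subseteq> lface v j"
    using sector_in_face[OF edgeD(2)[OF vi]] by blast
  \<comment> \<open>A radius below all edge lengths ensures \<open>t < 1\<close>.\<close>
  define r2 where "r2 = Min ((\<lambda>j. norm (p j - p v)) ` {j. {v, j} \<in> E})"
  have r2: "r2 \<le> norm (p j - p v)" if "{v, j} \<in> E" for j
    unfolding r2_def using that finite_nbrs[of v] by (intro Min_le) auto
  have "r2 \<in> (\<lambda>j. norm (p j - p v)) ` {j. {v, j} \<in> E}"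
    unfolding r2_def using vi finite_nbrs[of v] by (intro Min_in) auto
  then have "r2 > 0" using nbr_dir_nonzero by auto
  show ?thesis
  proof (intro exI[of _ "min r1 r2"] conjI allI impI)
    show "0 < min r1 r2" using r1(1) \<open>r2 > 0\<close> by simp
    fix z :: complex assume z: "z \<noteq> 0" "norm z < min r1 r2"
    from direction_in_sector[OF vi z(1)]
    show "(\<exists>j t. {v, j} \<in> E \<and> 0 < t \<and> t < 1 \<and> z = of_real t * (p j - p v)) \<or>
      (\<exists>j. {v, j} \<in> E \<and> p v + z \<in> lface v j)"
    proof (elim disjE exE conjE)
      fix j t assume j: "{v, j} \<in> E" "0 < t" "z = of_real t * (p j - p v)"
      have "t * norm (p j - p v) < norm (p j - p v)"
        using z(2) r2[OF j(1)] j(2,3) by (simp add: norm_mult)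
      then have "t < 1" using nbr_dir_nonzero[OF j(1)] by simp
      then show ?thesis using j by blast
    next
      fix j assume j: "{v, j} \<in> E" "ccw_angle (p j - p v) z < ccw_angle (p j - p v) (p (next_ccw v j) - p v)"
      have "p v + z \<in> sector v j r1" using z j by (auto simp: sector_def)
      then show ?thesis using r1(2)[OF j(1)] j(1) by blast
    qed
  qed
qed

lemma left_face_next_ccw:
  assumes "{v, j} \<in> E"
  shows "lface (next_ccw v j) v = lface v j"
  using sector_in_face[OF edgeD(2)[OF assms]] assms by metis

text \<open>
  Because of this a face cycle determines a single face.
\<close>

lemma left_face_face_succ:
  assumes ij: "{i, j} \<in> E"
  shows "lface j (next_cw j i) = lface i j"
proof -
  have ji: "{j, i} \<in> E" using ij by (simp add: insert_commute)
  show ?thesis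
    using left_face_next_ccw[OF next_cw_edge[OF ji]] next_ccw_next_cw[OF ji] by simp
qed

text \<open>
  The ray from \<open>p v\<close> in direction \<open>e\<close> leaves the half-plane that contains the drawing, so the
  sector around it belongs to the outer face. Both of its bounding edges make an obtuse angle with
  \<open>e\<close>.
\<close>

lemma extreme_vertex_outer_gap:
  assumes vi: "{v, i} \<in> E" and ext: "\<And>j. j \<in> V \<Longrightarrow> j \<noteq> v \<Longrightarrow> (p j - p v) \<bullet> e < 0"
  shows "\<exists>k. {v, k} \<in> E \<and> lface v k = outer_face V E p \<and>
    pi < ccw_angle (p k - p v) (p (next_ccw v k) - p v)"
proof -
  have v: "v \<in> V" using edgeD(2)[OF vi] .
  have neg: "(p j - p v) \<bullet> e < 0" if "{v, j} \<in> E" for j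
    using ext edgeD[OF that] by auto
  have e0: "e \<noteq> 0" using neg[OF vi] by auto
  have e2: "0 < e \<bullet> e" using e0 by simp
  obtain k where vk: "{v, k} \<in> E"
    and k: "ccw_angle (p k - p v) e < ccw_angle (p k - p v) (p (next_ccw v k) - p v)"
  proof -
    have "\<not> (\<exists>j t. {v, j} \<in> E \<and> 0 < t \<and> e = of_real t * (p j - p v))"
    proof clarify
      fix j t assume j: "{v, j} \<in> E" "0 < t" "e = of_real t * (p j - p v)"
      have "e \<bullet> e = t * ((p j - p v) \<bullet> e)"
        by (subst (1) j(3)) (simp add: scaleR_conv_of_real[symmetric])
      then show False using e2 mult_pos_neg[OF j(2) neg[OF j(1)]] by linarith
    qed
    then show thesis using direction_in_sector[OF vi e0] that by blast
  qed
  define n where "n = next_ccw v k"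
  have vn: "{v, n} \<in> E" using next_ccw_edge[OF vk] by (simp add: n_def)
  define R where "R = (\<lambda>t. p v + t *\<^sub>R e) ` {0<..}"
  have "D \<subseteq> {x. (x - p v) \<bullet> e \<le> 0}"
  proof -
    have eq: "{x. (x - p v) \<bullet> e \<le> 0} = {x. e \<bullet> x \<le> e \<bullet> p v}"
      by (auto simp: inner_diff_left inner_commute[of e])
    have pV: "p ` V \<subseteq> {x. e \<bullet> x \<le> e \<bullet> p v}"
      using ext by (force simp: inner_diff_left inner_commute[of e])
    moreover have "convex hull (p ` f) \<subseteq> {x. e \<bullet> x \<le> e \<bullet> p v}" if "f \<in> E" for f
      using that graph pV by (intro hull_minimal) (auto simp: simple_graph_def convex_halfspace_le)
    ultimately show ?thesis unfolding eq drawing_def by blast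
  qed
  moreover have "0 < (x - p v) \<bullet> e" if "x \<in> R" for x
    using that e2 by (auto simp: R_def)
  ultimately have RD: "R \<subseteq> - D" by force
  have "connected R"
    unfolding R_def by (intro connected_continuous_image continuous_intros convex_connected) auto
  have unb: "\<not> bounded R"
  proof
    assume "bounded R"
    then obtain B where B: "\<And>x. x \<in> R \<Longrightarrow> norm x \<le> B" by (auto simp: bounded_iff)
    define t where "t = (\<bar>B\<bar> + norm (p v) + 1) / norm e"
    have t: "t > 0" using e0 by (simp add: t_def add_nonneg_pos)
    have "norm (t *\<^sub>R e) = \<bar>B\<bar> + norm (p v) + 1" using e0 t by (simp add: t_def)
    moreover have "norm (t *\<^sub>R e) \<le> norm (p v + t *\<^sub>R e) + norm (p v)"
      using norm_triangle_ineq4[of "p v + t *\<^sub>R e" "p v"] by simp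
    moreover have "norm (p v + t *\<^sub>R e) \<le> B" using t by (intro B) (auto simp: R_def)
    ultimately show False by linarith
  qed
  have Rout: "R \<subseteq> outer_face V E p"
  proof
    fix x assume x: "x \<in> R"
    have "R \<subseteq> connected_component_set (- D) x"
      using \<open>connected R\<close> x RD by (intro connected_component_maximal)
    then have "\<not> bounded (connected_component_set (- D) x)" using unb bounded_subset by blast
    then show "x \<in> outer_face V E p" by (simp add: outer_face_def outside)
  qed
  obtain r where r: "r > 0" "sector v k r \<subseteq> lface v k"
    using sector_in_face[OF v] vk by blast
  define t where "t = r / (2 * norm e)"
  have t: "t > 0" "norm (t *\<^sub>R e) < r" using r e0 by (auto simp: t_def)
  have "p v + t *\<^sub>R e \<in> sector v k r"
    unfolding sector_def mem_Collect_eq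
    using t e0 k ccw_angle_scale_right[OF t(1), of "p k - p v" e]
    by (intro exI[of _ "t *\<^sub>R e"]) (auto simp: scaleR_conv_of_real)
  then have "lface v k = outer_face V E p"
    using r(2) Rout t(1) faces_eqI[OF left_face_in_faces[OF vk] outer_face_in_faces, of "p v + t *\<^sub>R e"]
    by (auto simp: R_def)
  moreover have "pi < ccw_angle (p k - p v) (p n - p v)"
  proof -
    have half: "pi / 2 < ccw_angle u w" if "u \<bullet> w < 0" "u \<noteq> 0" for u w :: complex
    proof (rule ccontr)
      assume "\<not> pi / 2 < ccw_angle u w"
      then have "0 \<le> cos (ccw_angle u w)"
        using ccw_angle_bounds(1)[of u w] by (intro cos_ge_zero) auto
      then show False using that inner_eq_cos_ccw_angle[OF that(2), of w]
        by (metis mult_nonneg_nonneg norm_ge_zero not_less)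
    qed
    have "pi / 2 < ccw_angle (p k - p v) e" "pi / 2 < ccw_angle e (p n - p v)"
      using half neg[OF vk] neg[OF vn] nbr_dir_nonzero[OF vk] e0 by (auto simp: inner_commute)
    then show ?thesis
      using ccw_angle_add[OF nbr_dir_nonzero[OF vk] e0 nbr_dir_nonzero[OF vn]] k
        ccw_angle_bounds(2)[of e "p n - p v"] by (auto simp: n_def)
  qed
  ultimately show ?thesis using vk by (auto simp: n_def)
qed

end

section \<open>The angle swept by a closed polygon\<close>

text \<open>
  The points \<open>a i\<close> and \<open>b i\<close> are the ends of the edges of a polygon. Divided by \<open>2 * pi\<close> this is the
  winding number about \<open>y\<close> if the polygon is closed, that is, if the ends \<open>b\<close> are a permutation of the
  starts \<open>a\<close>.
\<close>

definition angle_sum :: "'i set \<Rightarrow> ('i \<Rightarrow> complex) \<Rightarrow> ('i \<Rightarrow> complex) \<Rightarrow> complex \<Rightarrow> real" where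
  "angle_sum I a b y = (\<Sum>i\<in>I. Arg ((b i - y) / (a i - y)))"

lemma cis_sum: "finite I \<Longrightarrow> cis (\<Sum>i\<in>I. f i) = (\<Prod>i\<in>I. cis (f i))"
  by (induction I rule: finite_induct) (auto simp: cis_mult[symmetric])

lemma sgn_divide_complex: "sgn (x / y) = sgn x / sgn (y :: complex)"
  by (cases "x = 0 \<or> y = 0") (auto simp: sgn_eq norm_divide)

text \<open>
  The product of the unit vectors of the quotients \<open>(b i - y) / (a i - y)\<close> telescopes along the
  permutation.
\<close>

lemma angle_sum_multiple_of_full_turn:
  assumes I: "finite I" "bij_betw \<pi> I I" and b: "\<And>i. i \<in> I \<Longrightarrow> b i = a (\<pi> i)"
    and y: "\<And>i. i \<in> I \<Longrightarrow> a i \<noteq> y"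
  shows "\<exists>n::int. angle_sum I a b y = 2 * pi * of_int n"
proof -
  have bny: "b i \<noteq> y" if "i \<in> I" for i
    using b[OF that] y I(2) that by (auto dest: bij_betwE)
  have "cis (angle_sum I a b y) = (\<Prod>i\<in>I. sgn (b i - y) / sgn (a i - y))"
    unfolding angle_sum_def cis_sum[OF I(1)]
    by (intro prod.cong refl) (simp add: cis_Arg y bny sgn_divide_complex)
  also have "\<dots> = (\<Prod>i\<in>I. sgn (a (\<pi> i) - y)) / (\<Prod>i\<in>I. sgn (a i - y))"
    by (simp add: prod_dividef b cong: prod.cong)
  also have "(\<Prod>i\<in>I. sgn (a (\<pi> i) - y)) = (\<Prod>i\<in>I. sgn (a i - y))"
    by (rule prod.reindex_bij_betw[OF I(2), of "\<lambda>i. sgn (a i - y)"])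
  finally have "cis (angle_sum I a b y) = 1"
    using y I(1) by (simp add: sgn_zero_iff)
  then have "exp (\<i> * of_real (angle_sum I a b y)) = 1" by (simp add: cis_conv_exp)
  then show ?thesis unfolding exp_eq_1 by auto
qed

text \<open>
  The quotient is a non-positive real exactly if \<open>y\<close> lies between the two points.
\<close>

lemma isCont_Arg_ratio:
  assumes "y \<notin> closed_segment a b"
  shows "isCont (\<lambda>y. Arg ((b - y) / (a - y))) y"
proof -
  have ay: "a - y \<noteq> 0" using assms by auto
  have "(b - y) / (a - y) \<notin> \<real>\<^sub>\<le>\<^sub>0"
  proof
    assume "(b - y) / (a - y) \<in> \<real>\<^sub>\<le>\<^sub>0"
    then obtain r where r: "(b - y) / (a - y) = of_real r" "r \<le> 0"
      by (auto simp: nonpos_Reals_def)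
    then have "b - y = of_real r * (a - y)" using ay by (simp add: field_simps)
    then have e: "of_real (1 - r) * y = b - of_real r * a" by (simp add: algebra_simps)
    define u where "u = 1 / (1 - r)"
    have u: "0 \<le> u" "u \<le> 1" using r(2) by (auto simp: u_def)
    have "y = of_real u * (of_real (1 - r) * y)" using r(2) by (simp add: u_def flip: of_real_mult)
    also have "\<dots> = of_real u * b - of_real (u * r) * a" unfolding e by (simp add: algebra_simps)
    also have "u * r = u - 1" using r(2) by (simp add: u_def field_simps)
    finally have "y = (1 - u) *\<^sub>R a + u *\<^sub>R b" by (simp add: scaleR_conv_of_real algebra_simps)
    then show False using assms u by (auto simp: in_segment)
  qed
  then have Arg: "isCont Arg ((b - y) / (a - y))" by (rule continuous_at_Arg)
  have "isCont (\<lambda>y. (b - y) / (a - y)) y" by (intro continuous_intros ay)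
  then show ?thesis using Arg by (rule isCont_o2)
qed

lemma isCont_angle_sum:
  assumes "\<And>i. i \<in> I \<Longrightarrow> y \<notin> closed_segment (a i) (b i)"
  shows "isCont (angle_sum I a b) y"
  unfolding angle_sum_def[abs_def] by (intro continuous_intros isCont_Arg_ratio assms)

lemma angle_sum_at_infinity: "(angle_sum I a b \<longlongrightarrow> 0) at_infinity"
proof -
  have "((\<lambda>y. Arg ((b i - y) / (a i - y))) \<longlongrightarrow> 0) at_infinity" for i
  proof -
    have "((\<lambda>y. 1 + (b i - a i) * inverse (a i - y)) \<longlongrightarrow> 1 + (b i - a i) * 0) at_infinity"
    proof (intro tendsto_intros)
      have "filterlim (\<lambda>y. a i - y) at_infinity at_infinity"
      proof -
        have "filterlim (\<lambda>y. - norm (a i) + norm y) at_top at_infinity"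
          by (rule filterlim_tendsto_add_at_top[OF tendsto_const filterlim_norm_at_top])
        then have "filterlim (\<lambda>y. norm (a i - y)) at_top at_infinity"
        proof (rule filterlim_at_top_mono)
          show "\<forall>\<^sub>F y in at_infinity. - norm (a i) + norm y \<le> norm (a i - y)"
            using norm_triangle_ineq2[of _ "a i"] by (auto simp: norm_minus_commute algebra_simps)
        qed
        then show ?thesis by (rule filterlim_norm_at_top_imp_at_infinity)
      qed
      then show "((\<lambda>y. inverse (a i - y)) \<longlongrightarrow> 0) at_infinity"
        using filterlim_compose[OF tendsto_inverse_0] by blast
    qed
    moreover have "\<forall>\<^sub>F y in at_infinity. 1 + (b i - a i) * inverse (a i - y) = (b i - y) / (a i - y)"
    proof -
      have "\<forall>\<^sub>F y in at_infinity. norm (a i) + 1 \<le> norm y" by (rule eventually_at_infinityI)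
      then show ?thesis
      proof eventually_elim
        case (elim y)
        then have "a i - y \<noteq> 0" by auto
        then show ?case by (simp add: field_simps)
      qed
    qed
    ultimately have "((\<lambda>y. (b i - y) / (a i - y)) \<longlongrightarrow> 1) at_infinity"
      by (auto elim: Lim_transform_eventually)
    then have "((\<lambda>y. Arg ((b i - y) / (a i - y))) \<longlongrightarrow> Arg 1) at_infinity"
      using continuous_at_Arg[of 1] by (intro isCont_tendsto_compose[of 1 Arg]) auto
    then show ?thesis by simp
  qed
  then have "((\<lambda>y. \<Sum>i\<in>I. Arg ((b i - y) / (a i - y))) \<longlongrightarrow> (\<Sum>i\<in>I. 0)) at_infinity"
    by (intro tendsto_sum)
  then show ?thesis by (simp add: angle_sum_def[abs_def])
qed

text \<open>
  Just beside its midpoint a segment is seen at almost a straight angle, with opposite signs from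
  its two sides. This is where the winding number jumps.
\<close>

lemma Arg_ratio_beside_segment:
  fixes a b :: complex and t :: real
  assumes "a \<noteq> b" "0 < t" "t < 1/2"
  defines "z \<equiv> \<lambda>t. (a - (a + Complex (1/2) t * (b - a))) / (b - (a + Complex (1/2) t * (b - a)))"
  shows "pi / 2 < Arg (z (- t))" and "Arg (z t) = - Arg (z (- t))"
proof -
  have z: "z s = Complex (s\<^sup>2 - 1/4) (- s) / of_real (s\<^sup>2 + 1/4)" for s :: real
  proof -
    have nz: "b - a \<noteq> 0" using assms by simp
    have "b - (a + Complex (1/2) s * (b - a)) = Complex (1/2) (- s) * (b - a)"
      by (simp add: complex_eq_iff algebra_simps)
    then have "z s = (- Complex (1/2) s * (b - a)) / (Complex (1/2) (- s) * (b - a))"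
      by (simp add: z_def)
    also have "\<dots> = - Complex (1/2) s / Complex (1/2) (- s)" using nz by simp
    also have "\<dots> = Complex (s\<^sup>2 - 1/4) (- s) / of_real (s\<^sup>2 + 1/4)"
    proof -
      have "s\<^sup>2 + 1/4 \<noteq> 0" using zero_le_power2[of s] by linarith
      then have "of_real (s\<^sup>2 + 1/4) \<noteq> (0::complex)" by (simp only: of_real_eq_0_iff not_False_eq_True)
      moreover have "Complex (1/2) (- s) \<noteq> 0" by (simp add: complex_eq_iff)
      moreover have "- Complex (1/2) s * of_real (s\<^sup>2 + 1/4) = Complex (s\<^sup>2 - 1/4) (- s) * Complex (1/2) (- s)"
        by (simp add: complex_eq_iff power2_eq_square algebra_simps)
      ultimately show ?thesis
        using frac_eq_eq[of "Complex (1/2) (- s)" "of_real (s\<^sup>2 + 1/4)"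
            "- Complex (1/2) s" "Complex (s\<^sup>2 - 1/4) (- s)"] by blast
    qed
    finally show ?thesis .
  qed
  have pos: "0 < t\<^sup>2 + 1/4" "t\<^sup>2 < 1/4"
    using assms power_strict_mono[of t "1/2" 2] by (auto simp: power2_eq_square add_pos_pos)
  have ReIm: "Re (z (- t)) < 0" "0 < Im (z (- t))"
    unfolding z Re_divide_of_real Im_divide_of_real using assms(2) pos
    by (auto simp: divide_neg_pos)
  then have "0 \<le> Arg (z (- t))" by (simp add: Arg_less_0)
  moreover have "\<not> \<bar>Arg (z (- t))\<bar> \<le> pi / 2" using ReIm(1) Arg_Re_nonneg[of "z (- t)"] by simp
  ultimately show "pi / 2 < Arg (z (- t))" by simp
  have "z t = cnj (z (- t))" unfolding z by (simp add: complex_eq_iff)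
  moreover have "z (- t) \<notin> \<real>" using ReIm(2) by (auto simp: complex_is_Real_iff)
  ultimately show "Arg (z t) = - Arg (z (- t))" by (simp add: Arg_cnj)
qed

text \<open>
  A strict estimate between neighbouring multiples determines a difference of full turns.
\<close>

lemma full_turns_eqI:
  assumes "\<exists>n::int. x = 2 * pi * of_int n" "\<exists>n::int. y = 2 * pi * of_int n"
    and "x - y < 2 * pi * (of_int k + 1)" "2 * pi * (of_int k - 1) < x - y"
  shows "x = y + 2 * pi * of_int k"
proof -
  obtain m n :: int where mn: "x = 2 * pi * of_int m" "y = 2 * pi * of_int n" using assms by blast
  have "2 * pi * of_int (m - n) < 2 * pi * of_int (k + 1)" "2 * pi * of_int (k - 1) < 2 * pi * of_int (m - n)"
    using assms(3,4) by (simp_all add: mn algebra_simps)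
  then have "of_int (m - n) < (of_int (k + 1) :: real)" "of_int (k - 1) < (of_int (m - n) :: real)"
    by (simp_all only: mult_less_cancel_left_pos pi_gt_zero zero_less_mult_iff zero_less_numeral simp_thms)
  then have "m - n < k + 1" "k - 1 < m - n" by linarith+
  then have "m = n + k" by linarith
  then show ?thesis by (simp add: mn algebra_simps)
qed

lemma Arg_diff_half_plane:
  assumes "0 < Re x" "0 < Re y"
  shows "Arg (x / y) = Arg x - Arg y"
proof (rule cis_Arg_unique)
  have nz: "x \<noteq> 0" "y \<noteq> 0" using assms by auto
  have "\<bar>Arg x\<bar> < pi / 2" "\<bar>Arg y\<bar> < pi / 2"
    using Arg_Re_pos[of x] Arg_Re_pos[of y] assms by blast+
  then show "- pi < Arg x - Arg y" "Arg x - Arg y \<le> pi" by auto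
  show "sgn (x / y) = cis (Arg x - Arg y)"
    using nz by (simp add: cis_divide[symmetric] cis_Arg sgn_divide_complex)
qed

lemma ccw_angle_eq_Arg_diff:
  assumes "ccw_angle d d' < pi" "d \<noteq> 0" "d' \<noteq> 0" "0 < Re (u / d)" "0 < Re (u / d')"
  shows "Arg (u / d) - Arg (u / d') = ccw_angle d d'"
proof -
  have nz: "u \<noteq> 0" using assms(4) by auto
  have "Arg (u / d) - Arg (u / d') = Arg (u / d / (u / d'))"
    using Arg_diff_half_plane[OF assms(4,5)] by simp
  also have "u / d / (u / d') = d' / d" using nz assms by simp
  also have "Arg (d' / d) = ccw_angle d d'"
  proof (rule cis_Arg_unique)
    show "- pi < ccw_angle d d'" "ccw_angle d d' \<le> pi"
      using assms(1) ccw_angle_bounds(1)[of d d'] pi_gt_zero by linarith+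
    have "d' / d = of_real (norm d' / norm d) * cis (ccw_angle d d')"
      using ccw_angle_polar[OF assms(2), of d'] assms(2) by (metis nonzero_mult_div_cancel_right)
    then have "sgn (d' / d) = sgn (of_real (norm d' / norm d) * cis (ccw_angle d d'))" by simp
    also have "\<dots> = cis (ccw_angle d d')"
    proof -
      have "sgn (norm d' / norm d) = 1" using assms by simp
      then show ?thesis by (simp only: sgn_mult sgn_of_real sgn_cis of_real_1 mult_1)
    qed
    finally show "sgn (d' / d) = cis (ccw_angle d d')" .
  qed
  finally show ?thesis .
qed

lemma Re_divide_pos_iff_inner: "d \<noteq> 0 \<Longrightarrow> 0 < Re (u / d) \<longleftrightarrow> 0 < u \<bullet> d"
proof -
  assume "d \<noteq> 0"
  have "Re (u / d) = (u \<bullet> d) / (norm d)\<^sup>2"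
    by (simp add: Re_divide cmod_power2 inner_complex_def)
  then show ?thesis using \<open>d \<noteq> 0\<close> by (simp add: zero_less_divide_iff)
qed

context framework
begin

text \<open>
  All vectors \<open>u F\<close> of the faces \<open>F\<close> on either side of the edge to \<open>j\<close> lie in the half-plane opposite
  to the direction \<open>d\<close> of that edge. So the angle from the one to the other is the difference of
  their angles to \<open>- d\<close>. Collecting the terms by faces instead of edges, each face contributes the
  angle between the two edges that bound its sector.
\<close>

lemma angle_sum_around_vertex_pos:
  assumes vi: "{v, i} \<in> E"
    and left: "\<And>j. {v, j} \<in> E \<Longrightarrow> u (lface v j) \<bullet> (p j - p v) < 0"
    and right: "\<And>j. {v, j} \<in> E \<Longrightarrow> u (lface j v) \<bullet> (p j - p v) < 0"
    and convex: "\<And>j. {v, j} \<in> E \<Longrightarrow> ccw_angle (p j - p v) (p (next_ccw v j) - p v) < pi"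
  shows "0 < (\<Sum>j | {v, j} \<in> E. Arg (u (lface v j) / u (lface j v)))"
proof -
  define N where "N = {j. {v, j} \<in> E}"
  define d where "d = (\<lambda>j. - (p j - p v))"
  have d: "d j \<noteq> 0" if "j \<in> N" for j using nbr_dir_nonzero[of v j] that by (simp add: d_def N_def)
  have pos: "0 < Re (u (lface v j) / d j)" "0 < Re (u (lface j v) / d j)" if "j \<in> N" for j
  proof -
    have "0 < Re (x / d j)" if "x \<bullet> (p j - p v) < 0" for x
      using Re_divide_pos_iff_inner[OF d[OF \<open>j \<in> N\<close>], of x] that
      unfolding d_def inner_minus_right by simp
    then show "0 < Re (u (lface v j) / d j)" "0 < Re (u (lface j v) / d j)"
      using left right that by (auto simp: N_def)
  qed
  have "(\<Sum>j\<in>N. Arg (u (lface v j) / u (lface j v))) =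
      (\<Sum>j\<in>N. Arg (u (lface v j) / d j) - Arg (u (lface j v) / d j))"
  proof (rule sum.cong)
    fix j assume j: "j \<in> N"
    have eq: "u (lface v j) / u (lface j v) = (u (lface v j) / d j) / (u (lface j v) / d j)"
      using d[OF j] by simp
    show "Arg (u (lface v j) / u (lface j v)) =
        Arg (u (lface v j) / d j) - Arg (u (lface j v) / d j)"
      unfolding eq by (rule Arg_diff_half_plane[OF pos[OF j]])
  qed simp
  also have "\<dots> = (\<Sum>j\<in>N. Arg (u (lface v j) / d j)) - (\<Sum>j\<in>N. Arg (u (lface j v) / d j))"
    by (rule sum_subtractf)
  also have "(\<Sum>j\<in>N. Arg (u (lface j v) / d j)) =
      (\<Sum>j\<in>N. Arg (u (lface (next_ccw v j) v) / d (next_ccw v j)))"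
    using sum.reindex_bij_betw[OF bij_next_ccw[of v], of "\<lambda>j. Arg (u (lface j v) / d j)"]
    by (simp add: N_def)
  also have "\<dots> = (\<Sum>j\<in>N. Arg (u (lface v j) / d (next_ccw v j)))"
    by (rule sum.cong) (auto simp: N_def left_face_next_ccw)
  also have "(\<Sum>j\<in>N. Arg (u (lface v j) / d j)) - \<dots> =
      (\<Sum>j\<in>N. Arg (u (lface v j) / d j) - Arg (u (lface v j) / d (next_ccw v j)))"
    by (rule sum_subtractf[symmetric])
  also have "\<dots> = (\<Sum>j\<in>N. ccw_angle (p j - p v) (p (next_ccw v j) - p v))"
  proof (rule sum.cong)
    fix j assume j: "j \<in> N"
    then have n: "next_ccw v j \<in> N" using next_ccw_edge by (simp add: N_def)
    have "lface (next_ccw v j) v = lface v j" using j left_face_next_ccw by (simp add: N_def)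
    then have "Arg (u (lface v j) / d j) - Arg (u (lface v j) / d (next_ccw v j)) =
        ccw_angle (d j) (d (next_ccw v j))"
      using pos(1)[OF j] pos(2)[OF n] d[OF j] d[OF n] convex[of j] j
      by (intro ccw_angle_eq_Arg_diff) (auto simp: d_def N_def ccw_angle_uminus simp del: minus_diff_eq)
    then show "Arg (u (lface v j) / d j) - Arg (u (lface v j) / d (next_ccw v j)) =
        ccw_angle (p j - p v) (p (next_ccw v j) - p v)"
      by (simp add: d_def ccw_angle_uminus del: minus_diff_eq)
  qed simp
  also have "\<dots> > 0"
    using vi finite_nbrs[of v] by (intro sum_pos) (auto simp: N_def ccw_angle_bounds)
  finally show ?thesis by (simp add: N_def)
qed

end

section \<open>Reciprocal pairs and their orientation\<close>

locale reciprocal_pair = framework V E p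
  for V :: "'v set" and E :: "'v set set" and p :: "'v \<Rightarrow> complex" +
  fixes \<omega> :: "'v set \<Rightarrow> real" and q :: "complex set \<Rightarrow> complex"
  assumes two_connected: "two_connected V E"
    and stress_nonzero: "e \<in> E \<Longrightarrow> \<omega> e \<noteq> 0"
    and reciprocal: "is_reciprocal V E p \<omega> q"
    and noncrossing_reciprocal: "noncrossing_reciprocal V E p q"

sublocale reciprocal_pair \<subseteq> dual: framework "faces V E p" "dual_edges V E p" q
  using noncrossing_reciprocal by unfold_locales (simp add: noncrossing_reciprocal_def)

context reciprocal_pair
begin

lemma ex_nbr:
  assumes "v \<in> V"
  shows "\<exists>j. {v, j} \<in> E"
proof -
  have card: "3 \<le> card V" using two_connected by (simp add: two_connected_def)
  have "\<not> V \<subseteq> {v}"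
  proof
    assume "V \<subseteq> {v}"
    then have "card V \<le> card {v}" by (intro card_mono) auto
    then show False using card by simp
  qed
  then obtain u where u: "u \<in> V" "u \<noteq> v" by blast
  have "(v, u) \<in> {(x, y). x \<in> V \<and> y \<in> V \<and> {x, y} \<in> E}\<^sup>*"
    using two_connected assms u by (auto simp: two_connected_def connected_on_def)
  then show ?thesis using u(2) by (auto elim: converse_rtranclE)
qed

lemma ex_vertex: "\<exists>v. v \<in> V"
  using two_connected by (cases "V = {}") (auto simp: two_connected_def)

lemma E_nonempty: "E \<noteq> {}"
  using ex_vertex ex_nbr by blast

lemma dual_edge_eq: "dual_edge V E p {i, j} = {lface i j, lface j i}"
  by (auto simp: dual_edge_def doubleton_eq_iff)

lemma dual_edge_in: "{i, j} \<in> E \<Longrightarrow> {lface i j, lface j i} \<in> dual_edges V E p"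
  unfolding dual_edges_def using dual_edge_eq by blast

lemma dual_edgesE:
  assumes "{A, B} \<in> dual_edges V E p"
  obtains i j where "{i, j} \<in> E" "A = lface i j" "B = lface j i"
proof -
  obtain e where e: "e \<in> E" "{A, B} = dual_edge V E p e" using assms by (auto simp: dual_edges_def)
  obtain i j where ij: "e = {i, j}" "{i, j} \<in> E" using e(1) edgeE by blast
  have "{A, B} = {lface i j, lface j i}" using e(2) dual_edge_eq ij by simp
  then have "A = lface i j \<and> B = lface j i \<or> A = lface j i \<and> B = lface i j"
    by (simp add: doubleton_eq_iff)
  moreover have "{j, i} \<in> E" using ij(2) by (simp add: insert_commute)
  ultimately show thesis using that ij(2) by blast
qed

lemma dual_edge_inj:
  assumes "{i, j} \<in> E" "{k, l} \<in> E" "{lface i j, lface j i} = {lface k l, lface l k}"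
  shows "{i, j} = {k, l}"
proof -
  have "inj_on (dual_edge V E p) E"
    using noncrossing_reciprocal by (simp add: noncrossing_reciprocal_def)
  then show ?thesis using assms by (simp add: dual_edge_eq inj_on_eq_iff[symmetric] inj_onD)
qed

lemma left_right_distinct: "{i, j} \<in> E \<Longrightarrow> lface i j \<noteq> lface j i"
  using dual.edgeD(1)[OF dual_edge_in] .

lemma recip_diff: "{i, j} \<in> E \<Longrightarrow> q (lface i j) - q (lface j i) = \<omega> {i, j} *\<^sub>R (p j - p i)"
  using reciprocal by (simp add: is_reciprocal_def)

lemma dual_edges_nonempty: "dual_edges V E p \<noteq> {}"
  using E_nonempty by (simp add: dual_edges_def)

lemma farthest_vertex_extreme:
  assumes "v \<in> V" "\<And>j. j \<in> V \<Longrightarrow> norm (p j - c) \<le> norm (p v - c)"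
    and "j \<in> V" "j \<noteq> v"
  shows "(p j - p v) \<bullet> (p v - c) < 0"
  using assms inj_p by (intro farthest_point_extreme) (auto dest: inj_onD)

lemma ex_farthest_vertex: "\<exists>v\<in>V. \<forall>j\<in>V. norm (p j - c) \<le> norm (p v - c)"
proof -
  have "finite ((\<lambda>j. norm (p j - c)) ` V)" "(\<lambda>j. norm (p j - c)) ` V \<noteq> {}"
    using finite_V ex_vertex by auto
  then have "Max ((\<lambda>j. norm (p j - c)) ` V) \<in> (\<lambda>j. norm (p j - c)) ` V"
    "\<forall>x\<in>(\<lambda>j. norm (p j - c)) ` V. x \<le> Max ((\<lambda>j. norm (p j - c)) ` V)"
    by (auto intro: Max_in)
  then show ?thesis by (metis (no_types, lifting) image_iff)
qed

text \<open>
  At an extreme vertex \<open>v\<close> the outer face has an angle \<open>\<beta> > \<pi>\<close>, between two boundary edges. Their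
  stresses have the same sign, so their duals leave \<open>q O\<close> in the direction of the one edge and
  opposite to the direction of the other. In the orientation-preserving case they are consecutive
  at \<open>q O\<close>, with an angle \<open>3 * \<pi> - \<beta>\<close> between them, which again exceeds \<open>\<pi>\<close>.
\<close>

lemma same_embedding_gap_at_extreme_vertex:
  assumes same: "dual_embedding_same V E p q"
    and c: "c = 1 \<or> c = -1" "\<And>e. e \<in> boundary_edges V E p \<Longrightarrow> 0 < c * \<omega> e"
    and v: "v \<in> V" and ext: "\<And>j. j \<in> V \<Longrightarrow> j \<noteq> v \<Longrightarrow> (p j - p v) \<bullet> e < 0"
  shows "\<exists>i. {i, v} \<in> E \<and> lface i v = outer_face V E p \<and>
    pi < ccw_angle (q (lface v i) - q (outer_face V E p))
      (q (dual.next_ccw (outer_face V E p) (lface v i)) - q (outer_face V E p))"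
proof -
  let ?O = "outer_face V E p"
  obtain i0 where "{v, i0} \<in> E" using ex_nbr[OF v] by blast
  then obtain k where vk: "{v, k} \<in> E" "lface v k = ?O"
    "pi < ccw_angle (p k - p v) (p (next_ccw v k) - p v)"
    using extreme_vertex_outer_gap[of v i0 e] ext by blast
  define i where "i = next_ccw v k"
  have vi: "{v, i} \<in> E" using next_ccw_edge[OF vk(1)] by (simp add: i_def)
  have iv: "{i, v} \<in> E" using vi by (simp add: insert_commute)
  have lO: "lface i v = ?O" using left_face_next_ccw[OF vk(1)] vk(2) by (simp add: i_def)
  have ki: "next_cw v i = k" using next_cw_next_ccw[OF vk(1)] by (simp add: i_def)
  have "vertex_succ (dual_edges V E p) q (dual_dart V E p (i, v)) =
      dual_dart V E p (face_succ E p (i, v))"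
    using same iv by (auto simp: dual_embedding_same_def)
  then have succ: "dual.next_ccw ?O (lface v i) = lface k v"
    by (simp add: vertex_succ_def dual_dart_def face_succ_def ki lO vk(2))
  have "{v, k} \<in> boundary_edges V E p" "{i, v} \<in> boundary_edges V E p"
    using edges_of_face_iff[OF vk(1) outer_face_in_faces] edges_of_face_iff[OF iv outer_face_in_faces]
      vk(2) lO by (auto simp: boundary_edges_def)
  then have pos: "0 < c * \<omega> {v, k}" "0 < c * \<omega> {i, v}" using c(2) by auto
  define di where "di = p i - p v"
  define dk where "dk = p k - p v"
  have nz: "di \<noteq> 0" "dk \<noteq> 0"
    using nbr_dir_nonzero[OF vi] nbr_dir_nonzero[OF vk(1)] by (auto simp: di_def dk_def)
  have 1: "q (lface v i) - q ?O = of_real (\<omega> {i, v}) * di"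
    using recip_diff[OF iv] lO by (simp add: di_def scaleR_conv_of_real algebra_simps)
  have 2: "q (lface k v) - q ?O = of_real (\<omega> {v, k}) * (- dk)"
    using recip_diff[OF vk(1)] vk(2) by (simp add: dk_def scaleR_conv_of_real algebra_simps)
  have eq: "ccw_angle (q (lface v i) - q ?O) (q (lface k v) - q ?O) = ccw_angle di (- dk)"
  proof -
    have "ccw_angle (of_real (c * \<omega> {i, v}) * di) (of_real (c * \<omega> {v, k}) * (- dk)) = ccw_angle di (- dk)"
      using pos by (intro ccw_angle_scale)
    then show ?thesis
      unfolding 1 2 using c(1)
        ccw_angle_uminus[of "of_real (\<omega> {i, v}) * di" "of_real (\<omega> {v, k}) * (- dk)"] by auto
  qed
  have "ccw_angle dk di \<noteq> 2 * pi"
  proof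
    assume "ccw_angle dk di = 2 * pi"
    then have "k = i" using ccw_angle_full_eq[OF vk(1) vi] by (simp add: di_def dk_def)
    then show False using left_right_distinct[OF vk(1)] vk(2) lO by simp
  qed
  then have "pi < ccw_angle dk di" "ccw_angle dk di < 2 * pi"
    using vk(3) ccw_angle_bounds(2)[of dk di] by (auto simp: dk_def di_def i_def)
  then have "pi < ccw_angle di (- dk)"
    using ccw_angle_add[OF nz(2) nz(1), of "- dk"] nz ccw_angle_opposite[OF nz(2)]
      ccw_angle_bounds(1)[of di "- dk"] by auto
  then show ?thesis using iv lO eq succ by metis
qed

text \<open>
  Two extreme vertices are a farthest one from an arbitrary point and a farthest one from that
  vertex. They give two gaps larger than \<open>\<pi>\<close> in the fan of dual edges at \<open>q O\<close>, while all the gaps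
  add up to \<open>2 * \<pi>\<close>.
\<close>

lemma same_embedding_impossible:
  assumes c: "c = 1 \<or> c = -1" "\<And>e. e \<in> boundary_edges V E p \<Longrightarrow> 0 < c * \<omega> e"
  shows "\<not> dual_embedding_same V E p q"
proof
  assume same: "dual_embedding_same V E p q"
  let ?O = "outer_face V E p"
  obtain v1 where v1: "v1 \<in> V" "\<And>j. j \<in> V \<Longrightarrow> norm (p j - 0) \<le> norm (p v1 - 0)"
    using ex_farthest_vertex[of 0] by blast
  obtain v2 where v2: "v2 \<in> V" "\<And>j. j \<in> V \<Longrightarrow> norm (p j - p v1) \<le> norm (p v2 - p v1)"
    using ex_farthest_vertex[of "p v1"] by blast
  have "v1 \<noteq> v2"
  proof
    assume "v1 = v2"
    obtain j where "{v1, j} \<in> E" using ex_nbr[OF v1(1)] by blast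
    then show False using v2(2)[of j] edgeD[of v1 j] \<open>v1 = v2\<close> by simp
  qed
  obtain i1 where i1: "{i1, v1} \<in> E" "lface i1 v1 = ?O"
    "pi < ccw_angle (q (lface v1 i1) - q ?O) (q (dual.next_ccw ?O (lface v1 i1)) - q ?O)"
    using same_embedding_gap_at_extreme_vertex[OF same c v1(1), of "p v1 - 0"]
      farthest_vertex_extreme[OF v1] by blast
  obtain i2 where i2: "{i2, v2} \<in> E" "lface i2 v2 = ?O"
    "pi < ccw_angle (q (lface v2 i2) - q ?O) (q (dual.next_ccw ?O (lface v2 i2)) - q ?O)"
    using same_embedding_gap_at_extreme_vertex[OF same c v2(1), of "p v2 - p v1"]
      farthest_vertex_extreme[OF v2] by blast
  have ne: "{i1, v1} \<noteq> {i2, v2}"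
    using \<open>v1 \<noteq> v2\<close> i1 i2 left_right_distinct[OF i1(1)] by (auto simp: doubleton_eq_iff)
  have dual1: "{?O, lface v1 i1} \<in> dual_edges V E p" using dual_edge_in[OF i1(1)] i1(2) by simp
  have dual2: "{?O, lface v2 i2} \<in> dual_edges V E p" using dual_edge_in[OF i2(1)] i2(2) by simp
  have A: "lface v1 i1 \<noteq> lface v2 i2"
    using dual_edge_inj[OF i1(1) i2(1)] ne i1(2) i2(2) by auto
  have "pi < ccw_angle (q (lface v1 i1) - q ?O) (q (lface v2 i2) - q ?O)"
    using dual.next_ccw_min[OF dual1 dual2] i1(3) by linarith
  moreover have "pi < ccw_angle (q (lface v2 i2) - q ?O) (q (lface v1 i1) - q ?O)"
    using dual.next_ccw_min[OF dual2 dual1] i2(3) by linarith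
  ultimately show False
    using ccw_angle_swap[OF dual.nbr_dir_nonzero[OF dual1] dual.nbr_dir_nonzero[OF dual2]]
      dual.ccw_angle_less_full[OF dual1 dual2 A] by linarith
qed

section \<open>Winding numbers of the reciprocal polygons\<close>

text \<open>
  The choice of \<open>j\<close> is immaterial if the orientation is reversed; see \<open>recip_face_eq\<close>.
\<close>

definition recip_face :: "'v \<Rightarrow> complex set" where
  "recip_face v = (let j = SOME j. {v, j} \<in> E in dual.lface (lface v j) (lface j v))"

text \<open>
  The polygon dual to the vertex cycle of \<open>v\<close>: the edge from \<open>v\<close> to \<open>j\<close> is crossed from its right to
  its left face, so the faces around \<open>v\<close> are visited counterclockwise.
\<close>

definition winding :: "'v \<Rightarrow> complex \<Rightarrow> real" where
  "winding v = angle_sum {j. {v, j} \<in> E} (\<lambda>j. q (lface j v)) (\<lambda>j. q (lface v j))"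

lemma winding_multiple_of_full_turn:
  assumes "y \<notin> dual.D"
  shows "\<exists>n::int. winding v y = 2 * pi * of_int n"
  unfolding winding_def
proof (rule angle_sum_multiple_of_full_turn[where \<pi> = "next_ccw v"])
  show "finite {j. {v, j} \<in> E}" "bij_betw (next_ccw v) {j. {v, j} \<in> E} {j. {v, j} \<in> E}"
    by (rule finite_nbrs bij_next_ccw)+
  fix i assume "i \<in> {j. {v, j} \<in> E}"
  then have vi: "{v, i} \<in> E" by simp
  show "q (lface v i) = q (lface (next_ccw v i) v)" using left_face_next_ccw[OF vi] by simp
  show "q (lface i v) \<noteq> y" using assms right_face_in_faces[OF vi] by (auto simp: drawing_def)
qed

lemma isCont_winding:
  assumes "y \<notin> dual.D"
  shows "isCont (winding v) y"
  unfolding winding_def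
proof (rule isCont_angle_sum)
  fix j assume "j \<in> {j. {v, j} \<in> E}"
  then have "{lface v j, lface j v} \<in> dual_edges V E p" using dual_edge_in by simp
  then show "y \<notin> closed_segment (q (lface j v)) (q (lface v j))"
    using dual.segment_subset_D assms closed_segment_commute by blast
qed

lemma winding_constant_on_face:
  assumes F: "F \<in> faces (faces V E p) (dual_edges V E p) q" and xy: "x \<in> F" "y \<in> F"
  shows "winding v x = winding v y"
proof -
  have nD: "z \<notin> dual.D" if "z \<in> F" for z using dual.face_disjoint_D[OF F] that by blast
  have "winding v constant_on F"
  proof (rule continuous_discrete_range_constant)
    show "connected F" using F by (auto simp: faces_def dest: in_components_connected)
    show "continuous_on F (winding v)"
      using isCont_winding nD by (intro continuous_at_imp_continuous_on) auto
    fix x assume x: "x \<in> F"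
    show "\<exists>e>0. \<forall>y. y \<in> F \<and> winding v y \<noteq> winding v x \<longrightarrow> e \<le> norm (winding v y - winding v x)"
    proof (intro exI[of _ "2 * pi"] conjI allI impI)
      fix y assume y: "y \<in> F \<and> winding v y \<noteq> winding v x"
      obtain m n :: int where mn: "winding v x = 2 * pi * of_int m" "winding v y = 2 * pi * of_int n"
        using winding_multiple_of_full_turn nD x y by metis
      then have "m \<noteq> n" using y by auto
      then have "1 \<le> \<bar>n - m\<bar>" by linarith
      then have "1 \<le> \<bar>of_int n - of_int m :: real\<bar>" by linarith
      moreover have "norm (winding v y - winding v x) = 2 * pi * \<bar>of_int n - of_int m\<bar>"
        by (simp add: mn abs_mult flip: right_diff_distrib)
      ultimately show "2 * pi \<le> norm (winding v y - winding v x)" by simp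
    qed simp
  qed
  then show ?thesis using xy by (auto simp: constant_on_def)
qed

text \<open>
  The swept angle tends to \<open>0\<close> at infinity, it is a multiple of a full turn, and the outer face is
  unbounded.
\<close>

lemma winding_outer:
  assumes y: "y \<in> outer_face (faces V E p) (dual_edges V E p) q"
  shows "winding v y = 0"
proof -
  let ?X = "outer_face (faces V E p) (dual_edges V E p) q"
  have "(winding v \<longlongrightarrow> 0) at_infinity" unfolding winding_def by (rule angle_sum_at_infinity)
  then have "\<forall>\<^sub>F z in at_infinity. dist (winding v z) 0 < 2 * pi" by (rule tendstoD) simp
  then obtain B where B: "\<And>z. B \<le> norm z \<Longrightarrow> \<bar>winding v z\<bar> < 2 * pi"
    by (auto simp: eventually_at_infinity)
  have "\<not> bounded ?X"
    unfolding outer_face_def using dual.compact_D compact_imp_bounded by (intro unbounded_outside) blast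
  then obtain z where z: "z \<in> ?X" "B \<le> norm z" by (auto simp: bounded_iff not_le intro: less_imp_le)
  have nD: "z \<notin> dual.D" using dual.face_disjoint_D[OF dual.outer_face_in_faces] z(1) by blast
  obtain n :: int where n: "winding v z = 2 * pi * of_int n"
    using winding_multiple_of_full_turn[OF nD] by blast
  have "2 * pi * \<bar>of_int n\<bar> < 2 * pi" using B[OF z(2)] by (simp add: n abs_mult)
  then have "\<bar>of_int n :: real\<bar> < 1" using pi_gt_zero by simp
  then have "n = 0" by linarith
  then have "winding v z = 0" using n by simp
  then show ?thesis using winding_constant_on_face[OF dual.outer_face_in_faces y z(1)] by simp
qed

lemma winding_split:
  assumes ab: "{a, b} \<in> E"
  defines "T \<equiv> \<lambda>v. {j. {v, j} \<in> E \<and> {v, j} \<noteq> {a, b}}"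
  shows "winding a y = Arg ((q (lface a b) - y) / (q (lface b a) - y)) +
      angle_sum (T a) (\<lambda>j. q (lface j a)) (\<lambda>j. q (lface a j)) y"
    and "v \<noteq> a \<Longrightarrow> v \<noteq> b \<Longrightarrow> winding v y = angle_sum (T v) (\<lambda>j. q (lface j v)) (\<lambda>j. q (lface v j)) y"
proof -
  have "{j. {a, j} \<in> E} = insert b (T a)" "b \<notin> T a" "finite (T a)"
    using ab edgeD(1)[OF ab] finite_subset[OF _ finite_nbrs[of a], of "T a"]
    by (auto simp: T_def doubleton_eq_iff)
  then show "winding a y = Arg ((q (lface a b) - y) / (q (lface b a) - y)) +
      angle_sum (T a) (\<lambda>j. q (lface j a)) (\<lambda>j. q (lface a j)) y"
    by (simp add: winding_def angle_sum_def)
  assume "v \<noteq> a" "v \<noteq> b"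
  then have "{j. {v, j} \<in> E} = T v" by (auto simp: T_def doubleton_eq_iff)
  then show "winding v y = angle_sum (T v) (\<lambda>j. q (lface j v)) (\<lambda>j. q (lface v j)) y"
    by (simp add: winding_def)
qed

text \<open>
  At the midpoint of the edge dual to \<open>{a, b}\<close> the sum over all other edges of the polygon of \<open>v\<close> is
  continuous, because no other dual edge passes through that point.
\<close>

lemma points_beside_dual_edge:
  fixes v :: 'v
  assumes ab: "{a, b} \<in> E"
  defines "T \<equiv> {j. {v, j} \<in> E \<and> {v, j} \<noteq> {a, b}}"
  defines "y \<equiv> dual.edge_pt (lface a b) (lface b a) (1/2)"
  defines "S \<equiv> angle_sum T (\<lambda>j. q (lface j v)) (\<lambda>j. q (lface v j))"
  shows "\<exists>t. 0 < t \<and> t < 1/2 \<and> y t \<in> dual.lface (lface a b) (lface b a) \<and>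
    y (- t) \<in> dual.lface (lface b a) (lface a b) \<and> \<bar>S (y (- t)) - S (y t)\<bar> < pi / 2"
proof -
  define A where "A = lface a b"
  define B where "B = lface b a"
  have AB: "{A, B} \<in> dual_edges V E p" using dual_edge_in[OF ab] by (simp add: A_def B_def)
  have BA: "{B, A} \<in> dual_edges V E p" using AB by (simp add: insert_commute)
  have yAB: "y t = dual.edge_pt A B (1/2) t" for t by (simp add: y_def A_def B_def)
  have y0: "y 0 \<in> closed_segment (q A) (q B)" "y 0 \<notin> {q A, q B}"
    unfolding yAB using dual.edge_pt_on_segment[OF dual.edgeD(4)[OF AB], of "1/2" 0]
      dual.inner_edge_pt_not_endpoint[OF dual.edgeD(4)[OF AB], of "1/2"] by auto
  have cS: "isCont S (y 0)"
    unfolding S_def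
  proof (rule isCont_angle_sum)
    fix j assume "j \<in> T"
    then have j: "{v, j} \<in> E" "{v, j} \<noteq> {a, b}" by (auto simp: T_def)
    have "{A, B} \<noteq> {lface v j, lface j v}"
      using dual_edge_inj[OF ab j(1)] j(2) by (auto simp: A_def B_def)
    then have "y 0 \<notin> convex hull (q ` {lface v j, lface j v})"
      using dual.edges_meet[OF AB dual_edge_in[OF j(1)] _ y0(1)] y0(2) by blast
    then show "y 0 \<notin> closed_segment (q (lface j v)) (q (lface v j))"
      unfolding dual.hull_edge using closed_segment_commute by blast
  qed
  have "isCont y 0" "isCont (\<lambda>t. y (- t)) 0"
    unfolding y_def dual.edge_pt_def Complex_eq by (intro continuous_intros)+
  then have "isCont (\<lambda>t. S (y t)) 0" "isCont (\<lambda>t. S (y (- t))) 0"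
    using cS isCont_o2[of 0 y S] isCont_o2[of 0 "\<lambda>t. y (- t)" S] by simp_all
  then have "isCont (\<lambda>t. S (y (- t)) - S (y t)) 0" by (intro continuous_diff)
  then have "((\<lambda>t. S (y (- t)) - S (y t)) \<longlongrightarrow> S (y (- 0)) - S (y 0)) (at 0)"
    by (simp only: isCont_def)
  then have "((\<lambda>t. S (y (- t)) - S (y t)) \<longlongrightarrow> 0) (at 0)" by simp
  then have "((\<lambda>t. S (y (- t)) - S (y t)) \<longlongrightarrow> 0) (at_right 0)"
    by (simp add: filterlim_at_split)
  then have "\<forall>\<^sub>F t in at_right 0. dist (S (y (- t)) - S (y t)) 0 < pi / 2"
    by (rule tendstoD) simp
  moreover obtain \<delta>1 where \<delta>1: "\<delta>1 > 0" "\<And>t. 0 < t \<Longrightarrow> t < \<delta>1 \<Longrightarrow> y t \<in> dual.lface A B"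
    using dual.strip_in_left_face[OF AB, of "1/2" "1/2"] by (auto simp: yAB)
  then have "\<forall>\<^sub>F t in at_right 0. y t \<in> dual.lface A B"
    unfolding eventually_at_right_field by blast
  moreover obtain \<delta>2 where \<delta>2: "\<delta>2 > 0" "\<And>t. 0 < t \<Longrightarrow> t < \<delta>2 \<Longrightarrow> dual.edge_pt B A (1/2) t \<in> dual.lface B A"
    using dual.strip_in_left_face[OF BA, of "1/2" "1/2"] by auto
  have "y (- t) = dual.edge_pt B A (1/2) t" for t
    using dual.edge_pt_swap[of B A "1/2" t] by (simp add: yAB)
  then have "\<forall>\<^sub>F t in at_right 0. y (- t) \<in> dual.lface B A"
    unfolding eventually_at_right_field using \<delta>2 by auto
  moreover have "\<forall>\<^sub>F t in at_right (0::real). 0 < t \<and> t < 1/2"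
    using eventually_at_right_field[of _ "0::real"] by (auto intro!: exI[of _ "1/2"])
  ultimately have "\<forall>\<^sub>F t in at_right 0. 0 < t \<and> t < 1/2 \<and> y t \<in> dual.lface A B \<and>
     y (- t) \<in> dual.lface B A \<and> \<bar>S (y (- t)) - S (y t)\<bar> < pi / 2"
    by eventually_elim auto
  then show ?thesis
    unfolding A_def B_def
    using eventually_happens'[OF trivial_limit_at_right_real] by blast
qed

lemma winding_across_edge:
  assumes ab: "{a, b} \<in> E" and vb: "v \<noteq> b"
    and x: "x \<in> dual.lface (lface a b) (lface b a)" and x': "x' \<in> dual.lface (lface b a) (lface a b)"
  shows "winding v x' = winding v x + 2 * pi * of_int (if v = a then 1 else 0)"
proof -
  define A where "A = lface a b"
  define B where "B = lface b a"
  have AB: "{A, B} \<in> dual_edges V E p" using dual_edge_in[OF ab] by (simp add: A_def B_def)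
  define y where "y = dual.edge_pt A B (1/2)"
  define S where "S = angle_sum {j. {v, j} \<in> E \<and> {v, j} \<noteq> {a, b}} (\<lambda>j. q (lface j v)) (\<lambda>j. q (lface v j))"
  obtain t where t: "0 < t" "t < 1/2" "y t \<in> dual.lface A B" "y (- t) \<in> dual.lface B A"
    "\<bar>S (y (- t)) - S (y t)\<bar> < pi / 2"
    using points_beside_dual_edge[OF ab, of v] unfolding A_def B_def y_def S_def by blast
  have faces: "dual.lface A B \<in> faces (faces V E p) (dual_edges V E p) q"
     "dual.lface B A \<in> faces (faces V E p) (dual_edges V E p) q"
    using dual.left_face_in_faces[OF AB] dual.right_face_in_faces[OF AB] .
  have nD: "y t \<notin> dual.D" "y (- t) \<notin> dual.D"
    using t(3,4) dual.face_disjoint_D[OF faces(1)] dual.face_disjoint_D[OF faces(2)] by blast+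
  have "winding v (y (- t)) = winding v (y t) + 2 * pi * of_int (if v = a then 1 else 0)"
  proof (rule full_turns_eqI[OF winding_multiple_of_full_turn[OF nD(2)] winding_multiple_of_full_turn[OF nD(1)]])
    \<comment> \<open>The term of the crossed edge jumps by an amount between \<open>pi\<close> and \<open>2 * pi\<close>, and the other
      terms change by less than \<open>pi / 2\<close>; only one full turn is left.\<close>
    have diff: "winding v (y (- t)) - winding v (y t) < 5 * pi / 2 \<and> pi / 2 < winding v (y (- t)) - winding v (y t)"
      if "v = a"
    proof -
      have W: "winding v z = Arg ((q A - z) / (q B - z)) + S z" for z
        unfolding that S_def A_def B_def by (rule winding_split(1)[OF ab])
      have "pi / 2 < Arg ((q A - y (- t)) / (q B - y (- t)))"
        "Arg ((q A - y t) / (q B - y t)) = - Arg ((q A - y (- t)) / (q B - y (- t)))"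
        unfolding y_def dual.edge_pt_def
        using Arg_ratio_beside_segment[OF dual.edgeD(4)[OF AB] t(1,2)] by auto
      moreover have "Arg ((q A - y (- t)) / (q B - y (- t))) \<le> pi" using Arg_bounded by blast
      ultimately show ?thesis using t(5) unfolding W by linarith
    qed
    have same: "\<bar>winding v (y (- t)) - winding v (y t)\<bar> < pi / 2" if "v \<noteq> a"
      using t(5) winding_split(2)[OF ab that vb] by (simp add: S_def)
    show "winding v (y (- t)) - winding v (y t) < 2 * pi * (of_int (if v = a then 1 else 0) + 1)"
      "2 * pi * (of_int (if v = a then 1 else 0) - 1) < winding v (y (- t)) - winding v (y t)"
      using diff same pi_gt_zero by (cases "v = a"; simp; linarith)+
  qed
  moreover have "winding v x = winding v (y t)" "winding v x' = winding v (y (- t))"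
    using winding_constant_on_face[OF faces(1) _ t(3)] winding_constant_on_face[OF faces(2) _ t(4)] x x'
    by (auto simp: A_def B_def)
  ultimately show ?thesis by simp
qed

end

locale reversed_reciprocal_pair = reciprocal_pair +
  assumes reversed: "dual_embedding_reversed V E p q"
begin

text \<open>
  In the reversed orientation the vertex cycle of \<open>i\<close> is turned into a face cycle of the reciprocal,
  and along a face cycle the left face does not change.
\<close>

lemma recip_face_eq:
  assumes ij: "{i, j} \<in> E"
  shows "recip_face i = dual.lface (lface i j) (lface j i)"
proof -
  define k where "k = (SOME j. {i, j} \<in> E)"
  have ik: "{i, k} \<in> E" unfolding k_def using ij by (rule someI)
  have "dual.lface (lface i j) (lface j i) = dual.lface (lface i k) (lface k i)"
  proof (rule next_ccw_induct[OF ik ij refl])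
    fix l assume il: "{i, l} \<in> E"
      and IH: "dual.lface (lface i l) (lface l i) = dual.lface (lface i k) (lface k i)"
    define n where "n = next_ccw i l"
    have "{i, n} \<in> E" using next_ccw_edge[OF il] by (simp add: n_def)
    then have dual_n: "{lface i n, lface n i} \<in> dual_edges V E p" by (rule dual_edge_in)
    have "face_succ (dual_edges V E p) q (dual_dart V E p (vertex_succ E p (i, l))) = dual_dart V E p (i, l)"
      using reversed il by (simp add: dual_embedding_reversed_def)
    then have "lface n i = lface i l" "dual.next_cw (lface n i) (lface i n) = lface l i"
      by (auto simp: face_succ_def vertex_succ_def dual_dart_def n_def)
    then show "dual.lface (lface i n) (lface n i) = dual.lface (lface i k) (lface k i)"
      using dual.left_face_face_succ[OF dual_n] IH by simp
  qed
  then show ?thesis by (simp add: recip_face_def k_def Let_def)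
qed

lemma recip_face_in_faces:
  assumes "v \<in> V"
  shows "recip_face v \<in> faces (faces V E p) (dual_edges V E p) q"
proof -
  obtain j where "{v, j} \<in> E" using ex_nbr[OF assms] by blast
  then show ?thesis using recip_face_eq dual.left_face_in_faces dual_edge_in by metis
qed

lemma face_is_recip_face:
  assumes "F \<in> faces (faces V E p) (dual_edges V E p) q"
  shows "\<exists>v\<in>V. F = recip_face v"
proof -
  obtain A B where AB: "{A, B} \<in> dual_edges V E p" "F = dual.lface A B"
    using dual.face_has_edge[OF assms dual_edges_nonempty] by blast
  obtain i j where ij: "{i, j} \<in> E" "A = lface i j" "B = lface j i" using dual_edgesE[OF AB(1)] .
  show ?thesis using recip_face_eq[OF ij(1)] edgeD(2)[OF ij(1)] AB(2) ij(2,3) by blast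
qed

text \<open>
  Let \<open>level u\<close> be the value of \<open>winding v\<close> on the reciprocal face of \<open>u\<close>. It does not change along
  edges of \<open>G - v\<close>, which is connected, and it vanishes at \<open>w\<close>. An edge from \<open>v\<close> to a neighbour raises
  it by one full turn, so \<open>level v\<close> is \<open>- 2 * pi\<close> and all other levels are \<open>0\<close>.
\<close>

lemma winding_nonpos:
  assumes v: "v \<in> V" and w: "w \<in> V" "recip_face w = outer_face (faces V E p) (dual_edges V E p) q"
    and ne: "v \<noteq> w"
  shows "(\<forall>y. y \<notin> dual.D \<longrightarrow> winding v y \<le> 0) \<and> recip_face v \<noteq> outer_face (faces V E p) (dual_edges V E p) q"
proof -
  let ?X = "outer_face (faces V E p) (dual_edges V E p) q"
  define level where "level u = winding v (SOME y. y \<in> recip_face u)" for u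
  have level: "winding v y = level u" if "u \<in> V" "y \<in> recip_face u" for u y
    unfolding level_def
    using winding_constant_on_face[OF recip_face_in_faces[OF that(1)] that(2)] that(2)
    by (metis someI)
  have nonempty: "\<exists>y. y \<in> recip_face u" if "u \<in> V" for u
    using recip_face_in_faces[OF that] in_components_nonempty unfolding faces_def by blast
  have across: "level b = level a + 2 * pi * of_int (if v = a then 1 else 0)"
    if ab: "{a, b} \<in> E" and "v \<noteq> b" for a b
  proof -
    have ba: "{b, a} \<in> E" using ab by (simp add: insert_commute)
    obtain x x' where x: "x \<in> recip_face a" "x' \<in> recip_face b"
      using nonempty edgeD(2,3)[OF ab] by blast
    have "winding v x = level a" "winding v x' = level b"
      using level x edgeD(2,3)[OF ab] by auto
    then show ?thesis
      using winding_across_edge[OF ab \<open>v \<noteq> b\<close>, of x x'] x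
      unfolding recip_face_eq[OF ab] recip_face_eq[OF ba] by simp
  qed
  have wv: "w \<in> V - {v}" using w ne by simp
  have level_w: "level w = 0"
    using winding_outer nonempty[OF w(1)] level[OF w(1)] w(2) by metis
  have level_u: "level u = 0" if "u \<in> V" "u \<noteq> v" for u
  proof -
    have "(w, u) \<in> {(x, y). x \<in> V - {v} \<and> y \<in> V - {v} \<and> {x, y} \<in> E}\<^sup>*"
      using two_connected v that wv by (auto simp: two_connected_def connected_on_def)
    then show ?thesis
    proof (induction rule: rtrancl_induct)
      case base then show ?case by (rule level_w)
    next
      case (step x y)
      then have "{x, y} \<in> E" "v \<noteq> x" "v \<noteq> y" by auto
      then show ?case using across[of x y] step.IH by simp
    qed
  qed
  have level_v: "level v = - 2 * pi"
  proof -
    obtain j where j: "{v, j} \<in> E" using ex_nbr[OF v] by blast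
    then show ?thesis using across[OF j] level_u[of j] edgeD[OF j] by simp
  qed
  have le: "level u \<le> 0" if "u \<in> V" for u using level_u[OF that] level_v by (cases "u = v") auto
  have "winding v y \<le> 0" if "y \<notin> dual.D" for y
  proof -
    have "connected_component_set (- dual.D) y \<in> faces (faces V E p) (dual_edges V E p) q"
      "y \<in> connected_component_set (- dual.D) y"
      using that by (auto simp: faces_def connected_component_refl_eq intro: componentsI)
    then show ?thesis using face_is_recip_face level le by metis
  qed
  moreover have "recip_face v \<noteq> ?X"
  proof
    assume "recip_face v = ?X"
    then have "level v = 0" using winding_outer nonempty[OF v] level[OF v] by metis
    then show False using level_v by simp
  qed
  ultimately show ?thesis by blast
qed

lemma ex_outer_vertex:
  "\<exists>w\<in>V. recip_face w = outer_face (faces V E p) (dual_edges V E p) q \<and>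
    (\<forall>v\<in>V. recip_face v = outer_face (faces V E p) (dual_edges V E p) q \<longrightarrow> v = w) \<and>
    (\<forall>v\<in>V. \<forall>y. y \<notin> dual.D \<longrightarrow> 0 < winding v y \<longrightarrow> v = w)"
proof -
  obtain w where "w \<in> V" "recip_face w = outer_face (faces V E p) (dual_edges V E p) q"
    using face_is_recip_face[OF dual.outer_face_in_faces] by metis
  then show ?thesis using winding_nonpos by (metis not_less)
qed

lemma reciprocal_face_of_outer_vertex:
  assumes w: "w \<in> V" "recip_face w = outer_face (faces V E p) (dual_edges V E p) q"
    and uniq: "\<And>v. v \<in> V \<Longrightarrow> recip_face v = outer_face (faces V E p) (dual_edges V E p) q \<Longrightarrow> v = w"
  shows "is_reciprocal_face V E p q w (outer_face (faces V E p) (dual_edges V E p) q)"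
proof -
  let ?X = "outer_face (faces V E p) (dual_edges V E p) q"
  have iff: "{lface i j, lface j i} \<in> edges_of_face (dual_edges V E p) q ?X \<longleftrightarrow> w \<in> {i, j}"
    if ij: "{i, j} \<in> E" for i j
  proof -
    have ji: "{j, i} \<in> E" using ij by (simp add: insert_commute)
    have "recip_face v = ?X \<longleftrightarrow> v = w" if "v \<in> V" for v using uniq[OF that] w(2) by metis
    then have "?X = recip_face i \<or> ?X = recip_face j \<longleftrightarrow> w \<in> {i, j}"
      using edgeD(2,3)[OF ij] by (metis insert_iff singletonD)
    then show ?thesis
      using dual.edges_of_face_iff[OF dual_edge_in[OF ij] dual.outer_face_in_faces]
      unfolding recip_face_eq[OF ij] recip_face_eq[OF ji] by (rule trans[rotated])
  qed
  have "edges_of_face (dual_edges V E p) q ?X = dual_edge V E p ` {e \<in> E. w \<in> e}"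
  proof (intro set_eqI iffI)
    fix \<epsilon> assume \<epsilon>: "\<epsilon> \<in> edges_of_face (dual_edges V E p) q ?X"
    then obtain e where e: "e \<in> E" "\<epsilon> = dual_edge V E p e"
      by (auto simp: edges_of_face_def dual_edges_def)
    obtain i j where ij: "e = {i, j}" "{i, j} \<in> E" using edgeE[OF e(1)] .
    then have "w \<in> e" using iff[OF ij(2)] \<epsilon> e(2) dual_edge_eq by simp
    then show "\<epsilon> \<in> dual_edge V E p ` {e \<in> E. w \<in> e}" using e by blast
  next
    fix \<epsilon> assume "\<epsilon> \<in> dual_edge V E p ` {e \<in> E. w \<in> e}"
    then obtain e where e: "e \<in> E" "w \<in> e" "\<epsilon> = dual_edge V E p e" by blast
    obtain i j where ij: "e = {i, j}" "{i, j} \<in> E" using edgeE[OF e(1)] .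
    then show "\<epsilon> \<in> edges_of_face (dual_edges V E p) q ?X"
      using iff[OF ij(2)] e dual_edge_eq by auto
  qed
  then show ?thesis
    using dual.outer_face_in_faces by (simp add: is_reciprocal_face_def)
qed

end

section \<open>Local structure of the lifting\<close>

text \<open>
  The quantities that the definition of the standard lifting asserts to exist are fixed here: \<open>c\<close> is
  the sign and \<open>g\<close> gives the gradients.
\<close>

locale lifted_pair = reversed_reciprocal_pair +
  fixes h :: "complex \<Rightarrow> real" and c :: real and g :: "complex set \<Rightarrow> complex"
  assumes continuous_h: "continuous_on UNIV h"
    and h_outer: "x \<in> outer_face V E p \<Longrightarrow> h x = 0"
    and c_cases: "c = 1 \<or> c = -1"
    and h_affine: "F \<in> faces V E p \<Longrightarrow> \<exists>b. \<forall>x\<in>F. h x = g F \<bullet> x + b"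
    and boundary_valley: "e \<in> boundary_edges V E p \<Longrightarrow> 0 < c * \<omega> e"
    and gradient_jump: "{i, j} \<in> E \<Longrightarrow>
      g (left_face V E p i j) - g (left_face V E p j i) = (c * \<omega> {i, j}) *\<^sub>R (\<i> * (p j - p i))"
begin

abbreviation "Out \<equiv> outer_face V E p"

abbreviation "rot \<equiv> of_real c * \<i>"

lemma rot_nonzero: "rot \<noteq> 0"
  using c_cases by auto

lemma inner_rot: "(rot * x) \<bullet> (rot * y) = x \<bullet> y"
  using c_cases by (auto simp: inner_complex_def)

lemma h_diff:
  assumes F: "F \<in> faces V E p" and x: "x \<in> closure F" and y: "y \<in> closure F"
  shows "h y - h x = g F \<bullet> (y - x)"
proof -
  obtain b where b: "\<And>z. z \<in> F \<Longrightarrow> h z - g F \<bullet> z = b" using h_affine[OF F] by fastforce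
  have cont: "continuous_on (closure F) (\<lambda>z. h z - g F \<bullet> z)"
    by (intro continuous_intros continuous_on_subset[OF continuous_h]) auto
  have "h z - g F \<bullet> z = b" if "z \<in> closure F" for z
    by (rule continuous_constant_on_closure[OF cont b that])
  then have "h x - g F \<bullet> x = h y - g F \<bullet> y" using x y by simp
  then show ?thesis by (simp add: inner_diff_right)
qed

lemma O_nonempty: "Out \<noteq> {}"
  using outer_face_in_faces in_components_nonempty unfolding faces_def by blast

lemma gradient_outer: "g Out = 0"
proof -
  obtain x where x: "x \<in> Out" using O_nonempty by blast
  have "\<forall>\<^sub>F y in nhds x. y \<in> Out"
    using open_face[OF outer_face_in_faces] x by (rule eventually_nhds_in_open)
  then obtain t where t: "t > 0" "x + t *\<^sub>R g Out \<in> Out"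
    using ex_small_pos[OF eventually_along_ray] by blast
  have "0 = g Out \<bullet> (t *\<^sub>R g Out)"
    using h_diff[OF outer_face_in_faces, of x "x + t *\<^sub>R g Out"] h_outer x t(2) closure_subset
    by (auto dest: subsetD)
  then show ?thesis using t(1) by simp
qed

text \<open>
  The difference of the two sides is the same for the two faces at an edge, hence for all faces around
  a vertex, hence, along the edges of the connected graph \<open>G\<close>, for all faces.
\<close>

lemma gradient_eq:
  assumes F: "F \<in> faces V E p"
  shows "g F = rot * (q F - q Out)"
proof -
  define \<kappa> where "\<kappa> F = g F - rot * q F" for F
  have jump: "\<kappa> (lface i j) = \<kappa> (lface j i)" if "{i, j} \<in> E" for i j
  proof -
    have "g (lface i j) - g (lface j i) = rot * (of_real (\<omega> {i, j}) * (p j - p i))"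
      using gradient_jump[OF that] by (simp add: scaleR_conv_of_real)
    also have "of_real (\<omega> {i, j}) * (p j - p i) = q (lface i j) - q (lface j i)"
      using recip_diff[OF that] by (simp add: scaleR_conv_of_real)
    finally show ?thesis by (simp add: \<kappa>_def algebra_simps)
  qed
  have around: "\<kappa> (lface v j) = \<kappa> (lface v k)" if "{v, j} \<in> E" "{v, k} \<in> E" for v j k
  proof (rule next_ccw_induct[OF that, of "\<lambda>k. \<kappa> (lface v j) = \<kappa> (lface v k)"])
    fix i assume i: "{v, i} \<in> E" "\<kappa> (lface v j) = \<kappa> (lface v i)"
    show "\<kappa> (lface v j) = \<kappa> (lface v (next_ccw v i))"
      using i jump[OF next_ccw_edge[OF i(1)]] left_face_next_ccw[OF i(1)] by simp
  qed simp
  obtain v0 where v0: "v0 \<in> V" using ex_vertex by blast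
  obtain j0 where j0: "{v0, j0} \<in> E" using ex_nbr[OF v0] by blast
  have const: "\<kappa> (lface v j) = \<kappa> (lface v0 j0)" if vj: "{v, j} \<in> E" for v j
  proof -
    have "(v0, v) \<in> {(x, y). x \<in> V \<and> y \<in> V \<and> {x, y} \<in> E}\<^sup>*"
      using two_connected v0 edgeD(2)[OF vj] by (auto simp: two_connected_def connected_on_def)
    then have "\<forall>j. {v, j} \<in> E \<longrightarrow> \<kappa> (lface v j) = \<kappa> (lface v0 j0)"
    proof (induction rule: rtrancl_induct)
      case base then show ?case using around[OF _ j0] by blast
    next
      case (step x y)
      then have xy: "{x, y} \<in> E" "{y, x} \<in> E" by (auto simp: insert_commute)
      have "\<kappa> (lface y x) = \<kappa> (lface v0 j0)" using step.IH xy(1) jump[OF xy(1)] by simp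
      then show ?case using around[OF xy(2)] by metis
    qed
    then show ?thesis using vj by blast
  qed
  have "\<kappa> F = \<kappa> Out"
    using face_has_edge[OF F E_nonempty] face_has_edge[OF outer_face_in_faces E_nonempty] const by metis
  then show ?thesis using gradient_outer by (simp add: \<kappa>_def algebra_simps)
qed

lemma gradient_inj:
  assumes "F \<in> faces V E p" "G \<in> faces V E p" "g F = g G"
  shows "F = G"
proof -
  have "q F = q G" using gradient_eq[OF assms(1)] gradient_eq[OF assms(2)] assms(3) rot_nonzero by auto
  then show ?thesis using dual.inj_p assms by (auto dest: inj_onD)
qed

text \<open>
  Maxima (\<open>\<sigma> = 1\<close>) and minima (\<open>\<sigma> = -1\<close>) are treated together.
\<close>

definition local_extremum :: "real \<Rightarrow> complex \<Rightarrow> bool" where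
  "local_extremum \<sigma> x \<longleftrightarrow> (\<sigma> = 1 \<or> \<sigma> = -1) \<and> (\<forall>\<^sub>F y in nhds x. \<sigma> * h y \<le> \<sigma> * h x)"

lemma local_extremum_slope:
  assumes ext: "local_extremum \<sigma> x" and F: "F \<in> faces V E p" and x: "x \<in> closure F"
    and d: "\<forall>\<^sub>F t in at_right 0. x + t *\<^sub>R d \<in> closure F"
  shows "\<sigma> * (g F \<bullet> d) \<le> 0"
proof -
  have "\<forall>\<^sub>F y in nhds x. \<sigma> * h y \<le> \<sigma> * h x" using ext by (simp add: local_extremum_def)
  then have "\<forall>\<^sub>F t in at_right 0. \<sigma> * h (x + t *\<^sub>R d) \<le> \<sigma> * h x" by (rule eventually_along_ray)
  then have "\<forall>\<^sub>F t in at_right 0. \<sigma> * h (x + t *\<^sub>R d) \<le> \<sigma> * h x \<and> x + t *\<^sub>R d \<in> closure F"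
    using d by eventually_elim simp
  then obtain t where t: "t > 0" "\<sigma> * h (x + t *\<^sub>R d) \<le> \<sigma> * h x" "x + t *\<^sub>R d \<in> closure F"
    using ex_small_pos by blast
  have "t * (\<sigma> * (g F \<bullet> d)) = \<sigma> * (h (x + t *\<^sub>R d) - h x)"
    using h_diff[OF F x t(3)] by simp
  then have "t * (\<sigma> * (g F \<bullet> d)) \<le> 0" using t(2) by (simp add: right_diff_distrib)
  then show ?thesis using t(1) by (simp add: mult_le_0_iff)
qed

lemma local_extremum_in_face:
  assumes ext: "local_extremum \<sigma> x" and F: "F \<in> faces V E p" and x: "x \<in> F"
  shows "F = Out"
proof -
  have "\<forall>\<^sub>F y in nhds x. y \<in> closure F"
    using eventually_nhds_in_open[OF open_face[OF F] x]
    by (rule eventually_mono) (rule mem_closureI)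
  then have "\<sigma> * (g F \<bullet> (\<sigma> *\<^sub>R g F)) \<le> 0"
    by (intro local_extremum_slope[OF ext F mem_closureI[OF x]] eventually_along_ray)
  moreover have "\<sigma> * \<sigma> = 1" using ext by (auto simp: local_extremum_def)
  ultimately have "g F \<bullet> g F \<le> 0" by (simp flip: mult.assoc)
  then have "g F \<bullet> g F = 0" using inner_ge_zero[of "g F"] by linarith
  then have "g F = g Out" using gradient_outer by simp
  then show ?thesis using gradient_inj[OF F outer_face_in_faces] by blast
qed

text \<open>
  Along the edge the slope vanishes, so both adjacent gradients are normal to it. Extremality makes
  them point to opposite sides, so \<open>0\<close> lies on the segment between them. In the reciprocal, the vertex
  \<open>q O\<close> then lies on the edge dual to \<open>{i, j}\<close>, and must be one of its ends.
\<close>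

lemma local_extremum_on_edge:
  assumes ext: "local_extremum \<sigma> x" and ij: "{i, j} \<in> E" and s: "0 < s" "s < 1"
    and x: "x = edge_pt i j s 0"
  shows "lface i j = Out \<or> lface j i = Out"
proof -
  define L where "L = lface i j"
  define R where "R = lface j i"
  define d where "d = p j - p i"
  define n where "n = \<i> * d"
  have d: "d \<noteq> 0" using nbr_dir_nonzero[OF ij] by (simp add: d_def)
  have n: "n \<noteq> 0" "0 < n \<bullet> n" using d by (simp_all add: n_def)
  have LR: "L \<in> faces V E p" "R \<in> faces V E p"
    using left_face_in_faces[OF ij] right_face_in_faces[OF ij] by (simp_all add: L_def R_def)
  have ji: "{j, i} \<in> E" using ij by (simp add: insert_commute)
  have xcl: "x \<in> closure L" "x \<in> closure R"
    unfolding x L_def R_def using edge_pt_in_closures[OF ij] s by auto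
  have shift: "x + t *\<^sub>R d = edge_pt i j (s + t) 0" "x + t *\<^sub>R n = edge_pt i j s t" for t
    unfolding x edge_pt_def d_def n_def by (simp_all add: complex_eq_iff algebra_simps)
  have "\<forall>\<^sub>F t in at_right 0. x + t *\<^sub>R d \<in> closure L"
    using eventually_small_pos[of "1 - s"] s
    by (auto elim!: eventually_mono simp: shift L_def intro!: edge_pt_in_closures(1)[OF ij])
  then have 1: "\<sigma> * (g L \<bullet> d) \<le> 0" by (rule local_extremum_slope[OF ext LR(1) xcl(1)])
  have "\<forall>\<^sub>F t in at_right 0. x + t *\<^sub>R (- d) \<in> closure L"
    using eventually_small_pos[of s] s shift(1)[of "- t" for t]
    by (auto elim!: eventually_mono simp: L_def intro!: edge_pt_in_closures(1)[OF ij])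
  then have "\<sigma> * (g L \<bullet> (- d)) \<le> 0" by (rule local_extremum_slope[OF ext LR(1) xcl(1)])
  then have "\<sigma> * (g L \<bullet> d) = 0" using 1 by simp
  then have gLd: "g L \<bullet> d = 0" using ext by (auto simp: local_extremum_def)
  have jump: "g L - g R = (c * \<omega> {i, j}) *\<^sub>R n"
    using gradient_jump[OF ij] by (simp add: L_def R_def n_def d_def)
  have "(g L - g R) \<bullet> d = 0" unfolding jump n_def by (simp add: inner_rotate_self)
  then have gRd: "g R \<bullet> d = 0" using gLd by (simp add: inner_diff_left)
  obtain \<alpha> where \<alpha>: "g L = \<alpha> *\<^sub>R n" using perpendicular_eq_multiple[OF d gLd] unfolding n_def .
  obtain \<beta> where \<beta>: "g R = \<beta> *\<^sub>R n" using perpendicular_eq_multiple[OF d gRd] unfolding n_def .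
  have "\<forall>\<^sub>F t in at_right 0. x + t *\<^sub>R n \<in> closure L"
  proof -
    obtain \<delta> where \<delta>: "\<delta> > 0" "\<And>t. 0 < t \<Longrightarrow> t < \<delta> \<Longrightarrow> edge_pt i j s t \<in> L"
      using strip_in_left_face[OF ij s] unfolding L_def by blast
    show ?thesis using eventually_small_pos[OF \<delta>(1)]
      by (auto elim!: eventually_mono simp: shift(2) intro!: mem_closureI \<delta>(2))
  qed
  then have "\<sigma> * (g L \<bullet> n) \<le> 0" by (rule local_extremum_slope[OF ext LR(1) xcl(1)])
  then have s\<alpha>: "\<sigma> * \<alpha> \<le> 0" using n(2) by (simp add: \<alpha> mult_le_0_iff zero_le_mult_iff)
  have "\<forall>\<^sub>F t in at_right 0. x + t *\<^sub>R (- n) \<in> closure R"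
  proof -
    have "0 < 1 - s" "1 - s < 1" using s by auto
    then obtain \<delta> where \<delta>: "\<delta> > 0" "\<And>t. 0 < t \<Longrightarrow> t < \<delta> \<Longrightarrow> edge_pt j i (1 - s) t \<in> R"
      using strip_in_left_face[OF ji, of "1 - s" "1 - s"] unfolding R_def by blast
    have "x + t *\<^sub>R (- n) = edge_pt j i (1 - s) t" for t
      using shift(2)[of "- t"] edge_pt_swap[of j i "1 - s" t] by simp
    then show ?thesis using eventually_small_pos[OF \<delta>(1)] \<delta>(2)
      by (auto elim!: eventually_mono intro!: mem_closureI simp del: scaleR_minus_right)
  qed
  then have "\<sigma> * (g R \<bullet> (- n)) \<le> 0" by (rule local_extremum_slope[OF ext LR(2) xcl(2)])
  then have s\<beta>: "0 \<le> \<sigma> * \<beta>" using n(2) by (simp add: \<beta> zero_le_mult_iff mult_le_0_iff)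
  have "\<alpha> \<noteq> \<beta>" using gradient_inj[OF LR] left_right_distinct[OF ij] \<alpha> \<beta> by (auto simp: L_def R_def)
  \<comment> \<open>the parameter of the zero of the segment from \<open>\<alpha> *\<^sub>R n\<close> to \<open>\<beta> *\<^sub>R n\<close>\<close>
  define u where "u = \<alpha> / (\<alpha> - \<beta>)"
  have u: "0 \<le> u" "u \<le> 1"
    using s\<alpha> s\<beta> ext \<open>\<alpha> \<noteq> \<beta>\<close> by (auto simp: u_def local_extremum_def divide_simps)
  have "(1 - u) *\<^sub>R g L + u *\<^sub>R g R = (\<alpha> - u * (\<alpha> - \<beta>)) *\<^sub>R n"
    by (simp add: \<alpha> \<beta> algebra_simps)
  also have "\<dots> = 0" using \<open>\<alpha> \<noteq> \<beta>\<close> by (simp add: u_def)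
  finally have "rot * ((1 - u) *\<^sub>R (q L - q Out) + u *\<^sub>R (q R - q Out)) = 0"
    unfolding gradient_eq[OF LR(1)] gradient_eq[OF LR(2)] by (simp add: algebra_simps)
  then have "(1 - u) *\<^sub>R (q L - q Out) + u *\<^sub>R (q R - q Out) = 0" using rot_nonzero by simp
  then have "q Out = (1 - u) *\<^sub>R q L + u *\<^sub>R q R" by (simp add: algebra_simps)
  then have "q Out \<in> closed_segment (q L) (q R)" using u by (auto simp: in_segment)
  then have "Out = L \<or> Out = R"
    using dual.vertex_on_segment[OF outer_face_in_faces dual_edge_in[OF ij]] by (simp add: L_def R_def)
  then show ?thesis by (auto simp: L_def R_def)
qed

text \<open>
  A nearby point of the same height would itself be a local extremum, in the interior of a face or of an
  edge, which is possible only at the outer face.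
\<close>

lemma local_extremum_at_vertex_strict:
  assumes ext: "local_extremum \<sigma> x" and nO: "x \<notin> closure Out"
  shows "\<exists>v\<in>V. x = p v \<and> (\<forall>\<^sub>F y in at x. \<sigma> * h y < \<sigma> * h x)"
proof -
  have "x \<in> D"
  proof (rule ccontr)
    assume "x \<notin> D"
    then obtain F where F: "F \<in> faces V E p" "x \<in> F" using off_D_in_face by blast
    then have "x \<in> Out" using local_extremum_in_face[OF ext] by blast
    then show False using nO mem_closureI by blast
  qed
  then obtain v where v: "v \<in> V" "x = p v"
  proof (cases rule: on_D_cases)
    case (2 i j s)
    have "x \<in> closure (lface i j)" "x \<in> closure (lface j i)"
      using edge_pt_in_closures[OF 2(1), of s] 2(2-4) by auto
    then show thesis using local_extremum_on_edge[OF ext 2] nO by auto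
  qed
  obtain i where vi: "{v, i} \<in> E" using ex_nbr[OF v(1)] by blast
  obtain r where r: "r > 0" "\<And>z. z \<noteq> 0 \<Longrightarrow> norm z < r \<Longrightarrow>
    (\<exists>j t. {v, j} \<in> E \<and> 0 < t \<and> t < 1 \<and> z = of_real t * (p j - p v)) \<or>
    (\<exists>j. {v, j} \<in> E \<and> p v + z \<in> lface v j)"
    using vertex_star[OF vi] by blast
  have notO: "lface v j \<noteq> Out" "lface j v \<noteq> Out" if "{v, j} \<in> E" for j
    using nO edge_pt_in_closures[OF that, of 0] v(2) by (auto simp: edge_pt_endpoints)
  have "\<forall>\<^sub>F y in nhds x. \<forall>\<^sub>F z in nhds y. \<sigma> * h z \<le> \<sigma> * h x"
    using ext by (simp add: local_extremum_def eventually_eventually)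
  moreover have "\<forall>\<^sub>F y in nhds x. dist y x < r" using r(1) by (auto simp: eventually_nhds_metric)
  ultimately have "\<forall>\<^sub>F y in nhds x. y \<noteq> x \<longrightarrow> \<sigma> * h y < \<sigma> * h x"
  proof eventually_elim
    case (elim y)
    show ?case
    proof (rule impI, rule ccontr)
      assume "y \<noteq> x" and "\<not> \<sigma> * h y < \<sigma> * h x"
      moreover have "\<sigma> * h y \<le> \<sigma> * h x" using elim(1) eventually_nhds_x_imp_x by blast
      ultimately have "\<sigma> * h y = \<sigma> * h x" by simp
      then have "\<forall>\<^sub>F z in nhds y. \<sigma> * h z \<le> \<sigma> * h y" using elim(1) by (simp only:)
      then have exty: "local_extremum \<sigma> y" using ext unfolding local_extremum_def by blast
      have "norm (y - p v) < r" "y - p v \<noteq> 0"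
        using elim(2) \<open>y \<noteq> x\<close> v(2) by (auto simp: dist_norm)
      then consider j t where "{v, j} \<in> E" "0 < t" "t < 1" "y - p v = of_real t * (p j - p v)"
        | j where "{v, j} \<in> E" "p v + (y - p v) \<in> lface v j"
        using r(2) by blast
      then show False
      proof cases
        case 1
        then have "y = edge_pt v j t 0"
          by (simp add: edge_pt_real scaleR_conv_of_real algebra_simps)
        then show False using local_extremum_on_edge[OF exty 1(1-3)] notO[OF 1(1)] by blast
      next
        case 2
        then show False
          using local_extremum_in_face[OF exty left_face_in_faces[OF 2(1)]] notO[OF 2(1)] by simp
      qed
    qed
  qed
  then show ?thesis using v by (auto simp: eventually_at_filter)
qed

lemma strict_slope:
  assumes strict: "\<forall>\<^sub>F y in at x. \<sigma> * (h y - h x - a \<bullet> (y - x)) < 0"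
    and F: "F \<in> faces V E p" and x: "x \<in> closure F" and d0: "d \<noteq> 0"
    and d: "\<forall>\<^sub>F t in at_right 0. x + t *\<^sub>R d \<in> closure F"
  shows "\<sigma> * ((g F - a) \<bullet> d) < 0"
proof -
  have "\<forall>\<^sub>F y in nhds x. y \<noteq> x \<longrightarrow> \<sigma> * (h y - h x - a \<bullet> (y - x)) < 0"
    using strict by (simp add: eventually_at_filter)
  then have "\<forall>\<^sub>F t in at_right 0. x + t *\<^sub>R d \<noteq> x \<longrightarrow>
    \<sigma> * (h (x + t *\<^sub>R d) - h x - a \<bullet> (x + t *\<^sub>R d - x)) < 0"
    by (rule eventually_along_ray)
  then have "\<forall>\<^sub>F t in at_right 0. (x + t *\<^sub>R d \<noteq> x \<longrightarrow>
    \<sigma> * (h (x + t *\<^sub>R d) - h x - a \<bullet> (x + t *\<^sub>R d - x)) < 0) \<and> x + t *\<^sub>R d \<in> closure F"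
    using d by eventually_elim blast
  then obtain t where t: "t > 0" "x + t *\<^sub>R d \<in> closure F"
    "x + t *\<^sub>R d \<noteq> x \<longrightarrow> \<sigma> * (h (x + t *\<^sub>R d) - h x - a \<bullet> (x + t *\<^sub>R d - x)) < 0"
    using ex_small_pos by blast
  have "t * (\<sigma> * ((g F - a) \<bullet> d)) = \<sigma> * (h (x + t *\<^sub>R d) - h x - a \<bullet> (x + t *\<^sub>R d - x))"
    using h_diff[OF F x t(2)] by (simp add: inner_diff_left algebra_simps)
  also have "\<dots> < 0" using t(1,3) d0 by simp
  finally show ?thesis using t(1) by (simp add: mult_less_0_iff)
qed

text \<open>
  A sector of angle at least \<open>\<pi>\<close> would contain a line through the vertex on which the surface is
  straight. The slope \<open>a\<close> of the supporting plane corresponds to the point \<open>q O + a / rot\<close> of the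
  reciprocal plane. The inequalities along the edges are stable under small changes of \<open>a\<close>, so this
  point may be moved off the reciprocal drawing.
\<close>

lemma pointed_vertex:
  assumes v: "v \<in> V" and \<sigma>: "\<sigma> = 1 \<or> \<sigma> = -1"
    and strict: "\<forall>\<^sub>F y in at (p v). \<sigma> * (h y - h (p v) - a \<bullet> (y - p v)) < 0"
  shows "\<exists>y. y \<notin> dual.D \<and> 0 < winding v y"
    and "\<And>j. {v, j} \<in> E \<Longrightarrow> ccw_angle (p j - p v) (p (next_ccw v j) - p v) < pi"
    and "\<And>j. {v, j} \<in> E \<Longrightarrow> \<sigma> * ((g (lface v j) - a) \<bullet> (p j - p v)) < 0"
    and "\<And>j. {v, j} \<in> E \<Longrightarrow> \<sigma> * ((g (lface j v) - a) \<bullet> (p j - p v)) < 0"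
proof -
  note slope = strict_slope[OF strict]
  have pv: "p v \<in> closure (lface v j)" "p v \<in> closure (lface j v)" if "{v, j} \<in> E" for j
    using edge_pt_in_closures[OF that, of 0] by (simp_all add: edge_pt_endpoints)
  have ray: "\<forall>\<^sub>F t in at_right 0. p v + t *\<^sub>R (p j - p v) \<in> closure (lface v j)"
    "\<forall>\<^sub>F t in at_right 0. p v + t *\<^sub>R (p j - p v) \<in> closure (lface j v)" if j: "{v, j} \<in> E" for j
  proof -
    have "\<forall>\<^sub>F t in at_right (0::real). 0 < t \<and> t < 1" by (rule eventually_small_pos) simp
    then show "\<forall>\<^sub>F t in at_right 0. p v + t *\<^sub>R (p j - p v) \<in> closure (lface v j)"
      "\<forall>\<^sub>F t in at_right 0. p v + t *\<^sub>R (p j - p v) \<in> closure (lface j v)"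
      using edge_pt_in_closures[OF j] unfolding edge_pt_real by (auto elim!: eventually_mono)
  qed
  have left: "\<sigma> * ((g (lface v j) - a) \<bullet> (p j - p v)) < 0"
    and right: "\<sigma> * ((g (lface j v) - a) \<bullet> (p j - p v)) < 0" if j: "{v, j} \<in> E" for j
    using slope[OF left_face_in_faces[OF j] pv(1)[OF j] nbr_dir_nonzero[OF j] ray(1)[OF j]]
      slope[OF right_face_in_faces[OF j] pv(2)[OF j] nbr_dir_nonzero[OF j] ray(2)[OF j]] .
  show "\<sigma> * ((g (lface v j) - a) \<bullet> (p j - p v)) < 0"
    "\<sigma> * ((g (lface j v) - a) \<bullet> (p j - p v)) < 0" if "{v, j} \<in> E" for j
    using left[OF that] right[OF that] .
  have convex: "ccw_angle (p j - p v) (p (next_ccw v j) - p v) < pi" if j: "{v, j} \<in> E" for j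
  proof (rule ccontr)
    define d where "d = p j - p v"
    define d' where "d' = p (next_ccw v j) - p v"
    have vn: "{v, next_ccw v j} \<in> E" using next_ccw_edge[OF j] .
    have nz: "d \<noteq> 0" "d' \<noteq> 0" using nbr_dir_nonzero[OF j] nbr_dir_nonzero[OF vn] by (simp_all add: d_def d'_def)
    assume "\<not> ccw_angle (p j - p v) (p (next_ccw v j) - p v) < pi"
    then consider "ccw_angle d d' = pi" | "pi < ccw_angle d d'" by (fastforce simp: d_def d'_def)
    \<comment> \<open>The direction \<open>- d\<close> points into the sector or, if the angle is exactly \<open>pi\<close>, along its second
      edge.\<close>
    then have "\<forall>\<^sub>F t in at_right 0. p v + t *\<^sub>R (- d) \<in> closure (lface v j)"
    proof cases
      case 1
      define m where "m = norm d' / norm d"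
      have m: "m > 0" using nz by (simp add: m_def)
      have "d' = of_real m * cis pi * d" using ccw_angle_polar[OF nz(1), of d'] 1 by (simp add: m_def)
      then have "d = (1 / m) *\<^sub>R (- d')" using m by (simp add: scaleR_conv_of_real)
      then have eq: "p v + t *\<^sub>R (- d) = edge_pt v (next_ccw v j) (t / m) 0" for t
        by (simp add: edge_pt_real d'_def[symmetric])
      have "\<forall>\<^sub>F t in at_right (0::real). 0 < t \<and> t < m" using eventually_small_pos m by blast
      then show ?thesis
      proof eventually_elim
        case (elim t)
        then have "edge_pt v (next_ccw v j) (t / m) 0 \<in> closure (lface (next_ccw v j) v)"
          using m by (intro edge_pt_in_closures(2)[OF vn]) auto
        then show ?case unfolding eq left_face_next_ccw[OF j] .
      qed
    next
      case 2
      obtain r where r: "r > 0" "sector v j r \<subseteq> lface v j"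
        using sector_in_face[OF v] j by blast
      have "\<forall>\<^sub>F t in at_right (0::real). 0 < t \<and> t < r / norm d" using eventually_small_pos[of "r / norm d"] r(1) nz by simp
      then show ?thesis
      proof eventually_elim
        case (elim t)
        have "ccw_angle d (t *\<^sub>R (- d)) = pi"
          using ccw_angle_scale_right[of t d "- d"] ccw_angle_opposite[OF nz(1)] elim
          by (simp add: scaleR_conv_of_real)
        moreover have "norm (t *\<^sub>R (- d)) < r" "t *\<^sub>R (- d) \<noteq> 0"
          using elim nz by (auto simp: field_simps)
        ultimately have "p v + t *\<^sub>R (- d) \<in> sector v j r"
          unfolding sector_def mem_Collect_eq d_def[symmetric] d'_def[symmetric] using 2 by auto
        then show ?case using r(2) mem_closureI by blast
      qed
    qed
    then have "\<sigma> * ((g (lface v j) - a) \<bullet> (- d)) < 0"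
      using nz(1) by (intro slope[OF left_face_in_faces[OF j] pv(1)[OF j]]) auto
    then show False using left[OF j] by (simp add: d_def[symmetric])
  qed
  then show "ccw_angle (p j - p v) (p (next_ccw v j) - p v) < pi" if "{v, j} \<in> E" for j
    using that .
  define N where "N = {j. {v, j} \<in> E}"
  define f where "f = (\<lambda>F j y. \<sigma> * ((g F - rot * (y - q Out)) \<bullet> (p j - p v)))"
  define S where "S = (\<Inter>j\<in>N. {y. f (lface v j) j y < 0} \<inter> {y. f (lface j v) j y < 0})"
  have "open S"
    unfolding S_def f_def N_def
    by (intro open_INT finite_nbrs ballI open_Int open_Collect_less continuous_intros)
  moreover have "q Out + a / rot \<in> S"
    using left right rot_nonzero by (auto simp: S_def f_def N_def)
  ultimately obtain y where y: "y \<in> S" "y \<notin> dual.D" using dual.ex_point_off_D by blast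
  define u where "u = (\<lambda>F. of_real \<sigma> * rot * (q F - y))"
  have u: "u F \<bullet> (p j - p v) = f F j y" if "F \<in> faces V E p" for F j
  proof -
    have "u F = \<sigma> *\<^sub>R (g F - rot * (y - q Out))"
      using gradient_eq[OF that] by (simp add: u_def scaleR_conv_of_real algebra_simps)
    then show ?thesis by (simp add: f_def)
  qed
  obtain i where vi: "{v, i} \<in> E" using ex_nbr[OF v] by blast
  have "0 < (\<Sum>j | {v, j} \<in> E. Arg (u (lface v j) / u (lface j v)))"
    by (rule angle_sum_around_vertex_pos[OF vi _ _ convex])
      (use y(1) u left_face_in_faces right_face_in_faces in \<open>auto simp: S_def N_def\<close>)
  also have "(\<Sum>j | {v, j} \<in> E. Arg (u (lface v j) / u (lface j v))) = winding v y"
    unfolding winding_def angle_sum_def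
    using \<sigma> rot_nonzero by (intro sum.cong) (auto simp: u_def)
  finally show "\<exists>y. y \<notin> dual.D \<and> 0 < winding v y" using y(2) by blast
qed

lemma local_extremum_pointed:
  assumes "local_extremum \<sigma> x" "x \<notin> closure Out"
  obtains v where "v \<in> V" "x = p v" "\<sigma> = 1 \<or> \<sigma> = -1"
    "\<forall>\<^sub>F y in at (p v). \<sigma> * (h y - h (p v) - 0 \<bullet> (y - p v)) < 0"
proof -
  obtain v where "v \<in> V" "x = p v" "\<forall>\<^sub>F y in at x. \<sigma> * h y < \<sigma> * h x"
    using local_extremum_at_vertex_strict[OF assms] by blast
  then show thesis
    using that assms(1) by (auto simp: local_extremum_def right_diff_distrib elim: eventually_mono)
qed

text \<open>
  A supporting plane is never vertical, because the surface is a graph over the whole plane. In the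
  interior of a face or of an edge the surface contains a line segment around the point, which a
  strictly supporting plane does not allow.
\<close>

lemma pointed_is_vertex:
  assumes pt: "pointed_at (lifted_surface h) (x, h x)"
  obtains v \<sigma> a where "v \<in> V" "x = p v" "\<sigma> = 1 \<or> \<sigma> = -1"
    "\<forall>\<^sub>F y in at (p v). \<sigma> * (h y - h (p v) - a \<bullet> (y - p v)) < 0"
proof -
  obtain \<alpha> \<beta> where ab: "(\<alpha>, \<beta>) \<noteq> 0"
    "\<forall>\<^sub>F Q in at (x, h x) within lifted_surface h. (\<alpha>, \<beta>) \<bullet> Q < (\<alpha>, \<beta>) \<bullet> (x, h x)"
    using pt unfolding pointed_at_def by (metis surj_pair)
  have "isCont h x" using continuous_h by (simp add: continuous_on_eq_continuous_at)
  then have "((\<lambda>y. (y, h y)) \<longlongrightarrow> (x, h x)) (at x)"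
    by (intro tendsto_intros) (simp add: isCont_def)
  moreover have "\<forall>\<^sub>F y in at x. (y, h y) \<in> lifted_surface h \<and> (y, h y) \<noteq> (x, h x)"
    by (auto simp: eventually_at_filter lifted_surface_def)
  ultimately have "filterlim (\<lambda>y. (y, h y)) (at (x, h x) within lifted_surface h) (at x)"
    by (simp add: filterlim_at)
  then have "\<forall>\<^sub>F y in at x. (\<alpha>, \<beta>) \<bullet> (y, h y) < (\<alpha>, \<beta>) \<bullet> (x, h x)"
    by (rule eventually_compose_filterlim[OF ab(2)])
  then have ev: "\<forall>\<^sub>F y in at x. \<alpha> \<bullet> (y - x) + \<beta> * (h y - h x) < 0"
    by eventually_elim (simp add: inner_diff_right right_diff_distrib)
  have "\<beta> \<noteq> 0"
  proof
    assume "\<beta> = 0"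
    then have "\<alpha> \<noteq> 0" using ab(1) by (auto simp: zero_prod_def)
    have "\<forall>\<^sub>F y in nhds x. y \<noteq> x \<longrightarrow> \<alpha> \<bullet> (y - x) < 0"
      using ev \<open>\<beta> = 0\<close> by (simp add: eventually_at_filter)
    then obtain t where t: "t > 0" "x + t *\<^sub>R \<alpha> \<noteq> x \<longrightarrow> \<alpha> \<bullet> (x + t *\<^sub>R \<alpha> - x) < 0"
      using ex_small_pos[OF eventually_along_ray] by blast
    then have "t * (\<alpha> \<bullet> \<alpha>) < 0" using \<open>\<alpha> \<noteq> 0\<close> by simp
    then show False using t(1) inner_ge_zero[of \<alpha>] by (simp add: mult_less_0_iff)
  qed
  define \<sigma> where "\<sigma> = sgn \<beta>"
  define a where "a = - (1 / \<beta>) *\<^sub>R \<alpha>"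
  have \<sigma>: "\<sigma> = 1 \<or> \<sigma> = -1" using \<open>\<beta> \<noteq> 0\<close> by (auto simp: \<sigma>_def sgn_if)
  have strict: "\<forall>\<^sub>F y in at x. \<sigma> * (h y - h x - a \<bullet> (y - x)) < 0"
    using ev
  proof eventually_elim
    case (elim y)
    have "\<sigma> * (h y - h x - a \<bullet> (y - x)) = (\<alpha> \<bullet> (y - x) + \<beta> * (h y - h x)) / \<bar>\<beta>\<bar>"
      using \<open>\<beta> \<noteq> 0\<close> by (auto simp: \<sigma>_def a_def sgn_if field_simps)
    also have "\<dots> < 0" using elim \<open>\<beta> \<noteq> 0\<close> by (simp add: divide_neg_pos)
    finally show ?case .
  qed
  have no_line: False
    if F: "F \<in> faces V E p" "x \<in> closure F" and d: "d \<noteq> 0"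
      "\<forall>\<^sub>F t in at_right 0. x + t *\<^sub>R d \<in> closure F" "\<forall>\<^sub>F t in at_right 0. x + t *\<^sub>R (- d) \<in> closure F"
    for F d
    using strict_slope[OF strict F d(1,2)] strict_slope[OF strict F _ d(3)] d(1) by simp
  have "x \<in> D"
  proof (rule ccontr)
    assume "x \<notin> D"
    then obtain F where F: "F \<in> faces V E p" "x \<in> F" using off_D_in_face by blast
    have near: "\<forall>\<^sub>F y in nhds x. y \<in> closure F"
      using eventually_nhds_in_open[OF open_face[OF F(1)] F(2)]
      by (rule eventually_mono) (rule mem_closureI)
    show False
      by (rule no_line[OF F(1) mem_closureI[OF F(2)] one_neq_zero
            eventually_along_ray[OF near] eventually_along_ray[OF near]])
  qed
  then show thesis
  proof (cases rule: on_D_cases)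
    case (1 v)
    then show thesis using that \<sigma> strict by blast
  next
    case (2 i j s)
    define d where "d = p j - p i"
    have d: "d \<noteq> 0" using nbr_dir_nonzero[OF 2(1)] by (simp add: d_def)
    have shift: "x + t *\<^sub>R d = edge_pt i j (s + t) 0" for t
      unfolding 2(4) edge_pt_def d_def by (simp add: complex_eq_iff algebra_simps)
    have "x \<in> closure (lface i j)" using edge_pt_in_closures(1)[OF 2(1), of s] 2 by simp
    moreover have "\<forall>\<^sub>F t in at_right 0. x + t *\<^sub>R d \<in> closure (lface i j)"
      using eventually_small_pos[of "1 - s"] 2(2,3)
      by (auto elim!: eventually_mono simp: shift intro!: edge_pt_in_closures(1)[OF 2(1)])
    moreover have "\<forall>\<^sub>F t in at_right 0. x + t *\<^sub>R (- d) \<in> closure (lface i j)"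
      using eventually_small_pos[of s] 2(2,3) shift[of "- t" for t]
      by (auto elim!: eventually_mono intro!: edge_pt_in_closures(1)[OF 2(1)])
    ultimately show thesis using no_line[OF left_face_in_faces[OF 2(1)] _ d] by blast
  qed
qed

section \<open>Ridges at the maximum\<close>

text \<open>
  The duals of two consecutive edges at \<open>w\<close>, seen from the common face between them, enclose the
  angle of the sector at \<open>w\<close> if the signs differ and that angle plus \<open>\<pi>\<close> if they agree.
\<close>

lemma consecutive_signs:
  assumes wj: "{w, j} \<in> E" and conv: "ccw_angle (p j - p w) (p (next_ccw w j) - p w) < pi"
    and gap: "pi < ccw_angle (q (lface j w) - q (lface w j))
      (q (dual.next_ccw (lface w j) (lface j w)) - q (lface w j))"
  shows "dual.next_ccw (lface w j) (lface j w) = lface w (next_ccw w j)"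
    and "0 < \<omega> {w, j} * \<omega> {w, next_ccw w j}"
proof -
  define n where "n = next_ccw w j"
  have wn: "{w, n} \<in> E" using next_ccw_edge[OF wj] by (simp add: n_def)
  have nw: "{n, w} \<in> E" using wn by (simp add: insert_commute)
  have F: "lface n w = lface w j" using left_face_next_ccw[OF wj] by (simp add: n_def)
  have "vertex_succ (dual_edges V E p) q (dual_dart V E p (face_succ E p (n, w))) = dual_dart V E p (n, w)"
    using reversed nw by (simp add: dual_embedding_reversed_def)
  moreover have "face_succ E p (n, w) = (w, j)"
    using next_cw_next_ccw[OF wj] by (simp add: face_succ_def n_def)
  ultimately have "(lface w j, dual.next_ccw (lface w j) (lface j w)) = (lface n w, lface w n)"
    by (simp only: vertex_succ_def dual_dart_def prod.case)
  then have succ: "dual.next_ccw (lface w j) (lface j w) = lface w n" by blast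
  then show "dual.next_ccw (lface w j) (lface j w) = lface w (next_ccw w j)" by (simp add: n_def)
  have 1: "q (lface j w) - q (lface w j) = of_real (\<omega> {w, j}) * - (p j - p w)"
    using recip_diff[OF wj] by (simp add: scaleR_conv_of_real algebra_simps)
  have 2: "q (lface w n) - q (lface w j) = of_real (\<omega> {w, n}) * (p n - p w)"
    using recip_diff[OF wn] by (simp add: F scaleR_conv_of_real)
  have gap': "pi < ccw_angle (of_real (\<omega> {w, j}) * - (p j - p w)) (of_real (\<omega> {w, n}) * (p n - p w))"
    using gap unfolding succ 1 2 .
  show "0 < \<omega> {w, j} * \<omega> {w, next_ccw w j}"
  proof (rule ccontr)
    assume "\<not> 0 < \<omega> {w, j} * \<omega> {w, next_ccw w j}"
    then consider "0 < \<omega> {w, j}" "\<omega> {w, n} < 0" | "\<omega> {w, j} < 0" "0 < \<omega> {w, n}"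
      using stress_nonzero[OF wj] stress_nonzero[OF wn]
      by (fastforce simp: n_def zero_less_mult_iff not_less neq_iff)
    then have "ccw_angle (of_real (\<omega> {w, j}) * - (p j - p w)) (of_real (\<omega> {w, n}) * (p n - p w)) =
      ccw_angle (p j - p w) (p n - p w)"
    proof cases
      case 1
      then have "ccw_angle (of_real (\<omega> {w, j}) * - (p j - p w)) (of_real (- \<omega> {w, n}) * - (p n - p w)) =
        ccw_angle (- (p j - p w)) (- (p n - p w))" by (intro ccw_angle_scale) auto
      then show ?thesis
        unfolding ccw_angle_uminus
        by (simp only: of_real_minus mult_minus_left mult_minus_right minus_minus)
    next
      case 2
      then have "ccw_angle (of_real (- \<omega> {w, j}) * (p j - p w)) (of_real (\<omega> {w, n}) * (p n - p w)) =
        ccw_angle (p j - p w) (p n - p w)" by (intro ccw_angle_scale) auto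
      then show ?thesis
        by (simp only: of_real_minus mult_minus_left mult_minus_right minus_minus)
    qed
    then show False using gap' conv by (simp add: n_def)
  qed
qed

lemma ex_farthest_face:
  "\<exists>F\<in>faces V E p. \<forall>G\<in>faces V E p. norm (g G - z) \<le> norm (g F - z)"
proof -
  have fin: "finite ((\<lambda>F. norm (g F - z)) ` faces V E p)" "(\<lambda>F. norm (g F - z)) ` faces V E p \<noteq> {}"
    using dual.finite_V outer_face_in_faces by auto
  have "Max ((\<lambda>F. norm (g F - z)) ` faces V E p) \<in> (\<lambda>F. norm (g F - z)) ` faces V E p"
    using fin by (rule Max_in)
  then obtain F where F: "F \<in> faces V E p" "norm (g F - z) = Max ((\<lambda>F. norm (g F - z)) ` faces V E p)"
    by auto
  then show ?thesis using fin(1) by (intro bexI[of _ F]) auto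
qed

text \<open>
  Let \<open>z\<close> be far out in the sector between \<open>j0\<close> and its successor, and \<open>F\<close> the face with gradient
  farthest from \<open>z\<close>. Then \<open>F\<close> is extreme in the direction from \<open>z\<close> to \<open>g F\<close>, so it has a gap larger than
  \<open>\<pi>\<close> in the outer face of the reciprocal. Therefore it is the face in some sector of \<open>w\<close>, between \<open>j\<close>
  and its successor \<open>n\<close>, and the stresses on these two edges have the same sign. With
  \<open>e = z - g F\<close>, extremality shows that \<open>- e\<close> or \<open>e\<close> lies in this sector, according to whether they
  are valleys or ridges. In the first case \<open>g F \<bullet> (- e) < 0\<close>, because the surface descends in the
  sector of \<open>F\<close>; but \<open>g F \<bullet> e < 0\<close>, because \<open>F\<close> is more extreme than the outer face, whose gradient
  is \<open>0\<close>. So they are ridges and \<open>e\<close> lies in the sector. As \<open>z\<close> is far away, \<open>e\<close> also lies in the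
  sector of \<open>j0\<close>, and \<open>j = j0\<close>.
\<close>

lemma ridges_at_strict_maximum:
  assumes w: "w \<in> V" and nO: "p w \<notin> closure Out"
    and uniq: "\<And>v. v \<in> V \<Longrightarrow> recip_face v = outer_face (faces V E p) (dual_edges V E p) q \<Longrightarrow> v = w"
    and max: "\<forall>\<^sub>F y in at (p w). 1 * (h y - h (p w) - 0 \<bullet> (y - p w)) < 0"
    and wj0: "{w, j0} \<in> E"
  shows "c * \<omega> {w, j0} < 0"
proof -
  note conv = pointed_vertex(2)[OF w _ max, simplified]
  note left = pointed_vertex(3)[OF w _ max, simplified]
  note right = pointed_vertex(4)[OF w _ max, simplified]
  define n0 where "n0 = next_ccw w j0"
  have wn0: "{w, n0} \<in> E" using next_ccw_edge[OF wj0] by (simp add: n0_def)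
  define d where "d k = p k - p w" for k
  have nz: "d k \<noteq> 0" if "{w, k} \<in> E" for k using nbr_dir_nonzero[OF that] by (simp add: d_def)
  have cross_pos: "0 < (\<i> * d k) \<bullet> d (next_ccw w k)" if "{w, k} \<in> E" for k
    using conv[OF that] ccw_angle_less_pi_iff[OF nz[OF that] nz[OF next_ccw_edge[OF that]]]
    by (simp add: d_def)
  define K where "K = (\<i> * d j0) \<bullet> d n0"
  have K: "K > 0" using cross_pos[OF wj0] by (simp add: K_def n0_def)
  define bound where "bound F = \<bar>(\<i> * d j0) \<bullet> g F\<bar> + \<bar>(\<i> * g F) \<bullet> d n0\<bar>" for F
  \<comment> \<open>large enough for every \<open>z - g F\<close> to stay inside the sector of \<open>j0\<close>\<close>
  define T where "T = (1 + (\<Sum>F\<in>faces V E p. bound F)) / K"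
  define z where "z = T *\<^sub>R (d j0 + d n0)"
  have TK: "bound F < T * K" if "F \<in> faces V E p" for F
  proof -
    have "bound F \<le> (\<Sum>F\<in>faces V E p. bound F)"
      using that dual.finite_V by (intro member_le_sum) (auto simp: bound_def)
    then show ?thesis using K by (simp add: T_def)
  qed
  obtain F where F: "F \<in> faces V E p" "\<And>G. G \<in> faces V E p \<Longrightarrow> norm (g G - z) \<le> norm (g F - z)"
    using ex_farthest_face[of z] by blast
  define e where "e = z - g F"
  have ext: "0 < (g G - g F) \<bullet> e" if "G \<in> faces V E p" "G \<noteq> F" for G
  proof -
    have "g G \<noteq> g F" using gradient_inj[OF that(1) F(1)] that(2) by blast
    then have "(g G - g F) \<bullet> (g F - z) < 0" using F(2)[OF that(1)] by (rule farthest_point_extreme)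
    then have "0 < (g G - g F) \<bullet> (- (g F - z))" unfolding inner_minus_right by simp
    then show ?thesis by (simp add: e_def)
  qed
  have e_cone: "0 < (\<i> * d j0) \<bullet> e" "0 < (\<i> * e) \<bullet> d n0"
  proof -
    have "(\<i> * d j0) \<bullet> z = T * K"
      by (simp add: z_def inner_add_right K_def inner_rotate_self)
    then show "0 < (\<i> * d j0) \<bullet> e"
      using TK[OF F(1)] by (simp add: e_def inner_diff_right bound_def)
    have "(\<i> * z) \<bullet> d n0 = T * K"
      by (simp add: z_def K_def inner_complex_def algebra_simps)
    moreover have "(\<i> * e) \<bullet> d n0 = (\<i> * z) \<bullet> d n0 - (\<i> * g F) \<bullet> d n0"
      by (simp add: e_def right_diff_distrib inner_diff_left)
    ultimately show "0 < (\<i> * e) \<bullet> d n0"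
      using TK[OF F(1)] by (simp add: bound_def)
  qed
  obtain i k where ik: "{i, k} \<in> E" "F = lface i k"
    using face_has_edge[OF F(1) E_nonempty] by blast
  have "{F, lface k i} \<in> dual_edges V E p" using dual_edge_in[OF ik(1)] ik(2) by simp
  moreover have "(q G - q F) \<bullet> (- (e / rot)) < 0" if "G \<in> faces V E p" "G \<noteq> F" for G
  proof -
    have "g G - g F = rot * (q G - q F)"
      using gradient_eq[OF that(1)] gradient_eq[OF F(1)] by (simp add: right_diff_distrib)
    moreover have "e = rot * (e / rot)" using rot_nonzero by simp
    ultimately have "(g G - g F) \<bullet> e = (q G - q F) \<bullet> (e / rot)" using inner_rot by metis
    then show ?thesis using ext[OF that] unfolding inner_minus_right by simp
  qed
  ultimately obtain B where B: "{F, B} \<in> dual_edges V E p"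
    "dual.lface F B = outer_face (faces V E p) (dual_edges V E p) q"
    "pi < ccw_angle (q B - q F) (q (dual.next_ccw F B) - q F)"
    using dual.extreme_vertex_outer_gap[of F "lface k i" "- (e / rot)"] by blast
  obtain a j where aj: "{a, j} \<in> E" "F = lface a j" "B = lface j a" using dual_edgesE[OF B(1)] .
  have "a = w" using uniq[OF edgeD(2)[OF aj(1)]] recip_face_eq[OF aj(1)] B(2) aj(2,3) by simp
  then have wj: "{w, j} \<in> E" "F = lface w j" "B = lface j w" using aj by simp_all
  define n where "n = next_ccw w j"
  have wn: "{w, n} \<in> E" using next_ccw_edge[OF wj(1)] by (simp add: n_def)
  have Fn: "lface n w = F" using left_face_next_ccw[OF wj(1)] wj(2) by (simp add: n_def)
  have signs: "0 < \<omega> {w, j} * \<omega> {w, n}"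
    using consecutive_signs(2)[OF wj(1) conv[OF wj(1)]] B(3) wj(2,3) by (simp add: n_def)
  have "g B - g F = - (c * \<omega> {w, j}) *\<^sub>R (\<i> * d j)"
    using gradient_jump[OF wj(1)] wj(2,3) by (simp add: d_def algebra_simps)
  moreover have "B \<noteq> F" using left_right_distinct[OF wj(1)] wj(2,3) by simp
  ultimately have j_slope: "0 < - (c * \<omega> {w, j}) * ((\<i> * d j) \<bullet> e)"
    using ext[OF right_face_in_faces[OF wj(1)]] wj(3) by (metis inner_scaleR_left)
  have "g (lface w n) - g F = (c * \<omega> {w, n}) *\<^sub>R (\<i> * d n)"
    using gradient_jump[OF wn] Fn by (simp add: d_def)
  moreover have "lface w n \<noteq> F" using left_right_distinct[OF wn] Fn by simp
  ultimately have n_slope: "0 < (c * \<omega> {w, n}) * ((\<i> * d n) \<bullet> e)"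
    using ext[OF left_face_in_faces[OF wn]] by (metis inner_scaleR_left)
  have jn: "0 < (\<i> * d j) \<bullet> d n" using cross_pos[OF wj(1)] by (simp add: n_def)
  have gF: "g F \<bullet> d j < 0" "g F \<bullet> d n < 0"
    using left[OF wj(1)] right[OF wn] wj(2) Fn by (simp_all add: d_def)
  have "Out \<noteq> F"
    using nO edge_pt_in_closures(1)[OF wj(1), of 0] wj(2) by (auto simp: edge_pt_endpoints)
  then have gFe: "g F \<bullet> e < 0"
    using ext[OF outer_face_in_faces] gradient_outer by simp
  define s where "s k = c * \<omega> {w, k}" for k
  have same: "0 < s j * s n" using signs c_cases by (auto simp: s_def)
  have j_slope: "s j * ((\<i> * d j) \<bullet> e) < 0" using j_slope unfolding s_def[symmetric] by simp
  have n_slope: "0 < s n * ((\<i> * d n) \<bullet> e)" using n_slope by (simp only: s_def)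
  have ridge: "s j < 0"
  proof (rule ccontr)
    assume "\<not> s j < 0"
    then have pos: "0 < s j" "0 < s n" using same by (auto simp: zero_less_mult_iff)
    have 1: "0 < (\<i> * d j) \<bullet> (- e)" using j_slope pos(1) by (simp add: mult_less_0_iff)
    have "0 < (\<i> * d n) \<bullet> e" using n_slope pos(2) by (simp add: zero_less_mult_iff)
    then have 2: "0 < (\<i> * (- e)) \<bullet> d n" using cross_swap[of "d n" e] by simp
    have "g F \<bullet> (- e) < 0" by (rule inner_neg_on_cone[OF jn 1 2 gF])
    then show False using gFe by simp
  qed
  then have "s n < 0" using same by (auto simp: zero_less_mult_iff)
  then have "(\<i> * d n) \<bullet> e < 0" using n_slope by (simp add: zero_less_mult_iff)
  then have e2: "0 < (\<i> * e) \<bullet> d n" using cross_swap[of "d n" e] by simp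
  have e1: "0 < (\<i> * d j) \<bullet> e" using j_slope ridge by (simp add: mult_less_0_iff)
  have "j = j0"
  proof (rule sectors_disjoint[OF wj(1) wj0])
    show "e \<noteq> 0" using e1 by auto
    show "ccw_angle (p j - p w) e < ccw_angle (p j - p w) (p (next_ccw w j) - p w)"
      using ccw_angle_less_on_cone[OF jn e1 e2] by (simp add: d_def n_def)
    show "ccw_angle (p j0 - p w) e < ccw_angle (p j0 - p w) (p (next_ccw w j0) - p w)"
      using ccw_angle_less_on_cone[OF _ e_cone] K by (simp add: K_def d_def n0_def)
  qed
  then show ?thesis using ridge by (simp add: s_def)
qed

section \<open>The extrema of the standard lifting\<close>

lemma h_closure_outer: "x \<in> closure Out \<Longrightarrow> h x = 0"
proof -
  assume x: "x \<in> closure Out"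
  obtain z where z: "z \<in> Out" using O_nonempty by blast
  show "h x = 0"
    using h_diff[OF outer_face_in_faces mem_closureI[OF z] x] h_outer[OF z] gradient_outer by simp
qed

text \<open>
  The boundary edges being valleys, the lifting rises from the outer face across them.
\<close>

lemma ex_positive_height: "\<exists>x. 0 < h x"
proof -
  obtain i j where ij: "{i, j} \<in> E" "Out = lface i j"
    using face_has_edge[OF outer_face_in_faces E_nonempty] by blast
  define n where "n = \<i> * (p j - p i)"
  define m where "m = edge_pt i j (1/2) 0"
  have n: "0 < n \<bullet> n" using nbr_dir_nonzero[OF ij(1)] by (simp add: n_def)
  have ji: "{j, i} \<in> E" using ij(1) by (simp add: insert_commute)
  have pos: "0 < c * \<omega> {i, j}"
    using edges_of_face_iff[OF ij(1) outer_face_in_faces] ij(2)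
    by (intro boundary_valley) (simp add: boundary_edges_def)
  have "- g (lface j i) = (c * \<omega> {i, j}) *\<^sub>R n"
    using gradient_jump[OF ij(1)] gradient_outer ij(2) by (simp add: n_def)
  then have gR: "g (lface j i) = - (c * \<omega> {i, j}) *\<^sub>R n"
    by (metis minus_minus scaleR_minus_left)
  obtain \<delta> where \<delta>: "\<delta> > 0" "\<And>t. 0 < t \<Longrightarrow> t < \<delta> \<Longrightarrow> edge_pt j i (1/2) t \<in> lface j i"
    using strip_in_left_face[OF ji, of "1/2" "1/2"] by auto
  define y where "y = edge_pt j i (1/2) (\<delta>/2)"
  have y: "y \<in> closure (lface j i)" using \<delta> by (auto simp: y_def intro: mem_closureI)
  have m: "m \<in> closure Out" "m \<in> closure (lface j i)"
    using edge_pt_in_closures[OF ij(1), of "1/2"] ij(2) by (simp_all add: m_def)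
  have "y - m = - (\<delta> / 2) *\<^sub>R n"
    by (simp add: y_def m_def edge_pt_def n_def complex_eq_iff algebra_simps)
  then have "h y - h m = (c * \<omega> {i, j}) * (\<delta> / 2) * (n \<bullet> n)"
    using h_diff[OF right_face_in_faces[OF ij(1)] m(2) y] by (simp add: gR)
  moreover have "0 < (c * \<omega> {i, j}) * (\<delta> / 2) * (n \<bullet> n)"
    using mult_pos_pos[OF mult_pos_pos[OF pos half_gt_zero[OF \<delta>(1)]] n] .
  ultimately have "0 < h y - h m" by metis
  then show ?thesis using h_closure_outer[OF m(1)] by auto
qed

text \<open>
  The complement of the outer face is compact, and \<open>h\<close> vanishes outside it.
\<close>

lemma global_extremum:
  assumes \<sigma>: "\<sigma> = 1 \<or> \<sigma> = -1" and x0: "0 < \<sigma> * h x0"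
  shows "\<exists>x. 0 < \<sigma> * h x \<and> (\<forall>y. \<sigma> * h y \<le> \<sigma> * h x)"
proof -
  have "bounded (- Out)"
    unfolding outer_face_def using compact_D compact_imp_bounded by (intro cobounded_outside) blast
  then have "compact (- Out)"
    using open_face[OF outer_face_in_faces] by (simp add: compact_eq_bounded_closed closed_Compl)
  moreover have "x0 \<in> - Out" using x0 h_outer by auto
  moreover have "continuous_on (- Out) (\<lambda>x. \<sigma> * h x)"
    by (intro continuous_intros continuous_on_subset[OF continuous_h]) auto
  ultimately obtain x where x: "x \<in> - Out" "\<And>y. y \<in> - Out \<Longrightarrow> \<sigma> * h y \<le> \<sigma> * h x"
    using continuous_attains_sup[of "- Out" "\<lambda>x. \<sigma> * h x"] by blast
  have pos: "0 < \<sigma> * h x" using x(2)[OF \<open>x0 \<in> - Out\<close>] x0 by linarith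
  have "\<sigma> * h y \<le> \<sigma> * h x" for y
    using x(2)[of y] pos h_outer[of y] by (cases "y \<in> Out") auto
  then show ?thesis using pos by blast
qed

lemma extrema_and_pointed_points:
  "\<exists>v\<in>V. {x. x \<notin> Out \<and> local_max_at h x} = {p v} \<and>
     (\<forall>x. x \<noteq> p v \<longrightarrow> h x < h (p v)) \<and>
     is_reciprocal_face V E p q v (outer_face (faces V E p) (dual_edges V E p) q) \<and>
     (\<forall>e\<in>E. v \<in> e \<longrightarrow> (\<forall>f\<in>boundary_edges V E p. sgn (\<omega> e) = - sgn (\<omega> f))) \<and>
     {P \<in> lifted_surface h. pointed_at (lifted_surface h) P} = {(p v, h (p v))}"
  "{x. local_min_at h x} = closure Out"
proof -
  obtain w where w: "w \<in> V" "recip_face w = outer_face (faces V E p) (dual_edges V E p) q"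
    "\<And>v. v \<in> V \<Longrightarrow> recip_face v = outer_face (faces V E p) (dual_edges V E p) q \<Longrightarrow> v = w"
    "\<And>v y. v \<in> V \<Longrightarrow> y \<notin> dual.D \<Longrightarrow> 0 < winding v y \<Longrightarrow> v = w"
    using ex_outer_vertex by blast
  have only_w: "v = w" if "v \<in> V" "\<sigma> = 1 \<or> \<sigma> = -1"
    "\<forall>\<^sub>F y in at (p v). \<sigma> * (h y - h (p v) - a \<bullet> (y - p v)) < 0" for v \<sigma> a
    using pointed_vertex(1)[OF that] w(4)[OF that(1)] by blast
  have ext_w: "x = p w \<and> (\<forall>\<^sub>F y in at (p w). \<sigma> * (h y - h (p w) - 0 \<bullet> (y - p w)) < 0)"
    if ext: "local_extremum \<sigma> x" "x \<notin> closure Out" for \<sigma> x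
  proof -
    obtain v where v: "v \<in> V" "x = p v" "\<sigma> = 1 \<or> \<sigma> = -1"
      "\<forall>\<^sub>F y in at (p v). \<sigma> * (h y - h (p v) - 0 \<bullet> (y - p v)) < 0"
      using local_extremum_pointed[OF ext] .
    then have "v = w" by (intro only_w)
    then show ?thesis using v(2,4) by simp
  qed
  have global_ext: "local_extremum \<sigma> x" if "\<sigma> = 1 \<or> \<sigma> = -1" "\<forall>y. \<sigma> * h y \<le> \<sigma> * h x" for \<sigma> x
    using that by (simp add: local_extremum_def)
  have off: "x \<notin> closure Out" if "h x \<noteq> 0" for x using that h_closure_outer by blast
  obtain x0 where "0 < h x0" using ex_positive_height by blast
  then obtain x where x: "0 < h x" "\<And>y. h y \<le> h x"
    using global_extremum[of 1 x0] by auto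
  then have "local_extremum 1 x" "x \<notin> closure Out" using global_ext[of 1 x] off[of x] by auto
  then have xw: "x = p w"
    and max: "\<forall>\<^sub>F y in at (p w). 1 * (h y - h (p w) - 0 \<bullet> (y - p w)) < 0"
    using ext_w[of 1 x] by auto
  have wO: "p w \<notin> closure Out" using \<open>x \<notin> closure Out\<close> xw by simp
  have strict: "h y < h (p w)" if "y \<noteq> p w" for y
  proof (rule ccontr)
    assume "\<not> h y < h (p w)"
    then have "h y = h x" using x(2)[of y] xw by simp
    then have "local_extremum 1 y" "y \<notin> closure Out" using global_ext[of 1 y] x off[of y] by auto
    then show False using ext_w[of 1 y] that by simp
  qed
  have nonneg: "0 \<le> h y" for y
  proof (rule ccontr)
    assume "\<not> 0 \<le> h y"
    then obtain z where z: "0 < -1 * h z" "\<And>y. -1 * h y \<le> -1 * h z"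
      using global_extremum[of "-1" y] by auto
    then have "local_extremum (-1) z" "z \<notin> closure Out" using global_ext[of "-1" z] off[of z] by auto
    then have "z = p w" using ext_w[of "-1" z] by simp
    then show False using z(1) x(1) xw by simp
  qed
  have loc_max: "x' = p w" if "x' \<notin> Out" "local_max_at h x'" for x'
  proof (cases "x' \<in> closure Out")
    case False
    have "local_extremum 1 x'" using that(2) by (simp add: local_max_at_def local_extremum_def)
    then show ?thesis using ext_w False by blast
  next
    case True
    have "h x' = 0" using h_closure_outer[OF True] .
    then have zero: "\<forall>\<^sub>F y in nhds x'. h y = 0"
      using that(2) nonneg unfolding local_max_at_def by (auto elim!: eventually_mono intro: antisym)
    have "x' \<in> D"
    proof (rule ccontr)
      assume "x' \<notin> D"
      then obtain F where F: "F \<in> faces V E p" "x' \<in> F" using off_D_in_face by blast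
      then have "F \<inter> Out \<noteq> {}" using True open_face[OF F(1)] open_Int_closure_eq_empty by blast
      then show False using faces_eqI[OF F(1) outer_face_in_faces] F(2) that(1) by blast
    qed
    then obtain i j where ij: "{i, j} \<in> E" "x' \<in> closure (lface i j)" "x' \<in> closure (lface j i)"
    proof (cases rule: on_D_cases)
      case (1 v)
      obtain k where "{v, k} \<in> E" using ex_nbr[OF 1(1)] by blast
      then show thesis
        using that[of v k] edge_pt_in_closures[of v k 0] 1(2) by (simp add: edge_pt_endpoints)
    next
      case (2 i j s)
      then show thesis using that[of i j] edge_pt_in_closures[of i j s] by simp
    qed
    \<comment> \<open>Near \<open>x'\<close> the lifting would be constant on a face other than the outer one.\<close>
    then obtain F where F: "F \<in> faces V E p" "F \<noteq> Out" "x' \<in> closure F"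
      using left_right_distinct[OF ij(1)] left_face_in_faces[OF ij(1)] right_face_in_faces[OF ij(1)] by metis
    obtain U where U: "open U" "x' \<in> U" "\<And>y. y \<in> U \<Longrightarrow> h y = 0"
      using zero by (auto simp: eventually_nhds)
    obtain y where y: "y \<in> U" "y \<in> F" using F(3) U(1,2) open_Int_closure_eq_empty by blast
    have "\<forall>\<^sub>F z in nhds y. h z \<le> h y"
      using eventually_nhds_in_open[OF U(1) y(1)] by (rule eventually_mono) (simp add: U(3) y(1))
    then have "local_extremum 1 y" by (simp add: local_extremum_def)
    then show ?thesis using local_extremum_in_face[OF _ F(1) y(2)] F(2) by blast
  qed
  have 1: "{x. x \<notin> Out \<and> local_max_at h x} = {p w}"
  proof -
    have "local_max_at h (p w)" using x(2) xw by (simp add: local_max_at_def)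
    moreover have "p w \<notin> Out" using wO mem_closureI by blast
    ultimately show ?thesis using loc_max by blast
  qed
  have 2: "\<forall>e\<in>E. w \<in> e \<longrightarrow> (\<forall>f\<in>boundary_edges V E p. sgn (\<omega> e) = - sgn (\<omega> f))"
  proof (intro ballI impI)
    fix e f assume e: "e \<in> E" "w \<in> e" and f: "f \<in> boundary_edges V E p"
    obtain j where j: "e = {w, j}" using edgeE[OF e(1)] e(2) by auto
    have "c * \<omega> e < 0" using ridges_at_strict_maximum[OF w(1) wO w(3) max] e(1) j by blast
    moreover have "0 < c * \<omega> f" using boundary_valley[OF f] .
    ultimately show "sgn (\<omega> e) = - sgn (\<omega> f)" using c_cases by auto
  qed
  have 3: "{P \<in> lifted_surface h. pointed_at (lifted_surface h) P} = {(p w, h (p w))}"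
  proof -
    have "P = (p w, h (p w))" if P: "P \<in> lifted_surface h" "pointed_at (lifted_surface h) P" for P
    proof -
      obtain x where x: "P = (x, h x)" using P(1) by (auto simp: lifted_surface_def)
      obtain v \<sigma> a where v: "v \<in> V" "x = p v" "\<sigma> = 1 \<or> \<sigma> = -1"
        "\<forall>\<^sub>F y in at (p v). \<sigma> * (h y - h (p v) - a \<bullet> (y - p v)) < 0"
        using pointed_is_vertex[OF P(2)[unfolded x]] .
      have "v = w" by (rule only_w[OF v(1,3,4)])
      then show ?thesis using x v(2) by simp
    qed
    moreover have "pointed_at (lifted_surface h) (p w, h (p w))"
      unfolding pointed_at_def
    proof (intro exI[of _ "(0, 1)"] conjI)
      show "\<forall>\<^sub>F Q in at (p w, h (p w)) within lifted_surface h. (0, 1) \<bullet> Q < (0, 1) \<bullet> (p w, h (p w))"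
        unfolding eventually_at_filter using strict
        by (intro always_eventually) (auto simp: lifted_surface_def)
    qed (simp add: zero_prod_def)
    ultimately show ?thesis by (auto simp: lifted_surface_def)
  qed
  show "\<exists>v\<in>V. {x. x \<notin> Out \<and> local_max_at h x} = {p v} \<and>
     (\<forall>x. x \<noteq> p v \<longrightarrow> h x < h (p v)) \<and>
     is_reciprocal_face V E p q v (outer_face (faces V E p) (dual_edges V E p) q) \<and>
     (\<forall>e\<in>E. v \<in> e \<longrightarrow> (\<forall>f\<in>boundary_edges V E p. sgn (\<omega> e) = - sgn (\<omega> f))) \<and>
     {P \<in> lifted_surface h. pointed_at (lifted_surface h) P} = {(p v, h (p v))}"
    using w(1) 1 strict reciprocal_face_of_outer_vertex[OF w(1-3)] 2 3 by blast
  show "{x. local_min_at h x} = closure Out"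
  proof (intro set_eqI iffI)
    fix x assume "x \<in> closure Out"
    then show "x \<in> {x. local_min_at h x}"
      using h_closure_outer nonneg by (simp add: local_min_at_def)
  next
    fix z assume "z \<in> {x. local_min_at h x}"
    then have ext: "local_extremum (-1) z" by (simp add: local_min_at_def local_extremum_def)
    show "z \<in> closure Out"
    proof (rule ccontr)
      assume "z \<notin> closure Out"
      then have "\<forall>\<^sub>F y in at (p w). -1 * (h y - h (p w) - 0 \<bullet> (y - p w)) < 0"
        using ext_w[OF ext] by blast
      with max have "\<forall>\<^sub>F y in at (p w). False" by eventually_elim simp
      then show False by simp
    qed
  qed
qed

end

theorem theorem10:
  fixes V :: "'v set" and E :: "'v set set" and p :: "'v \<Rightarrow> complex"
    and \<omega> :: "'v set \<Rightarrow> real" and q :: "complex set \<Rightarrow> complex" and h :: "complex \<Rightarrow> real"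
  assumes "noncrossing_framework V E p"
    and "two_connected V E"
    and "self_stress V E p \<omega>"
    and "\<forall>e\<in>E. \<omega> e \<noteq> 0"
    and "is_reciprocal V E p \<omega> q"
    and "noncrossing_reciprocal V E p q"
    and "standard_lifting V E p \<omega> h"
  shows "(\<exists>v\<in>V.
       \<comment> \<open>Points of the open outer face, where h is constantly 0, are local maxima only in the
          weak sense; they are not counted.\<close>
       {x. x \<notin> outer_face V E p \<and> local_max_at h x} = {p v} \<and>
       (\<forall>x. x \<noteq> p v \<longrightarrow> h x < h (p v)) \<and>
       is_reciprocal_face V E p q v (outer_face (faces V E p) (dual_edges V E p) q) \<and>
       (\<forall>e\<in>E. v \<in> e \<longrightarrow> (\<forall>f\<in>boundary_edges V E p. sgn (\<omega> e) = - sgn (\<omega> f))) \<and>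
       {P \<in> lifted_surface h. pointed_at (lifted_surface h) P} = {(p v, h (p v))}) \<and>
     {x. local_min_at h x} = closure (outer_face V E p)"
proof -
  interpret reciprocal_pair V E p \<omega> q
    using assms(1,2,4-6) by unfold_locales auto
  obtain c g where lift: "continuous_on UNIV h" "\<forall>x\<in>outer_face V E p. h x = 0" "c = 1 \<or> c = - 1"
    "\<forall>F\<in>faces V E p. \<exists>b. \<forall>x\<in>F. h x = g F \<bullet> x + b"
    "\<forall>e\<in>boundary_edges V E p. 0 < c * \<omega> e"
    "\<forall>i j. {i, j} \<in> E \<longrightarrow> g (left_face V E p i j) - g (left_face V E p j i) =
        (c * \<omega> {i, j}) *\<^sub>R (\<i> * (p j - p i))"
    using assms(7) unfolding standard_lifting_def by blast
  have "dual_embedding_reversed V E p q"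
    using assms(6) same_embedding_impossible[OF lift(3)] lift(5)
    by (auto simp: noncrossing_reciprocal_def)
  then interpret lifted_pair V E p \<omega> q h c g
    using lift by unfold_locales auto
  show ?thesis using extrema_and_pointed_points by blast
qed

end
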